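(* Let $A\in\mathcal B(H)^d_{sa}$, let $\mathcal S=\mathcal W(A)$, and suppose that $0\in\mathcal S$. If $B\in\mathcal B(K)^d_{sa}$ and the map $S_A\to S_B$ given by $I\mapsto I$, $A_i\mapsto B_i$ ($i=1,\dots,d$) is (well defined and) positive, then the map given by $I\mapsto I$, $A_i\mapsto\sigma_{\mathcal S}B_i$ ($i=1,\dots,d$) is completely positive. Moreover $\sigma_{\mathcal S}$ is the optimal (largest) constant that works for all $B$. Likewise, if $B\in\mathcal B(K)^d_{sa}$ and the map $S_B\to S_A$ given by $I\mapsto I$, $B_i\mapsto A_i$ ($i=1,\dots,d$) is (well defined and) positive, then the map given by $I\mapsto I$, $B_i\mapsto\rho_{\mathcal S}A_i$ ($i=1,\dots,d$) is completely positive. Moreover $\rho_{\mathcal S}$ is the optimal (largest) constant that works for all $B$. If $0\in\operatorname{int}\mathcal W_1(A)$, then $\rho_{\mathcal S}>0$ and $\sigma_{\mathcal S}>0$. If there are a constant $C>0$ and rank one real $d\times d$ matrices $\lambda^{(1)},\dots,\lambda^{(k)}$ with $I_d\in\operatorname{conv}\{\lambda^{(1)},\dots,\lambda^{(k)}\}$ and $\lambda^{(m)}\mathcal W_1(A)\subseteq C\,\mathcal W_1(A)$ for all $m$, then $\rho_{\mathcal S}\ge\frac1C$ and $\sigma_{\mathcal S}\ge\frac1C$. In particular, if $\mathcal W_1(A)$ is invariant under projections onto an isometric tight frame, then both $\rho_{\mathcal S}$ and $\sigma_{\mathcal S}$ are bounded below by $\frac1d$.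
   Context: $\mathcal B(H)^d_{sa}$ (resp. $(M_n)^d_{sa}$) is the set of $d$-tuples of bounded self-adjoint operators on $H$ (resp. self-adjoint $n\times n$ complex matrices). $S_A=\operatorname{span}\{I,A_1,\dots,A_d\}$, $C^*(S_A)$ is the unital C*-algebra generated by $A$, and $\mathcal W(A)=\bigcup_n\mathcal W_n(A)$ is the matrix range, $\mathcal W_n(A)=\{(\phi(A_1),\dots,\phi(A_d)):\phi:C^*(S_A)\to M_n\text{ unital completely positive}\}$; $\mathcal W_1(A)\subseteq\mathbb R^d$. A set $\mathcal T=\bigcup_n\mathcal T_n$, $\mathcal T_n\subseteq(M_n)^d_{sa}$, is matrix convex if it is closed under direct sums and under UCP maps $M_n\to M_k$ applied coordinatewise. For a closed matrix convex set $\mathcal S$ containing $0$: $\rho_{\mathcal S}=\inf_n\rho_{\mathcal S}(n)$, where $\rho_{\mathcal S}(n)=\sup\{t\ge0: t\,\mathcal S_n\subseteq\mathcal T_n\text{ for every matrix convex set }\mathcal T\text{ with }\mathcal S_1\subseteq\mathcal T_1\}$. The number $\sigma_{\mathcal S}$ is the largest constant $\sigma\ge0$ such that for every matrix convex set $\mathcal T$, $\mathcal T_1\subseteq\mathcal S_1$ implies $\sigma\mathcal T\subseteq\mathcal S$. In the degenerate case $\mathcal S_1=\{0\}$ (i.e. $A=0$) these numbers are $+\infty$ and the convention $\infty\cdot0=0$ is used. A finite set $\{v_1,\dots,v_N\}\subset\mathbb R^d$ is an isometric tight frame if all $v_i$ have the same length $\ell>0$ and $\sum_iv_iv_i^*=\sigma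 I$ for some $\sigma>0$; $E\subseteq\mathbb R^d$ is invariant under projections onto it if $\frac1{\ell^2}v_iv_i^*(E)\subseteq E$ for all $i$. *)

theory Defs
  imports "Jordan_Normal_Form.Schur_Decomposition" "HOL-Analysis.Analysis"
begin

section \<open>Complex Hilbert spaces\<close>

class scaleC =
  fixes scaleC :: "complex \<Rightarrow> 'a \<Rightarrow> 'a" (infixr \<open>*\<^sub>C\<close> 75)

text \<open>The inner product is antilinear in its first argument. Completeness is part of
  \<^class>\<open>banach\<close>; positive definiteness follows from \<open>cinner_self\<close>.\<close>

class complex_hilbert = banach + scaleC +
  fixes cinner :: "'a \<Rightarrow> 'a \<Rightarrow> complex"
  assumes scaleC_add_right: "c *\<^sub>C (x + y) = c *\<^sub>C x + c *\<^sub>C y"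
    and scaleC_add_left: "(c + d) *\<^sub>C x = c *\<^sub>C x + d *\<^sub>C x"
    and scaleC_scaleC: "c *\<^sub>C d *\<^sub>C x = (c * d) *\<^sub>C x"
    and scaleC_of_real: "complex_of_real r *\<^sub>C x = scaleR r x"
    and cinner_commute: "cinner x y = cnj (cinner y x)"
    and cinner_add_right: "cinner x (y + z) = cinner x y + cinner x z"
    and cinner_scaleC_right: "cinner x (c *\<^sub>C y) = c * cinner x y"
    and cinner_self: "cinner x x = complex_of_real ((norm x)\<^sup>2)"
begin

lemma norm_scaleC: "norm (c *\<^sub>C x) = cmod c * norm x"
proof -
  have "complex_of_real ((norm (c *\<^sub>C x))\<^sup>2) = c * cinner (c *\<^sub>C x) x"
    by (metis cinner_self cinner_scaleC_right)
  also have "cinner (c *\<^sub>C x) x = cnj c * cinner x x"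
    by (metis cinner_commute cinner_scaleC_right complex_cnj_mult)
  also have "c * (cnj c * cinner x x) = complex_of_real ((cmod c * norm x)\<^sup>2)"
    by (simp add: cinner_self power_mult_distrib complex_norm_square flip: mult.assoc del: of_real_power)
  finally have "(norm (c *\<^sub>C x))\<^sup>2 = (cmod c * norm x)\<^sup>2"
    using of_real_eq_iff by blast
  then show ?thesis by simp
qed

end

subsection \<open>The space of square summable sequences\<close>

text \<open>Types cannot be quantified inside a formula, so the class of all Hilbert spaces is not available
  there; this concrete infinite dimensional space serves as the test space for optimality claims.\<close>

typedef ell2 = "{f :: nat \<Rightarrow> complex. summable (\<lambda>n. (cmod (f n))\<^sup>2)}"
  by (rule exI[of _ "\<lambda>_. 0"]) simp

setup_lifting type_definition_ell2

lemma ell2_add_summable: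
  fixes f g :: "nat \<Rightarrow> complex"
  assumes "summable (\<lambda>n. (cmod (f n))\<^sup>2)" "summable (\<lambda>n. (cmod (g n))\<^sup>2)"
  shows "summable (\<lambda>n. (cmod (f n + g n))\<^sup>2)"
proof (rule summable_comparison_test')
  show "summable (\<lambda>n. 2 * (cmod (f n))\<^sup>2 + 2 * (cmod (g n))\<^sup>2)"
    using assms by (intro summable_add summable_mult)
  fix n
  have "(cmod (f n + g n))\<^sup>2 \<le> (cmod (f n) + cmod (g n))\<^sup>2"
    by (intro power_mono norm_triangle_ineq) simp
  also have "\<dots> \<le> 2 * (cmod (f n))\<^sup>2 + 2 * (cmod (g n))\<^sup>2"
    using sum_squares_bound[of "cmod (f n)" "cmod (g n)"] by (simp add: power2_sum)
  finally show "norm ((cmod (f n + g n))\<^sup>2) \<le> 2 * (cmod (f n))\<^sup>2 + 2 * (cmod (g n))\<^sup>2"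
    by simp
qed

lemma ell2_scale_summable:
  fixes f :: "nat \<Rightarrow> complex"
  assumes "summable (\<lambda>n. (cmod (f n))\<^sup>2)"
  shows "summable (\<lambda>n. (cmod (c * f n))\<^sup>2)"
  using summable_mult[OF assms, of "(cmod c)\<^sup>2"] by (simp add: norm_mult power_mult_distrib)

lemma ell2_inner_summable:
  fixes f g :: "nat \<Rightarrow> complex"
  assumes "summable (\<lambda>n. (cmod (f n))\<^sup>2)" "summable (\<lambda>n. (cmod (g n))\<^sup>2)"
  shows "summable (\<lambda>n. cnj (f n) * g n)"
proof (rule summable_comparison_test')
  show "summable (\<lambda>n. (cmod (f n))\<^sup>2 + (cmod (g n))\<^sup>2)"
    using assms by (intro summable_add)
  fix n
  have "2 * (cmod (f n) * cmod (g n)) \<le> (cmod (f n))\<^sup>2 + (cmod (g n))\<^sup>2"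
    using sum_squares_bound[of "cmod (f n)" "cmod (g n)"] by simp
  moreover have "0 \<le> cmod (f n) * cmod (g n)" by simp
  ultimately have "cmod (f n) * cmod (g n) \<le> (cmod (f n))\<^sup>2 + (cmod (g n))\<^sup>2" by linarith
  then show "norm (cnj (f n) * g n) \<le> (cmod (f n))\<^sup>2 + (cmod (g n))\<^sup>2"
    by (simp add: norm_mult)
qed

instantiation ell2 :: real_normed_vector
begin

lift_definition zero_ell2 :: ell2 is "\<lambda>_. 0" by simp
lift_definition plus_ell2 :: "ell2 \<Rightarrow> ell2 \<Rightarrow> ell2" is "\<lambda>f g n. f n + g n"
  by (rule ell2_add_summable)
lift_definition uminus_ell2 :: "ell2 \<Rightarrow> ell2" is "\<lambda>f n. - f n" by simp
lift_definition minus_ell2 :: "ell2 \<Rightarrow> ell2 \<Rightarrow> ell2" is "\<lambda>f g n. f n - g n"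
proof -
  fix f g :: "nat \<Rightarrow> complex"
  assume "summable (\<lambda>n. (cmod (f n))\<^sup>2)" "summable (\<lambda>n. (cmod (g n))\<^sup>2)"
  then show "summable (\<lambda>n. (cmod (f n - g n))\<^sup>2)"
    using ell2_add_summable[of f "\<lambda>n. - g n"] by simp
qed
lift_definition scaleR_ell2 :: "real \<Rightarrow> ell2 \<Rightarrow> ell2" is "\<lambda>r f n. complex_of_real r * f n"
  by (rule ell2_scale_summable)
lift_definition norm_ell2 :: "ell2 \<Rightarrow> real" is "\<lambda>f. sqrt (\<Sum>n. (cmod (f n))\<^sup>2)" .
definition sgn_ell2 :: "ell2 \<Rightarrow> ell2" where "sgn_ell2 x = scaleR (inverse (norm x)) x"
definition dist_ell2 :: "ell2 \<Rightarrow> ell2 \<Rightarrow> real" where "dist_ell2 x y = norm (x - y)"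
definition uniformity_ell2 :: "(ell2 \<times> ell2) filter" where
  "uniformity_ell2 = (INF e\<in>{0<..}. principal {(x, y). dist x y < e})"
definition open_ell2 :: "ell2 set \<Rightarrow> bool" where
  "open_ell2 U = (\<forall>x\<in>U. \<forall>\<^sub>F (x', y) in uniformity. x' = x \<longrightarrow> y \<in> U)"

lemma Rep_ell2_summable: "summable (\<lambda>n. (cmod (Rep_ell2 x n))\<^sup>2)"
  using Rep_ell2[of x] by simp

lemma ell2_L2_set_le: "L2_set (\<lambda>n. cmod (Rep_ell2 x n)) {..<k} \<le> norm x"
  unfolding norm_ell2.rep_eq L2_set_def
  by (intro real_sqrt_le_mono sum_le_suminf Rep_ell2_summable) auto

lemma ell2_norm_le:
  assumes "\<And>k. L2_set (\<lambda>n. cmod (Rep_ell2 x n)) {..<k} \<le> B"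
  shows "norm x \<le> B"
proof -
  have B: "0 \<le> B" using assms[of 0] by simp
  have "(\<Sum>n. (cmod (Rep_ell2 x n))\<^sup>2) \<le> B\<^sup>2"
  proof (rule suminf_le_const[OF Rep_ell2_summable])
    fix k
    have "sqrt (\<Sum>n<k. (cmod (Rep_ell2 x n))\<^sup>2) \<le> B"
      using assms[of k] by (simp add: L2_set_def)
    then show "(\<Sum>n<k. (cmod (Rep_ell2 x n))\<^sup>2) \<le> B\<^sup>2"
      by (rule sqrt_le_D)
  qed
  then show ?thesis
    unfolding norm_ell2.rep_eq using B real_le_lsqrt by blast
qed

instance
proof
  fix x y z :: ell2 and r s :: real
  show "x + y + z = x + (y + z)" by transfer (simp add: add.assoc)
  show "x + y = y + x" by transfer (simp add: add.commute)
  show "0 + x = x" by transfer simp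
  show "- x + x = 0" by transfer simp
  show "x - y = x + - y" by transfer simp
  show "r *\<^sub>R (x + y) = r *\<^sub>R x + r *\<^sub>R y" by transfer (simp add: distrib_left)
  show "(r + s) *\<^sub>R x = r *\<^sub>R x + s *\<^sub>R x" by transfer (simp add: distrib_right)
  show "r *\<^sub>R s *\<^sub>R x = (r * s) *\<^sub>R x" by transfer (simp add: mult.assoc)
  show "1 *\<^sub>R x = x" by transfer simp
  show "sgn x = scaleR (inverse (norm x)) x" by (rule sgn_ell2_def)
  show "dist x y = norm (x - y)" by (rule dist_ell2_def)
  show "(uniformity :: (ell2 \<times> ell2) filter) = (INF e\<in>{0<..}. principal {(x, y). dist x y < e})"
    by (rule uniformity_ell2_def)
  show "open U = (\<forall>x\<in>U. \<forall>\<^sub>F (x', y) in uniformity. x' = x \<longrightarrow> y \<in> U)" for U :: "ell2 set"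
    by (rule open_ell2_def)
  show "(norm x = 0) = (x = 0)"
  proof
    assume "norm x = 0"
    then have "(\<Sum>n. (cmod (Rep_ell2 x n))\<^sup>2) = 0" by (simp add: norm_ell2.rep_eq)
    then have "\<forall>n. (cmod (Rep_ell2 x n))\<^sup>2 = 0"
      using suminf_eq_zero_iff[OF Rep_ell2_summable] by simp
    then have "Rep_ell2 x = Rep_ell2 0" by (simp add: zero_ell2.rep_eq fun_eq_iff)
    then show "x = 0" by (simp add: Rep_ell2_inject)
  next
    assume "x = 0"
    then show "norm x = 0" by (simp add: norm_ell2.rep_eq zero_ell2.rep_eq)
  qed
  show "norm (x + y) \<le> norm x + norm y"
  proof (rule ell2_norm_le)
    fix k
    have "L2_set (\<lambda>n. cmod (Rep_ell2 (x + y) n)) {..<k}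
        \<le> L2_set (\<lambda>n. cmod (Rep_ell2 x n) + cmod (Rep_ell2 y n)) {..<k}"
      by (intro L2_set_mono) (auto simp: plus_ell2.rep_eq norm_triangle_ineq)
    also have "\<dots> \<le> L2_set (\<lambda>n. cmod (Rep_ell2 x n)) {..<k}
        + L2_set (\<lambda>n. cmod (Rep_ell2 y n)) {..<k}"
      by (rule L2_set_triangle_ineq)
    also have "\<dots> \<le> norm x + norm y"
      by (intro add_mono ell2_L2_set_le)
    finally show "L2_set (\<lambda>n. cmod (Rep_ell2 (x + y) n)) {..<k} \<le> norm x + norm y" .
  qed
  show "norm (r *\<^sub>R x) = \<bar>r\<bar> * norm x"
    by (simp add: norm_ell2.rep_eq scaleR_ell2.rep_eq norm_mult power_mult_distrib
        suminf_mult[OF Rep_ell2_summable] real_sqrt_mult)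
qed

end

instance ell2 :: banach
proof
  have rep_diff: "Rep_ell2 (x - y) n = Rep_ell2 x n - Rep_ell2 y n" for x y n
    by (simp add: minus_ell2.rep_eq)
  have coord: "cmod (Rep_ell2 x n) \<le> norm x" for x n
    by (rule order_trans[OF _ ell2_L2_set_le[of x "Suc n"]]) (rule member_le_L2_set, auto)
  fix X :: "nat \<Rightarrow> ell2"
  assume "Cauchy X"
  then have C: "\<exists>M. \<forall>m\<ge>M. \<forall>n\<ge>M. norm (X m - X n) < e" if "e > 0" for e
    using that unfolding Cauchy_def dist_ell2_def by blast
  have "\<exists>l. (\<lambda>m. Rep_ell2 (X m) k) \<longlonglongrightarrow> l" for k
  proof -
    have "Cauchy (\<lambda>m. Rep_ell2 (X m) k)"
      unfolding Cauchy_def dist_norm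
      using C by (metis coord rep_diff le_less_trans)
    then show ?thesis by (simp add: Cauchy_convergent_iff convergent_def)
  qed
  then obtain g where g: "\<And>k. (\<lambda>m. Rep_ell2 (X m) k) \<longlonglongrightarrow> g k" by metis
  have bound: "\<exists>M. \<forall>m\<ge>M. \<forall>K. L2_set (\<lambda>k. cmod (Rep_ell2 (X m) k - g k)) {..<K} \<le> e"
    if "e > 0" for e
  proof -
    obtain M where M: "\<And>m n. m \<ge> M \<Longrightarrow> n \<ge> M \<Longrightarrow> norm (X m - X n) < e"
      using C[OF \<open>e > 0\<close>] by blast
    have "L2_set (\<lambda>k. cmod (Rep_ell2 (X m) k - g k)) {..<K} \<le> e" if "m \<ge> M" for m K
    proof (rule tendsto_upperbound)
      show "(\<lambda>n. L2_set (\<lambda>k. cmod (Rep_ell2 (X m) k - Rep_ell2 (X n) k)) {..<K})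
          \<longlonglongrightarrow> L2_set (\<lambda>k. cmod (Rep_ell2 (X m) k - g k)) {..<K}"
        unfolding L2_set_def by (intro tendsto_intros g)
      have "L2_set (\<lambda>k. cmod (Rep_ell2 (X m) k - Rep_ell2 (X n) k)) {..<K} \<le> e" if "n \<ge> M" for n
        using ell2_L2_set_le[of "X m - X n" K] M[OF \<open>m \<ge> M\<close> that] by (simp add: rep_diff)
      then show "\<forall>\<^sub>F n in sequentially.
          L2_set (\<lambda>k. cmod (Rep_ell2 (X m) k - Rep_ell2 (X n) k)) {..<K} \<le> e"
        unfolding eventually_sequentially by blast
    qed simp
    then show ?thesis by blast
  qed
  have "summable (\<lambda>k. (cmod (g k))\<^sup>2)"
  proof -
    obtain M where M: "\<And>K. L2_set (\<lambda>k. cmod (Rep_ell2 (X M) k - g k)) {..<K} \<le> 1"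
      using bound[of 1] by auto
    have "summable (\<lambda>k. (cmod (Rep_ell2 (X M) k - g k))\<^sup>2)"
    proof (rule summableI_nonneg_bounded)
      show "(\<Sum>k<K. (cmod (Rep_ell2 (X M) k - g k))\<^sup>2) \<le> 1" for K
        using M[of K] by (simp add: L2_set_def)
    qed simp
    then have "summable (\<lambda>k. (cmod (- 1 * (Rep_ell2 (X M) k - g k)))\<^sup>2)"
      by (rule ell2_scale_summable)
    from ell2_add_summable[OF Rep_ell2_summable[of "X M"] this]
    show ?thesis by simp
  qed
  then have repg: "Rep_ell2 (Abs_ell2 g) = g" by (simp add: Abs_ell2_inverse)
  have "X \<longlonglongrightarrow> Abs_ell2 g"
  proof (rule metric_LIMSEQ_I)
    fix e :: real
    assume "e > 0"
    then obtain M where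
      M: "\<And>m K. m \<ge> M \<Longrightarrow> L2_set (\<lambda>k. cmod (Rep_ell2 (X m) k - g k)) {..<K} \<le> e / 2"
      using bound[of "e / 2"] by auto
    have "norm (X m - Abs_ell2 g) \<le> e / 2" if "m \<ge> M" for m
      by (rule ell2_norm_le) (simp only: rep_diff repg M[OF that])
    then show "\<exists>M. \<forall>m\<ge>M. dist (X m) (Abs_ell2 g) < e"
      using \<open>e > 0\<close> by (intro exI[of _ M]) (fastforce simp: dist_ell2_def)
  qed
  then show "convergent X" by (auto simp: convergent_def)
qed

instantiation ell2 :: complex_hilbert
begin

lift_definition scaleC_ell2 :: "complex \<Rightarrow> ell2 \<Rightarrow> ell2" is "\<lambda>c f n. c * f n"
  by (rule ell2_scale_summable)
lift_definition cinner_ell2 :: "ell2 \<Rightarrow> ell2 \<Rightarrow> complex" is "\<lambda>f g. \<Sum>n. cnj (f n) * g n" .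

instance
proof
  fix x y z :: ell2 and r :: real and c d :: complex
  show "c *\<^sub>C (x + y) = c *\<^sub>C x + c *\<^sub>C y" by transfer (simp add: distrib_left)
  show "(c + d) *\<^sub>C x = c *\<^sub>C x + d *\<^sub>C x" by transfer (simp add: distrib_right)
  show "c *\<^sub>C d *\<^sub>C x = (c * d) *\<^sub>C x" by transfer (simp add: mult.assoc)
  show "complex_of_real r *\<^sub>C x = r *\<^sub>R x" by transfer simp
  have inner: "summable (\<lambda>n. cnj (Rep_ell2 u n) * Rep_ell2 v n)" for u v
    by (intro ell2_inner_summable Rep_ell2_summable)
  show "cinner x y = cnj (cinner y x)"
  proof -
    have "(\<lambda>n. cnj (cnj (Rep_ell2 y n) * Rep_ell2 x n)) sums cnj (cinner y x)"
      unfolding sums_cnj cinner_ell2.rep_eq using inner by (rule summable_sums)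
    then have "cnj (cinner y x) = (\<Sum>n. cnj (cnj (Rep_ell2 y n) * Rep_ell2 x n))"
      by (rule sums_unique)
    then show ?thesis by (simp add: cinner_ell2.rep_eq mult.commute)
  qed
  show "cinner x (y + z) = cinner x y + cinner x z"
    by (simp add: cinner_ell2.rep_eq plus_ell2.rep_eq distrib_left suminf_add[OF inner inner])
  show "cinner x (c *\<^sub>C y) = c * cinner x y"
    by (simp add: cinner_ell2.rep_eq scaleC_ell2.rep_eq suminf_mult[OF inner] mult.left_commute)
  show "cinner x x = complex_of_real ((norm x)\<^sup>2)"
  proof -
    have "(norm x)\<^sup>2 = (\<Sum>n. (cmod (Rep_ell2 x n))\<^sup>2)"
      by (simp add: norm_ell2.rep_eq suminf_nonneg[OF Rep_ell2_summable])
    moreover have "complex_of_real (\<Sum>n. (cmod (Rep_ell2 x n))\<^sup>2)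
        = (\<Sum>n. complex_of_real ((cmod (Rep_ell2 x n))\<^sup>2))"
      by (rule suminf_of_real[OF Rep_ell2_summable])
    moreover have "complex_of_real ((cmod w)\<^sup>2) = cnj w * w" for w
      by (simp only: complex_norm_square mult.commute)
    ultimately show ?thesis by (simp add: cinner_ell2.rep_eq del: of_real_power)
  qed
qed

end

section \<open>Bounded operators\<close>

text \<open>The library type of bounded real linear maps carries the operator norm; \<open>bounded_ops\<close> is
  the set of its complex linear members, i.e. \<open>B(H)\<close>.\<close>

instantiation blinfun :: (real_normed_vector, complex_hilbert) scaleC
begin

lift_definition scaleC_blinfun :: "complex \<Rightarrow> ('a \<Rightarrow>\<^sub>L 'b) \<Rightarrow> ('a \<Rightarrow>\<^sub>L 'b)" is "\<lambda>c f x. c *\<^sub>C f x"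
proof -
  fix c :: complex and f :: "'a \<Rightarrow> 'b"
  assume "bounded_linear f"
  moreover have "bounded_linear (\<lambda>y :: 'b. c *\<^sub>C y)"
  proof (rule bounded_linear_intro[where K = "cmod c"])
    show "c *\<^sub>C r *\<^sub>R y = r *\<^sub>R c *\<^sub>C y" for r and y :: 'b
      by (simp add: scaleC_scaleC mult.commute flip: scaleC_of_real)
  qed (simp_all add: scaleC_add_right norm_scaleC mult.commute)
  ultimately show "bounded_linear (\<lambda>x. c *\<^sub>C f x)"
    by (rule bounded_linear_compose[rotated])
qed

instance ..

end

definition bounded_ops :: "('h::complex_hilbert \<Rightarrow>\<^sub>L 'h) set" where
  "bounded_ops = {T. \<forall>c x. blinfun_apply T (c *\<^sub>C x) = c *\<^sub>C blinfun_apply T x}"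

definition is_adjoint :: "('h::complex_hilbert \<Rightarrow>\<^sub>L 'h) \<Rightarrow> ('h \<Rightarrow>\<^sub>L 'h) \<Rightarrow> bool" where
  "is_adjoint T T' \<longleftrightarrow>
     (\<forall>x y. cinner (blinfun_apply T x) y = cinner x (blinfun_apply T' y))"

definition selfadjoint_ops :: "('h::complex_hilbert \<Rightarrow>\<^sub>L 'h) set" where
  "selfadjoint_ops = {T \<in> bounded_ops. is_adjoint T T}"

text \<open>A \<open>p \<times> p\<close> matrix over \<open>B(H)\<close> acts on \<open>H\<^sup>p\<close>; \<open>pos_op_matrix\<close> says that this operator is
  positive. Only the entries with indices below \<open>p\<close> matter. The order on \<^typ>\<open>complex\<close> is such
  that \<open>0 \<le> z\<close> means that \<open>z\<close> is real and nonnegative.\<close>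

definition pos_op :: "('h::complex_hilbert \<Rightarrow>\<^sub>L 'h) \<Rightarrow> bool" where
  "pos_op T \<longleftrightarrow> (\<forall>x. 0 \<le> cinner x (blinfun_apply T x))"

definition pos_op_matrix :: "nat \<Rightarrow> (nat \<Rightarrow> nat \<Rightarrow> 'h::complex_hilbert \<Rightarrow>\<^sub>L 'h) \<Rightarrow> bool" where
  "pos_op_matrix p T \<longleftrightarrow>
     (\<forall>x :: nat \<Rightarrow> 'h. 0 \<le> (\<Sum>i<p. \<Sum>j<p. cinner (x i) (blinfun_apply (T i j) (x j))))"

definition pos_mat_matrix :: "nat \<Rightarrow> nat \<Rightarrow> (nat \<Rightarrow> nat \<Rightarrow> complex mat) \<Rightarrow> bool" where
  "pos_mat_matrix n p X \<longleftrightarrow>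
     (\<forall>v. (\<forall>i<p. v i \<in> carrier_vec n) \<longrightarrow> 0 \<le> (\<Sum>i<p. \<Sum>j<p. (X i j *\<^sub>v v j) \<bullet>c v i))"

definition linear_map_on ::
    "(complex \<Rightarrow> 'a \<Rightarrow> 'a) \<Rightarrow> (complex \<Rightarrow> 'b \<Rightarrow> 'b) \<Rightarrow> 'a::plus set \<Rightarrow> ('a \<Rightarrow> 'b::plus) \<Rightarrow> bool" where
  "linear_map_on scl scl' V \<phi> \<longleftrightarrow>
     (\<forall>x\<in>V. \<forall>y\<in>V. \<phi> (x + y) = \<phi> x + \<phi> y) \<and> (\<forall>c. \<forall>x\<in>V. \<phi> (scl c x) = scl' c (\<phi> x))"

text \<open>\<open>P\<close> and \<open>Q\<close> are the positivity predicates for matrices over the domain and the codomain.\<close>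

definition cp_on ::
    "(nat \<Rightarrow> (nat \<Rightarrow> nat \<Rightarrow> 'a) \<Rightarrow> bool) \<Rightarrow> (nat \<Rightarrow> (nat \<Rightarrow> nat \<Rightarrow> 'b) \<Rightarrow> bool)
      \<Rightarrow> 'a set \<Rightarrow> ('a \<Rightarrow> 'b) \<Rightarrow> bool" where
  "cp_on P Q V \<phi> \<longleftrightarrow>
     (\<forall>p T. (\<forall>i<p. \<forall>j<p. T i j \<in> V) \<and> P p T \<longrightarrow> Q p (\<lambda>i j. \<phi> (T i j)))"

section \<open>Operator systems and maps between them\<close>

definition op_system :: "('d::finite \<Rightarrow> 'h::complex_hilbert \<Rightarrow>\<^sub>L 'h) \<Rightarrow> ('h \<Rightarrow>\<^sub>L 'h) set" where
  "op_system A = {c0 *\<^sub>C id_blinfun + (\<Sum>i\<in>UNIV. c i *\<^sub>C A i) | c0 c. True}"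

text \<open>A linear map on \<open>op_system A\<close> is determined by its values at \<open>I\<close> and the \<open>A i\<close>, so existence
  of \<open>\<phi>\<close> below expresses that the map with the prescribed values is well defined, and the
  remaining condition is then a property of that map.\<close>

definition assigns ::
    "('d::finite \<Rightarrow> 'h::complex_hilbert \<Rightarrow>\<^sub>L 'h) \<Rightarrow> ('d \<Rightarrow> 'k::complex_hilbert \<Rightarrow>\<^sub>L 'k)
      \<Rightarrow> (('h \<Rightarrow>\<^sub>L 'h) \<Rightarrow> ('k \<Rightarrow>\<^sub>L 'k)) \<Rightarrow> bool" where
  "assigns A B \<phi> \<longleftrightarrow>
     linear_map_on scaleC scaleC (op_system A) \<phi> \<and> \<phi> id_blinfun = id_blinfun \<and> (\<forall>i. \<phi> (A i) = B i)"

definition positive_assignment ::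
    "('d::finite \<Rightarrow> 'h::complex_hilbert \<Rightarrow>\<^sub>L 'h) \<Rightarrow> ('d \<Rightarrow> 'k::complex_hilbert \<Rightarrow>\<^sub>L 'k) \<Rightarrow> bool" where
  "positive_assignment A B \<longleftrightarrow>
     (\<exists>\<phi>. assigns A B \<phi> \<and> (\<forall>T\<in>op_system A. pos_op T \<longrightarrow> pos_op (\<phi> T)))"

definition cp_assignment ::
    "('d::finite \<Rightarrow> 'h::complex_hilbert \<Rightarrow>\<^sub>L 'h) \<Rightarrow> ('d \<Rightarrow> 'k::complex_hilbert \<Rightarrow>\<^sub>L 'k) \<Rightarrow> bool" where
  "cp_assignment A B \<longleftrightarrow>
     (\<exists>\<phi>. assigns A B \<phi> \<and> cp_on pos_op_matrix pos_op_matrix (op_system A) \<phi>)"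

section \<open>Matrix ranges and matrix convex sets\<close>

definition unital_cstar_subalgebra :: "('h::complex_hilbert \<Rightarrow>\<^sub>L 'h) set \<Rightarrow> bool" where
  "unital_cstar_subalgebra M \<longleftrightarrow>
     M \<subseteq> bounded_ops \<and> id_blinfun \<in> M
     \<and> (\<forall>T\<in>M. \<forall>R\<in>M. T + R \<in> M \<and> T o\<^sub>L R \<in> M) \<and> (\<forall>c. \<forall>T\<in>M. c *\<^sub>C T \<in> M)
     \<and> (\<forall>T\<in>M. \<forall>T'. is_adjoint T T' \<longrightarrow> T' \<in> M) \<and> closed M"

definition cstar :: "('d::finite \<Rightarrow> 'h::complex_hilbert \<Rightarrow>\<^sub>L 'h) \<Rightarrow> ('h \<Rightarrow>\<^sub>L 'h) set" where
  "cstar A = \<Inter> {M. unital_cstar_subalgebra M \<and> range A \<subseteq> M}"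

definition ucp_to_mat ::
    "('h::complex_hilbert \<Rightarrow>\<^sub>L 'h) set \<Rightarrow> nat \<Rightarrow> (('h \<Rightarrow>\<^sub>L 'h) \<Rightarrow> complex mat) \<Rightarrow> bool" where
  "ucp_to_mat V n \<phi> \<longleftrightarrow>
     \<phi> ` V \<subseteq> carrier_mat n n \<and> linear_map_on scaleC smult_mat V \<phi>
     \<and> \<phi> id_blinfun = 1\<^sub>m n \<and> cp_on pos_op_matrix (pos_mat_matrix n) V \<phi>"

definition ucp_mat_mat :: "nat \<Rightarrow> nat \<Rightarrow> (complex mat \<Rightarrow> complex mat) \<Rightarrow> bool" where
  "ucp_mat_mat n k \<phi> \<longleftrightarrow>
     \<phi> ` carrier_mat n n \<subseteq> carrier_mat k k \<and> linear_map_on smult_mat smult_mat (carrier_mat n n) \<phi>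
     \<and> \<phi> (1\<^sub>m n) = 1\<^sub>m k \<and> cp_on (pos_mat_matrix n) (pos_mat_matrix k) (carrier_mat n n) \<phi>"

text \<open>Graded sets \<open>\<Union>\<^sub>n S\<^sub>n\<close> of matrix tuples are functions of the level \<open>n\<close>; only the levels
  \<open>n > 0\<close> are meaningful.\<close>

type_synonym 'd graded_set = "nat \<Rightarrow> ('d \<Rightarrow> complex mat) set"

definition matrix_range :: "('d::finite \<Rightarrow> 'h::complex_hilbert \<Rightarrow>\<^sub>L 'h) \<Rightarrow> 'd graded_set" where
  "matrix_range A n = {(\<lambda>i. \<phi> (A i)) | \<phi>. ucp_to_mat (cstar A) n \<phi>}"

definition selfadjoint_mats :: "nat \<Rightarrow> complex mat set" where
  "selfadjoint_mats n = {X \<in> carrier_mat n n. mat_adjoint X = X}"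

definition mat_direct_sum :: "complex mat \<Rightarrow> complex mat \<Rightarrow> complex mat" where
  "mat_direct_sum X Y =
     four_block_mat X (0\<^sub>m (dim_row X) (dim_col Y)) (0\<^sub>m (dim_row Y) (dim_col X)) Y"

definition matrix_convex :: "'d graded_set \<Rightarrow> bool" where
  "matrix_convex T \<longleftrightarrow>
     (\<forall>n>0. \<forall>X\<in>T n. \<forall>i. X i \<in> selfadjoint_mats n)
     \<and> (\<forall>n>0. \<forall>m>0. \<forall>X\<in>T n. \<forall>Y\<in>T m. (\<lambda>i. mat_direct_sum (X i) (Y i)) \<in> T (n + m))
     \<and> (\<forall>n>0. \<forall>k>0. \<forall>\<phi>. ucp_mat_mat n k \<phi> \<longrightarrow> (\<forall>X\<in>T n. (\<lambda>i. \<phi> (X i)) \<in> T k))"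

definition tuple_scale :: "real \<Rightarrow> ('d \<Rightarrow> complex mat) \<Rightarrow> ('d \<Rightarrow> complex mat)" where
  "tuple_scale t X = (\<lambda>i. complex_of_real t \<cdot>\<^sub>m X i)"

text \<open>\<open>level1_real S\<close> is \<open>S\<^sub>1\<close> regarded as a subset of Euclidean space.\<close>

definition level1_real :: "'d graded_set \<Rightarrow> (real ^ 'd::finite) set" where
  "level1_real S = {x. (\<lambda>i. Matrix.mat 1 1 (\<lambda>_. complex_of_real (vec_nth x i))) \<in> S 1}"

definition rho_level :: "'d graded_set \<Rightarrow> nat \<Rightarrow> ennreal" where
  "rho_level S n = Sup {ennreal t | t. 0 \<le> t \<and>
     (\<forall>T. matrix_convex T \<and> S 1 \<subseteq> T 1 \<longrightarrow> tuple_scale t ` S n \<subseteq> T n)}"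

definition rho_const :: "'d graded_set \<Rightarrow> ennreal" where
  "rho_const S = (INF n\<in>{0<..}. rho_level S n)"

text \<open>For closed \<open>S\<close> the supremum is attained whenever it is finite.\<close>

definition sigma_const :: "'d graded_set \<Rightarrow> ennreal" where
  "sigma_const S = Sup {ennreal s | s. 0 \<le> s \<and>
     (\<forall>T. matrix_convex T \<and> T 1 \<subseteq> S 1 \<longrightarrow> (\<forall>n>0. tuple_scale s ` T n \<subseteq> S n))}"

text \<open>Scaling by an extended number, with \<open>\<infinity> \<cdot> 0 = 0\<close>. The product \<open>\<infinity> \<cdot> x\<close> for
  nonzero \<open>x\<close> is deliberately left unspecified.\<close>

definition ext_scale :: "ennreal \<Rightarrow> 'a \<Rightarrow> 'a::real_vector" where
  "ext_scale c x = (if x = 0 then 0 else if c = \<infinity> then undefined else enn2real c *\<^sub>R x)"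

section \<open>Tight frames\<close>

definition outer :: "real ^ 'd \<Rightarrow> real ^ 'd \<Rightarrow> real ^ 'd ^ 'd" where
  "outer v w = (\<chi> a b. vec_nth v a * vec_nth w b)"

definition isometric_tight_frame :: "nat \<Rightarrow> (nat \<Rightarrow> real ^ 'd::finite) \<Rightarrow> bool" where
  "isometric_tight_frame N v \<longleftrightarrow>
     (\<exists>l>0. \<forall>i\<in>{1..N}. norm (v i) = l)
     \<and> (\<exists>s>0. (\<Sum>i=1..N. outer (v i) (v i)) = s *\<^sub>R mat 1)"

definition invariant_under_projections ::
    "(real ^ 'd::finite) set \<Rightarrow> nat \<Rightarrow> (nat \<Rightarrow> real ^ 'd) \<Rightarrow> bool" where
  "invariant_under_projections E N v \<longleftrightarrow>
     (\<forall>i\<in>{1..N}. (\<lambda>x. ((1 / (norm (v i))\<^sup>2) *\<^sub>R outer (v i) (v i)) *v x) ` E \<subseteq> E)"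

end

theory Submission
  imports Defs
begin

text \<open>A map between operator systems spanned by tuples is described by its action on coefficient
  matrices: \<open>A \<mapsto> B\<close> is completely positive iff positivity of \<open>\<Sum>\<^sub>k c\<^sub>k \<otimes> A\<^sub>k\<close> implies positivity of
  \<open>\<Sum>\<^sub>k c\<^sub>k \<otimes> B\<^sub>k\<close>. By compactness and separation (in place of Arveson's extension theorem), \<open>W\<^sub>n(A)\<close>
  consists of the \<open>n \<times> n\<close> tuples \<open>X\<close> for which \<open>A \<mapsto> X\<close> is completely positive. Compressions to
  finite dimensional subspaces then turn the two scaling statements into the definitions of the two
  constants, applied to the matrix convex set \<open>W(B)\<close>. Optimality is tested on \<open>B = X \<oplus> 0\<close> for \<open>\<sigma>\<close>,
  and on a diagonal \<open>B\<close> whose entries are dense in \<open>W\<^sub>1(A)\<close> for \<open>\<rho>\<close>; the latter works because a tuple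
  dominated by \<open>B\<close> is a finite sum \<open>\<Sum>\<^sub>m x\<^sub>m a\<^sub>m a\<^sub>m\<^sup>*\<close> with points \<open>x\<^sub>m\<close> of \<open>W\<^sub>1(A)\<close> and
  \<open>\<Sum>\<^sub>m a\<^sub>m a\<^sub>m\<^sup>* = 1\<close> (Caratheodory), and every matrix convex set over \<open>W\<^sub>1(A)\<close> contains these sums.
  For the lower bounds, \<open>\<lambda> = u w\<^sup>T\<close> maps a tuple \<open>X\<close> to \<open>u \<otimes> (w \<cdot> X)\<close>, which involves the single
  self-adjoint matrix \<open>w \<cdot> X\<close> and is therefore of the above form.\<close>

section \<open>Positivity through coefficient matrices\<close>

text \<open>The constants are suprema in [0, \<infinity>], so neither is known beforehand to be an
  admissible scale. What helps is that for one fixed pair of tuples the scales \<open>s\<close>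
  making the scaled map completely positive form a closed convex set. It contains 0 because 0 lies
  in W_1(A), hence it contains every real number up to the supremum. Since \<rho> is an infimum over
  the levels, this is done at each level separately, and only then are the levels assembled into a
  statement about operators. In the optimality claims all tests must live on one separable space. A
  matrix tuple fits into a corner of \<open>ell2\<close>, and filling up with zero keeps the map
  positive because 0 is a state of \<open>A\<close>. The whole of W_1(A) does not fit on a diagonal,
  but a countable dense subset does, and the inequalities that express positivity pass to its
  closure. Compactness is gained by normalising to trace one, so the separated points are tuples
  divided by \<open>n\<close>; the factor \<open>n\<close> returns whenever a map or a dilation is
  rebuilt.\<close>

lemma cinner_add_left: "cinner (x + y) z = cinner x z + cinner y z"
  by (metis cinner_commute cinner_add_right complex_cnj_add)

lemma cinner_scaleC_left: "cinner (c *\<^sub>C x) y = cnj c * cinner x y"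
  by (metis cinner_commute cinner_scaleC_right complex_cnj_mult)

lemma cinner_zero_right [simp]: "cinner x 0 = 0"
  using cinner_add_right[of x 0 0] by simp

lemma cinner_zero_left [simp]: "cinner 0 x = 0"
  using cinner_add_left[of 0 0 x] by simp

lemma cinner_sum_right: "cinner x (\<Sum>i\<in>I. f i) = (\<Sum>i\<in>I. cinner x (f i))"
  by (induction I rule: infinite_finite_induct) (auto simp: cinner_add_right)

lemma cinner_sum_left: "cinner (\<Sum>i\<in>I. f i) x = (\<Sum>i\<in>I. cinner (f i) x)"
  by (induction I rule: infinite_finite_induct) (auto simp: cinner_add_left)

lemma scaleC_zero_left [simp]: "0 *\<^sub>C (x :: 'a::complex_hilbert) = 0"
  using scaleC_of_real[of 0 x] by simp

lemma scaleC_zero_right [simp]: "c *\<^sub>C (0 :: 'a::complex_hilbert) = 0"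
  using scaleC_add_right[of c 0 "0::'a"] by simp

lemma scaleC_one [simp]: "1 *\<^sub>C (x :: 'a::complex_hilbert) = x"
  using scaleC_of_real[of 1 x] by simp

lemma scaleC_minus_one: "(- 1) *\<^sub>C (x :: 'a::complex_hilbert) = - x"
  using scaleC_of_real[of "-1" x] by simp

lemma scaleC_sum_right:
  "c *\<^sub>C (\<Sum>i\<in>I. f i) = (\<Sum>i\<in>I. c *\<^sub>C (f i :: 'a::complex_hilbert))"
  by (induction I rule: infinite_finite_induct) (auto simp: scaleC_add_right)

lemma cinner_minus_right: "cinner x (- y) = - cinner x y"
  using cinner_add_right[of x y "- y"] by (simp add: add_eq_0_iff)

lemma cinner_diff_right: "cinner x (y - z) = cinner x y - cinner x z"
  using cinner_add_right[of x y "- z"] by (simp add: cinner_minus_right)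

lemma cinner_scaleR_right: "cinner x (r *\<^sub>R y) = complex_of_real r * cinner x y"
  by (simp add: cinner_scaleC_right flip: scaleC_of_real)

lemma cinner_eq_zero_iff: "cinner x x = 0 \<longleftrightarrow> x = 0"
  by (simp add: cinner_self)

lemma cinner_self_nonneg: "0 \<le> cinner x x"
  by (simp add: cinner_self less_eq_complex_def del: of_real_power)

text \<open>Cauchy-Schwarz, read off from the squared norm of \<open>z\<close>, which is
  \<open>n\<close> times the component of \<open>y\<close> orthogonal to \<open>x\<close>; the
  factor \<open>n\<close> avoids a division.\<close>

lemma norm_cinner_le: "cmod (cinner x y) \<le> norm x * norm y"
proof (cases "x = 0")
  case False
  define a where "a = cinner x y"
  define n where "n = (norm x)\<^sup>2"
  have n: "n > 0" using False by (simp add: n_def)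
  define z where "z = n *\<^sub>R y - a *\<^sub>C x"
  have cx: "cinner x x = complex_of_real n" by (simp add: cinner_self n_def)
  have cy: "cinner y y = complex_of_real ((norm y)\<^sup>2)" by (rule cinner_self)
  have ca: "cinner y x = cnj a" unfolding a_def by (rule cinner_commute)
  have "cinner x z = 0"
    by (simp add: z_def cinner_diff_right cinner_scaleR_right cinner_scaleC_right cx a_def[symmetric])
  have "cinner z z = n * cinner z y - a * cinner z x"
    by (simp add: z_def[of] cinner_diff_right cinner_scaleR_right cinner_scaleC_right)
  also have "cinner z x = 0"
    using \<open>cinner x z = 0\<close> by (metis cinner_commute complex_cnj_zero)
  also have "cinner z y = cnj (cinner y z)" by (rule cinner_commute)
  also have "cinner y z = complex_of_real (n * (norm y)\<^sup>2) - a * cnj a"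
    by (simp add: z_def cinner_diff_right cinner_scaleR_right cinner_scaleC_right cy ca)
  also have "a * cnj a = complex_of_real ((cmod a)\<^sup>2)" by (simp only: complex_norm_square)
  finally have "complex_of_real ((norm z)\<^sup>2) = complex_of_real (n * (n * (norm y)\<^sup>2 - (cmod a)\<^sup>2))"
    by (simp add: cinner_self del: of_real_power)
  then have "(norm z)\<^sup>2 = n * (n * (norm y)\<^sup>2 - (cmod a)\<^sup>2)"
    using of_real_eq_iff by blast
  then have "n * (n * (norm y)\<^sup>2 - (cmod a)\<^sup>2) \<ge> 0" by (metis zero_le_power2)
  then have "(cmod a)\<^sup>2 \<le> (norm x * norm y)\<^sup>2"
    using n by (simp add: zero_le_mult_iff n_def power_mult_distrib)
  then show ?thesis unfolding a_def by (rule power2_le_imp_le) simp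
qed simp

text \<open>Complex polarization: the vectors \<open>x + y\<close> and
  \<open>x + \<i> *\<^sub>C y\<close> give the sum and the difference of the two mixed terms.
  Complex linearity is essential, since a real rotation by a right angle has vanishing quadratic
  form.\<close>

lemma op_eq_zero_if_quadratic_zero:
  assumes T: "T \<in> bounded_ops" and q: "\<And>x. cinner x (blinfun_apply T x) = 0"
  shows "T = 0"
proof -
  have "cinner x (blinfun_apply T y) = 0" for x y
  proof -
    have sc: "blinfun_apply T (c *\<^sub>C x) = c *\<^sub>C blinfun_apply T x" for c x
      using T by (simp add: bounded_ops_def)
    have 1: "cinner x (blinfun_apply T y) + cinner y (blinfun_apply T x) = 0"
      using q[of "x + y"] q[of x] q[of y]
      by (simp add: blinfun.add_right cinner_add_right cinner_add_left add.commute)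
    have 2: "\<i> * cinner x (blinfun_apply T y) - \<i> * cinner y (blinfun_apply T x) = 0"
      using q[of "x + \<i> *\<^sub>C y"] q[of x] q[of y]
      by (simp add: blinfun.add_right cinner_add_right cinner_add_left sc cinner_scaleC_right
          cinner_scaleC_left)
    have "\<i> * (cinner x (blinfun_apply T y) - cinner y (blinfun_apply T x)) = 0"
      using 2 by (simp add: algebra_simps)
    then have "cinner x (blinfun_apply T y) = cinner y (blinfun_apply T x)" by simp
    then show ?thesis using 1 by simp
  qed
  then have "blinfun_apply T y = 0" for y
    using cinner_eq_zero_iff by blast
  then show ?thesis by (intro blinfun_eqI) simp
qed

lemma blinfun_apply_scaleC [simp]: "blinfun_apply (c *\<^sub>C T) x = c *\<^sub>C blinfun_apply T x"
  by (simp add: scaleC_blinfun.rep_eq)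

lemma blinfun_apply_bounded_ops:
  "T \<in> bounded_ops \<Longrightarrow> blinfun_apply T (c *\<^sub>C x) = c *\<^sub>C blinfun_apply T x"
  by (simp add: bounded_ops_def)

lemma sum_option: "(\<Sum>k\<in>UNIV. f k) = f None + (\<Sum>i\<in>UNIV. f (Some (i::'d::finite)))"
  by (simp add: UNIV_option_conv sum.reindex)

text \<open>The index \<open>None\<close> stands for the unit, so that elements of the operator system are plain sums over
  \<open>'d option\<close>.\<close>

definition aug :: "('d \<Rightarrow> 'h::complex_hilbert \<Rightarrow>\<^sub>L 'h) \<Rightarrow> 'd option \<Rightarrow> 'h \<Rightarrow>\<^sub>L 'h" where
  "aug A k = (case k of None \<Rightarrow> id_blinfun | Some i \<Rightarrow> A i)"

definition comb :: "('d::finite \<Rightarrow> 'h::complex_hilbert \<Rightarrow>\<^sub>L 'h) \<Rightarrow> ('d option \<Rightarrow> complex) \<Rightarrow> 'h \<Rightarrow>\<^sub>L 'h" where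
  "comb A c = (\<Sum>k\<in>UNIV. c k *\<^sub>C aug A k)"

definition op_form :: "('d \<Rightarrow> 'h::complex_hilbert \<Rightarrow>\<^sub>L 'h) \<Rightarrow> 'd option \<Rightarrow> 'h \<Rightarrow> 'h \<Rightarrow> complex" where
  "op_form A k x y = cinner x (blinfun_apply (aug A k) y)"

text \<open>Operator tuples on different spaces, matrix tuples and their rescalings are all treated as families
  of sesquilinear forms \<open>F k\<close>, which avoids any coercion between matrices and operators.\<close>

definition form_pos :: "('k::finite \<Rightarrow> 'v \<Rightarrow> 'v \<Rightarrow> complex) \<Rightarrow> nat \<Rightarrow> ('k \<Rightarrow> nat \<Rightarrow> nat \<Rightarrow> complex) \<Rightarrow> bool" where
  "form_pos F p c \<longleftrightarrow> (\<forall>x. 0 \<le> (\<Sum>i<p. \<Sum>j<p. \<Sum>k\<in>UNIV. c k i j * F k (x i) (x j)))"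

definition cp_rel :: "('k::finite \<Rightarrow> 'v \<Rightarrow> 'v \<Rightarrow> complex) \<Rightarrow> ('k \<Rightarrow> 'w \<Rightarrow> 'w \<Rightarrow> complex) \<Rightarrow> bool" where
  "cp_rel F G \<longleftrightarrow> (\<forall>p c. form_pos F p c \<longrightarrow> form_pos G p c)"

definition pos_rel :: "('k::finite \<Rightarrow> 'v \<Rightarrow> 'v \<Rightarrow> complex) \<Rightarrow> ('k \<Rightarrow> 'w \<Rightarrow> 'w \<Rightarrow> complex) \<Rightarrow> bool" where
  "pos_rel F G \<longleftrightarrow>
     (\<forall>c. (\<forall>x. 0 \<le> (\<Sum>k\<in>UNIV. c k * F k x x)) \<longrightarrow> (\<forall>x. 0 \<le> (\<Sum>k\<in>UNIV. c k * G k x x)))"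

lemma cp_rel_trans: "cp_rel F G \<Longrightarrow> cp_rel G H \<Longrightarrow> cp_rel F H"
  by (simp add: cp_rel_def)

lemma cp_rel_imp_pos_rel:
  assumes "cp_rel F G"
  shows "pos_rel F G"
  unfolding pos_rel_def
proof (intro allI impI)
  fix c x
  assume "\<forall>x. 0 \<le> (\<Sum>k\<in>UNIV. c k * F k x x)"
  then have "form_pos F 1 (\<lambda>k _ _. c k)" by (simp add: form_pos_def)
  then have "form_pos G 1 (\<lambda>k _ _. c k)" using assms by (simp add: cp_rel_def)
  then show "0 \<le> (\<Sum>k\<in>UNIV. c k * G k x x)"
    unfolding form_pos_def by (drule_tac x="\<lambda>_. x" in spec) simp
qed

section \<open>Maps between operator systems in terms of coefficients\<close>

lemma aug_simps [simp]: "aug A None = id_blinfun" "aug A (Some i) = A i"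
  by (simp_all add: aug_def)

lemma op_system_eq: "op_system A = range (comb A)"
proof
  show "op_system A \<subseteq> range (comb A)"
  proof
    fix T assume "T \<in> op_system A"
    then obtain c0 c where "T = c0 *\<^sub>C id_blinfun + (\<Sum>i\<in>UNIV. c i *\<^sub>C A i)"
      by (auto simp: op_system_def)
    then have "T = comb A (case_option c0 c)" by (simp add: comb_def sum_option)
    then show "T \<in> range (comb A)" by blast
  qed
  show "range (comb A) \<subseteq> op_system A"
    by (auto simp: op_system_def comb_def sum_option)
qed

lemma blinfun_apply_comb: "blinfun_apply (comb A c) x = (\<Sum>k\<in>UNIV. c k *\<^sub>C blinfun_apply (aug A k) x)"
  by (simp add: comb_def blinfun.sum_left)

lemma cinner_comb: "cinner x (blinfun_apply (comb A c) y) = (\<Sum>k\<in>UNIV. c k * op_form A k x y)"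
  by (simp add: blinfun_apply_comb cinner_sum_right cinner_scaleC_right op_form_def)

lemma comb_add: "comb A c + comb A d = comb A (\<lambda>k. c k + d k)"
  by (rule blinfun_eqI) (simp add: blinfun.add_left blinfun_apply_comb scaleC_add_left sum.distrib)

lemma comb_scaleC: "c *\<^sub>C comb A d = comb A (\<lambda>k. c * d k)"
  by (rule blinfun_eqI) (simp add: blinfun_apply_comb scaleC_sum_right scaleC_scaleC)

lemma id_eq_comb: "comb A (\<lambda>k. if k = None then 1 else 0) = id_blinfun"
  by (rule blinfun_eqI) (simp add: blinfun_apply_comb sum_option)

lemma gen_eq_comb: "comb A (\<lambda>k. if k = Some i then 1 else 0) = A i"
proof (rule blinfun_eqI)
  fix x
  have "(\<Sum>j\<in>UNIV. (if j = i then 1 else 0) *\<^sub>C blinfun_apply (A j) x)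
      = (\<Sum>j\<in>UNIV. if j = i then blinfun_apply (A j) x else 0)"
    by (intro sum.cong) auto
  then show "blinfun_apply (comb A (\<lambda>k. if k = Some i then 1 else 0)) x = blinfun_apply (A i) x"
    by (simp add: blinfun_apply_comb sum_option)
qed

text \<open>Positivity already forces well-definedness: if \<open>comb A e\<close> vanishes, both
  \<open>e\<close> and its negative are positive on \<open>A\<close>, hence on \<open>B\<close>, so
  the quadratic form of \<open>comb B e\<close> is zero.\<close>

lemma comb_cong_pos:
  assumes B: "\<And>i. B i \<in> bounded_ops" and rel: "pos_rel (op_form A) (op_form B)"
    and eq: "comb A c = comb A d"
  shows "comb B c = comb B d"
proof -
  define e where "e = (\<lambda>k. c k - d k)"
  have e: "e = (\<lambda>k. c k + (-1) * d k)" by (auto simp: e_def)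
  have "comb A e = comb A c + (-1) *\<^sub>C comb A d"
    unfolding e comb_add comb_scaleC ..
  then have A0: "blinfun_apply (comb A e) x = 0" for x
    using eq by (simp add: blinfun.add_left scaleC_minus_one)
  have Bb: "comb B e \<in> bounded_ops"
  proof -
    have "aug B k \<in> bounded_ops" for k using B by (cases k) (auto simp: bounded_ops_def)
    then show ?thesis
      by (simp add: bounded_ops_def blinfun_apply_comb scaleC_sum_right scaleC_scaleC mult.commute)
  qed
  have z: "(\<Sum>k\<in>UNIV. e k * op_form A k x x) = 0" for x
    by (simp add: A0 flip: cinner_comb)
  have "0 \<le> (\<Sum>k\<in>UNIV. e k * op_form B k x x)" for x
    by (rule rel[unfolded pos_rel_def, rule_format, of e]) (simp add: z)
  moreover have "0 \<le> (\<Sum>k\<in>UNIV. (- e k) * op_form B k x x)" for x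
  proof -
    have "\<forall>x. 0 \<le> (\<Sum>k\<in>UNIV. (- e k) * op_form A k x x)"
      using z by (simp add: sum_negf)
    from rel[unfolded pos_rel_def, rule_format, of "\<lambda>k. - e k", OF this[rule_format]]
    show ?thesis .
  qed
  ultimately have "(\<Sum>k\<in>UNIV. e k * op_form B k x x) = 0" for x
    by (simp add: sum_negf order_class.order_eq_iff)
  then have "comb B e = 0"
    by (intro op_eq_zero_if_quadratic_zero[OF Bb]) (simp add: cinner_comb)
  moreover have "comb B e = comb B c + (-1) *\<^sub>C comb B d"
    unfolding e comb_add comb_scaleC ..
  ultimately have "comb B c + (-1) *\<^sub>C comb B d = 0" by simp
  then have "blinfun_apply (comb B c + (-1) *\<^sub>C comb B d) x = 0" for x by simp
  then have "blinfun_apply (comb B c) x = blinfun_apply (comb B d) x" for x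
    by (simp add: blinfun.add_left scaleC_minus_one)
  then show ?thesis by (rule blinfun_eqI)
qed

lemma assigns_comb:
  assumes "assigns A B \<phi>"
  shows "\<phi> (comb A c) = comb B c"
proof -
  have lin: "linear_map_on scaleC scaleC (op_system A) \<phi>" and
    unit: "\<phi> id_blinfun = id_blinfun" and gen: "\<And>i. \<phi> (A i) = B i"
    using assms by (auto simp: assigns_def)
  have add: "\<phi> (comb A c + comb A d) = \<phi> (comb A c) + \<phi> (comb A d)" for c d
    using lin by (auto simp: linear_map_on_def op_system_eq)
  have scl: "\<phi> (z *\<^sub>C comb A c) = z *\<^sub>C \<phi> (comb A c)" for z c
    using lin by (auto simp: linear_map_on_def op_system_eq)
  have elem: "\<phi> (aug A k) = aug B k" for k
    using unit gen by (cases k) auto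
  have aug: "aug A k = comb A (\<lambda>l. if l = k then 1 else 0)" for k
    by (cases k) (auto simp: id_eq_comb gen_eq_comb)
  have comb0: "comb X (\<lambda>_. 0) = 0" for X :: "'a \<Rightarrow> 'x::complex_hilbert \<Rightarrow>\<^sub>L 'x"
    by (rule blinfun_eqI) (simp add: blinfun_apply_comb)
  have *: "\<phi> (comb A (\<lambda>k. if k \<in> I then c k else 0)) = comb B (\<lambda>k. if k \<in> I then c k else 0)"
    if "finite I" for I
    using that
  proof induction
    case empty
    \<comment> \<open>\<open>linear_map_on\<close> does not list the value at 0; it comes from
      homogeneity with scalar 0.\<close>
    have "\<phi> (0 *\<^sub>C comb A (\<lambda>_. 0)) = 0 *\<^sub>C \<phi> (comb A (\<lambda>_. 0))" by (rule scl)
    moreover have "0 *\<^sub>C comb A (\<lambda>_. 0) = 0" by (rule blinfun_eqI) simp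
    moreover have "0 *\<^sub>C \<phi> (comb A (\<lambda>_. 0)) = 0" by (rule blinfun_eqI) simp
    ultimately show ?case by (simp add: comb0)
  next
    case (insert k I)
    have split: "comb X (\<lambda>l. if l \<in> insert k I then c l else 0)
        = comb X (\<lambda>l. if l \<in> I then c l else 0) + c k *\<^sub>C comb X (\<lambda>l. if l = k then 1 else 0)"
      for X :: "'a \<Rightarrow> 'x::complex_hilbert \<Rightarrow>\<^sub>L 'x"
      unfolding comb_add comb_scaleC
      by (rule arg_cong[where f = "comb X"]) (use insert in auto)
    have Bk: "comb B (\<lambda>l. if l = k then 1 else 0) = aug B k"
      by (cases k) (auto simp: id_eq_comb gen_eq_comb)
    have "\<phi> (comb A (\<lambda>l. if l \<in> insert k I then c l else 0))
        = \<phi> (comb A (\<lambda>l. if l \<in> I then c l else 0)) + c k *\<^sub>C \<phi> (aug A k)"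
      unfolding split aug comb_scaleC add by (simp only: flip: comb_scaleC scl)
    then show ?case by (simp only: split insert.IH elem Bk)
  qed
  show ?thesis using *[of UNIV] by simp
qed

text \<open>The map picks any coefficient vector representing \<open>T\<close>;
  \<open>comb_cong_pos\<close> makes the choice irrelevant.\<close>

lemma assigns_exists:
  assumes B: "\<And>i. B i \<in> bounded_ops" and rel: "pos_rel (op_form A) (op_form B)"
  shows "\<exists>\<phi>. assigns A B \<phi>"
proof -
  define \<phi> where "\<phi> T = comb B (SOME c. comb A c = T)" for T
  have \<phi>: "\<phi> (comb A c) = comb B c" for c
    unfolding \<phi>_def
    by (rule comb_cong_pos[OF B rel]) (rule someI[where x = c], simp)
  have "assigns A B \<phi>"
    unfolding assigns_def linear_map_on_def op_system_eq
    using \<phi>[of "\<lambda>k. if k = None then 1 else 0"] \<phi>[of "\<lambda>k. if k = Some _ then 1 else 0"]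
    by (auto simp: comb_add comb_scaleC \<phi> id_eq_comb gen_eq_comb)
  then show ?thesis by blast
qed

lemma pos_op_matrix_comb:
  "pos_op_matrix p (\<lambda>i j. comb A (\<lambda>k. c k i j)) \<longleftrightarrow> form_pos (op_form A) p c"
  by (simp add: pos_op_matrix_def form_pos_def cinner_comb)

lemma pos_op_comb: "pos_op (comb A c) \<longleftrightarrow> (\<forall>x. 0 \<le> (\<Sum>k\<in>UNIV. c k * op_form A k x x))"
  by (simp add: pos_op_def cinner_comb)

lemma positive_assignment_iff:
  assumes B: "\<And>i. B i \<in> bounded_ops"
  shows "positive_assignment A B \<longleftrightarrow> pos_rel (op_form A) (op_form B)"
proof
  assume "positive_assignment A B"
  then obtain \<phi> where \<phi>: "assigns A B \<phi>" "\<And>c. pos_op (comb A c) \<Longrightarrow> pos_op (\<phi> (comb A c))"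
    by (auto simp: positive_assignment_def op_system_eq)
  then show "pos_rel (op_form A) (op_form B)"
    by (simp add: pos_rel_def assigns_comb[OF \<phi>(1)] pos_op_comb)
next
  assume rel: "pos_rel (op_form A) (op_form B)"
  then obtain \<phi> where \<phi>: "assigns A B \<phi>" using assigns_exists[of B A] B by blast
  show "positive_assignment A B"
    unfolding positive_assignment_def op_system_eq
    using rel by (intro exI[of _ \<phi>]) (auto simp: \<phi> assigns_comb[OF \<phi>] pos_op_comb pos_rel_def)
qed

lemma cp_assignment_iff:
  assumes B: "\<And>i. B i \<in> bounded_ops"
  shows "cp_assignment A B \<longleftrightarrow> cp_rel (op_form A) (op_form B)"
proof
  assume "cp_assignment A B"
  then obtain \<phi> where \<phi>: "assigns A B \<phi>"
    and cp: "cp_on pos_op_matrix pos_op_matrix (op_system A) \<phi>"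
    by (auto simp: cp_assignment_def)
  show "cp_rel (op_form A) (op_form B)"
    unfolding cp_rel_def
  proof (intro allI impI)
    fix p c assume "form_pos (op_form A) p c"
    then have "pos_op_matrix p (\<lambda>i j. comb A (\<lambda>k. c k i j))" by (simp add: pos_op_matrix_comb)
    then have "pos_op_matrix p (\<lambda>i j. \<phi> (comb A (\<lambda>k. c k i j)))"
      using cp by (auto simp: cp_on_def op_system_eq)
    then show "form_pos (op_form B) p c"
      by (simp add: assigns_comb[OF \<phi>] pos_op_matrix_comb)
  qed
next
  assume rel: "cp_rel (op_form A) (op_form B)"
  then obtain \<phi> where \<phi>: "assigns A B \<phi>"
    using assigns_exists[of B A] B cp_rel_imp_pos_rel by blast
  have "cp_on pos_op_matrix pos_op_matrix (op_system A) \<phi>"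
    unfolding cp_on_def
  proof (intro allI impI)
    fix p T
    assume T: "(\<forall>i<p. \<forall>j<p. T i j \<in> op_system A) \<and> pos_op_matrix p T"
    then have "\<forall>i j. \<exists>c. i < p \<longrightarrow> j < p \<longrightarrow> T i j = comb A c"
      by (auto simp: op_system_eq)
    then obtain c where c: "\<And>i j. i < p \<Longrightarrow> j < p \<Longrightarrow> T i j = comb A (c i j)" by metis
    have "pos_op_matrix p (\<lambda>i j. comb A (\<lambda>k. c i j k))"
      using T c by (simp add: pos_op_matrix_def)
    then have "form_pos (op_form A) p (\<lambda>k i j. c i j k)"
      by (simp add: pos_op_matrix_comb)
    then have "form_pos (op_form B) p (\<lambda>k i j. c i j k)"
      using rel by (simp add: cp_rel_def)
    then have "pos_op_matrix p (\<lambda>i j. comb B (c i j))"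
      by (simp flip: pos_op_matrix_comb)
    then show "pos_op_matrix p (\<lambda>i j. \<phi> (T i j))"
      using c by (simp add: pos_op_matrix_def assigns_comb[OF \<phi>])
  qed
  then show "cp_assignment A B" using \<phi> by (auto simp: cp_assignment_def)
qed

section \<open>Separation in finitely many coordinates\<close>

text \<open>The size of the matrices is not a type, so the separation theorems of the library for Euclidean
  spaces do not apply; they are redone for functions on an arbitrary type, restricted to a finite
  set of coordinates.\<close>

lemma compact_Pi_UNIV:
  fixes S :: "'i \<Rightarrow> 'a::topological_space set"
  assumes "\<And>i. compact (S i)"
  shows "compact {f. \<forall>i. f i \<in> S i}"
proof -
  have "compactin (product_topology (\<lambda>_. euclidean) UNIV) (Pi\<^sub>E UNIV S)"
    using assms by (simp add: compactin_PiE)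
  moreover have "Pi\<^sub>E UNIV S = {f. \<forall>i. f i \<in> S i}" by (auto simp: PiE_def)
  ultimately show ?thesis by (simp add: euclidean_product_topology)
qed

lemma cmod_add_scaled_power2:
  "(cmod (a + of_real t * b))\<^sup>2 = (cmod a)\<^sup>2 + 2 * t * Re (cnj a * b) + t\<^sup>2 * (cmod b)\<^sup>2"
  unfolding cmod_power2 by (simp add: power2_eq_square algebra_simps)

text \<open>Nearest point argument: \<open>g\<close> minimises the squared distance \<open>D\<close>
  to \<open>z\<close>, the functional \<open>h\<close> is the conjugate of \<open>g - z\<close>, and
  the gap \<delta> is \<open>D g\<close>. As \<open>D\<close> sees only the coordinates in
  \<open>I\<close>, convexity of \<open>K\<close> up to the other coordinates suffices.\<close>

lemma separation_fun:
  fixes K :: "('i \<Rightarrow> complex) set"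
  assumes I: "finite I" and K: "compact K" "K \<noteq> {}"
    and conv: "\<And>f g t. f \<in> K \<Longrightarrow> g \<in> K \<Longrightarrow> 0 \<le> t \<Longrightarrow> t \<le> 1 \<Longrightarrow>
      \<exists>e\<in>K. \<forall>i\<in>I. e i = of_real (1 - t) * f i + of_real t * g i"
    and z: "\<And>f. f \<in> K \<Longrightarrow> \<exists>i\<in>I. f i \<noteq> z i"
  shows "\<exists>h. \<exists>\<delta>>0. \<forall>f\<in>K. Re (\<Sum>i\<in>I. h i * z i) + \<delta> \<le> Re (\<Sum>i\<in>I. h i * f i)"
proof -
  define D where "D f = (\<Sum>i\<in>I. (cmod (f i - z i))\<^sup>2)" for f
  have coord: "continuous_on K (\<lambda>f. f i)" for i
    by (rule continuous_on_subset[OF continuous_on_product_coordinates]) simp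
  have "continuous_on K D"
    unfolding D_def by (intro continuous_intros coord)
  then obtain g where g: "g \<in> K" and min: "\<And>f. f \<in> K \<Longrightarrow> D g \<le> D f"
    using continuous_attains_inf[OF K] by blast
  define h where "h i = cnj (g i - z i)" for i
  have "D g > 0"
  proof -
    obtain i where i: "i \<in> I" "g i \<noteq> z i" using z[OF g] by blast
    show ?thesis unfolding D_def using i by (intro sum_pos2[OF I i(1)]) auto
  qed
  moreover have "Re (\<Sum>i\<in>I. h i * z i) + D g \<le> Re (\<Sum>i\<in>I. h i * f i)" if f: "f \<in> K" for f
  proof -
    define R where "R = (\<Sum>i\<in>I. Re (h i * (f i - g i)))"
    define E where "E = (\<Sum>i\<in>I. (cmod (f i - g i))\<^sup>2)"
    have E: "E \<ge> 0" unfolding E_def by (intro sum_nonneg) auto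
    \<comment> \<open>Moving from \<open>g\<close> towards \<open>f\<close> cannot decrease
      \<open>D\<close>; this is the resulting inequality after division by \<open>t\<close>.\<close>
    have quad: "0 \<le> 2 * R + t * E" if t: "0 < t" "t \<le> 1" for t
    proof -
      obtain e where e: "e \<in> K" "\<forall>i\<in>I. e i = of_real (1 - t) * g i + of_real t * f i"
        using conv[OF g f, of t] t by auto
      have "D e = (\<Sum>i\<in>I. (cmod ((g i - z i) + of_real t * (f i - g i)))\<^sup>2)"
        unfolding D_def using e(2)
        by (intro sum.cong refl arg_cong[where f = "\<lambda>x. (cmod x)\<^sup>2"]) (auto simp: algebra_simps)
      also have "\<dots> = D g + 2 * t * R + t\<^sup>2 * E"
        unfolding cmod_add_scaled_power2 D_def R_def E_def h_def
        by (simp add: sum.distrib sum_distrib_left)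
      finally have "0 \<le> t * (2 * R + t * E)"
        using min[OF e(1)] by (simp add: power2_eq_square algebra_simps)
      then show ?thesis using t by (simp add: zero_le_mult_iff)
    qed
    have "R \<ge> 0"
    proof (rule ccontr)
      assume "\<not> R \<ge> 0"
      then have R: "R < 0" by simp
      \<comment> \<open>Small enough that \<open>t * E\<close> is at most \<open>- R\<close>, which
        contradicts \<open>quad\<close>; \<open>E + 1\<close> in the denominator covers
        \<open>E = 0\<close>.\<close>
      define t where "t = min 1 (- R / (E + 1))"
      have t: "0 < t" "t \<le> 1" using R E by (auto simp: t_def divide_neg_pos)
      have "t * E \<le> t * (E + 1)" using t by simp
      also have "\<dots> \<le> - R / (E + 1) * (E + 1)"
        using E by (intro mult_right_mono) (auto simp: t_def)
      also have "\<dots> = - R" using E by simp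
      finally show False using quad[OF t] R by simp
    qed
    have "Re (\<Sum>i\<in>I. h i * f i) = R + Re (\<Sum>i\<in>I. h i * g i)"
      by (simp add: R_def algebra_simps flip: sum.distrib)
    also have "Re (\<Sum>i\<in>I. h i * g i) = Re (\<Sum>i\<in>I. h i * z i) + D g"
    proof -
      have "Re (h i * g i) = Re (h i * z i) + (cmod (g i - z i))\<^sup>2" for i
        unfolding h_def cmod_power2 by (simp add: power2_eq_square algebra_simps)
      then show ?thesis
        by (simp only: D_def Re_sum sum.distrib)
    qed
    finally show ?thesis using \<open>R \<ge> 0\<close> by linarith
  qed
  ultimately show ?thesis by blast
qed

text \<open>Gaussian elimination: the pivot \<open>j0\<close> clears coordinate \<open>i\<close>
  from all other vectors, and its own coefficient is recovered from the relation found for the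
  rest.\<close>

lemma nontrivial_linear_relation:
  fixes g :: "'j \<Rightarrow> 'i \<Rightarrow> real"
  assumes "finite I" "finite J" "card I < card J"
  shows "\<exists>\<mu>. (\<exists>j\<in>J. \<mu> j \<noteq> 0) \<and> (\<forall>i\<in>I. (\<Sum>j\<in>J. \<mu> j * g j i) = 0)"
  using assms
proof (induction I arbitrary: J g rule: finite_induct)
  case empty
  then show ?case by (intro exI[of _ "\<lambda>_. 1"]) (auto simp: card_gt_0_iff)
next
  case (insert i I)
  show ?case
  proof (cases "\<forall>j\<in>J. g j i = 0")
    case True
    have "card I < card J" using insert by simp
    from insert.IH[OF \<open>finite J\<close> this, of g] show ?thesis using True by auto
  next
    case False
    then obtain j0 where j0: "j0 \<in> J" "g j0 i \<noteq> 0" by blast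
    define J' where "J' = J - {j0}"
    define g' where "g' j l = g j l - g j i / g j0 i * g j0 l" for j l
    have "card I < card J'" using insert j0 by (simp add: J'_def card_Diff_singleton)
    then obtain \<mu> where \<mu>: "\<exists>j\<in>J'. \<mu> j \<noteq> 0" "\<forall>l\<in>I. (\<Sum>j\<in>J'. \<mu> j * g' j l) = 0"
      using insert.IH[of J' g'] insert.prems by (auto simp: J'_def)
    define \<nu> where "\<nu> j = (if j = j0 then - (\<Sum>j\<in>J'. \<mu> j * g j i) / g j0 i else \<mu> j)" for j
    have "(\<Sum>j\<in>J. \<nu> j * g j l) = (\<Sum>j\<in>J'. \<mu> j * g' j l)" for l
    proof -
      have "(\<Sum>j\<in>J. \<nu> j * g j l) = \<nu> j0 * g j0 l + (\<Sum>j\<in>J'. \<nu> j * g j l)"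
        unfolding J'_def by (rule sum.remove) (use insert j0 in auto)
      also have "(\<Sum>j\<in>J'. \<nu> j * g j l) = (\<Sum>j\<in>J'. \<mu> j * g j l)"
        by (intro sum.cong) (auto simp: \<nu>_def J'_def)
      also have "\<nu> j0 * g j0 l = - (\<Sum>j\<in>J'. \<mu> j * (g j i / g j0 i * g j0 l))"
        by (simp add: \<nu>_def sum_divide_distrib sum_distrib_right mult.assoc)
      finally show ?thesis by (simp add: g'_def algebra_simps sum_subtractf)
    qed
    moreover have "(\<Sum>j\<in>J'. \<mu> j * g' j l) = 0" if "l \<in> insert i I" for l
      using that \<mu>(2) j0 by (auto simp: g'_def)
    moreover have "\<exists>j\<in>J. \<nu> j \<noteq> 0" using \<mu>(1) by (auto simp: \<nu>_def J'_def)
    ultimately show ?thesis by auto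
  qed
qed

text \<open>The bound counts real equations: two for each complex coordinate and one, indexed by
  \<open>None\<close>, for the sum of the weights. More points than that admit an affine relation
  \<mu>, along which the weights move until one of them vanishes.\<close>

lemma caratheodory_fun:
  fixes g :: "'j \<Rightarrow> 'i \<Rightarrow> complex"
  assumes I: "finite I" and "finite J" "\<And>j. j \<in> J \<Longrightarrow> 0 \<le> t j" "(\<Sum>j\<in>J. t j) = 1"
  shows "\<exists>J' t'. J' \<subseteq> J \<and> card J' \<le> 2 * card I + 1 \<and> (\<forall>j\<in>J'. (0::real) \<le> t' j) \<and>
    (\<Sum>j\<in>J'. t' j) = 1 \<and> (\<forall>i\<in>I. (\<Sum>j\<in>J'. of_real (t' j) * g j i) = (\<Sum>j\<in>J. of_real (t j) * g j i))"
  using assms(2-)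
proof (induction "card J" arbitrary: J t rule: less_induct)
  case less
  show ?case
  proof (cases "card J \<le> 2 * card I + 1")
    case True
    then show ?thesis using less.prems by (intro exI[of _ J] exI[of _ t]) auto
  next
    case False
    define L where "L = insert None (Some ` (I \<times> (UNIV :: bool set)))"
    define r where "r j l = (case l of None \<Rightarrow> 1 | Some (i, b) \<Rightarrow> if b then Re (g j i) else Im (g j i))"
      for j l
    have L: "finite L" unfolding L_def using I by simp
    have cL: "card L = 2 * card I + 1"
      unfolding L_def using I by (subst card_insert_disjoint) (auto simp: card_image card_cartesian_product)
    obtain \<mu> where \<mu>: "\<exists>j\<in>J. \<mu> j \<noteq> 0" and rel: "\<And>l. l \<in> L \<Longrightarrow> (\<Sum>j\<in>J. \<mu> j * r j l) = 0"
      using nontrivial_linear_relation[OF L less.prems(1), of r] False cL by auto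
    have \<mu>0: "(\<Sum>j\<in>J. \<mu> j) = 0" using rel[of None] by (simp add: L_def r_def)
    have \<mu>g: "(\<Sum>j\<in>J. of_real (\<mu> j) * g j i) = 0" if "i \<in> I" for i
    proof (rule complex_eqI)
      show "Re (\<Sum>j\<in>J. of_real (\<mu> j) * g j i) = Re 0"
        using rel[of "Some (i, True)"] that by (simp add: L_def r_def)
      show "Im (\<Sum>j\<in>J. of_real (\<mu> j) * g j i) = Im 0"
        using rel[of "Some (i, False)"] that by (simp add: L_def r_def)
    qed
    define P where "P = {j\<in>J. \<mu> j > 0}"
    have "P \<noteq> {}"
    proof
      assume "P = {}"
      then have "\<And>j. j \<in> J \<Longrightarrow> 0 \<le> - \<mu> j" by (force simp: P_def)
      then have "\<forall>j\<in>J. - \<mu> j = 0"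
        using \<mu>0 less.prems(1) sum_nonneg_eq_0_iff[of J "\<lambda>j. - \<mu> j"] by (simp add: sum_negf)
      then show False using \<mu> by auto
    qed
    moreover have fP: "finite P" unfolding P_def using less.prems by simp
    \<comment> \<open>The smallest ratio among the indices with positive \<mu> is the largest step
      along \<mu> that keeps all weights nonnegative; it brings the weight of \<open>j1\<close> to
      zero.\<close>
    ultimately obtain j1 where j1: "j1 \<in> P" and min: "\<And>j. j \<in> P \<Longrightarrow> t j1 / \<mu> j1 \<le> t j / \<mu> j"
      using ex_min_if_finite[of "(\<lambda>j. t j / \<mu> j) ` P"] by (auto simp: not_less)
    define s where "s = t j1 / \<mu> j1"
    define t' where "t' j = t j - s * \<mu> j" for j
    have j1': "j1 \<in> J" "\<mu> j1 > 0" using j1 by (auto simp: P_def)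
    have s0: "s \<ge> 0" using j1' less.prems by (simp add: s_def)
    have t'1: "t' j1 = 0" using j1' by (simp add: t'_def s_def)
    have t'0: "0 \<le> t' j" if "j \<in> J" for j
    proof (cases "\<mu> j > 0")
      case True
      then have "s \<le> t j / \<mu> j" unfolding s_def using that by (intro min) (simp add: P_def)
      then show ?thesis using True by (simp add: t'_def field_simps)
    next
      case False
      then have "s * \<mu> j \<le> 0" using s0 by (simp add: mult_nonneg_nonpos)
      then show ?thesis using less.prems(2)[OF that] by (simp add: t'_def)
    qed
    have drop: "(\<Sum>j\<in>J - {j1}. of_real (t' j) * f j) = (\<Sum>j\<in>J. of_real (t' j) * f j)"
      for f :: "'j \<Rightarrow> complex"
      using t'1 j1' less.prems(1) by (intro sum.mono_neutral_left) auto
    have sum1: "(\<Sum>j\<in>J - {j1}. t' j) = 1"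
    proof -
      have "(\<Sum>j\<in>J - {j1}. t' j) = (\<Sum>j\<in>J. t' j)"
        using t'1 j1' less.prems(1) by (intro sum.mono_neutral_left) auto
      also have "\<dots> = 1"
        using less.prems(3) \<mu>0 by (simp add: t'_def sum_subtractf flip: sum_distrib_left)
      finally show ?thesis .
    qed
    have sg: "(\<Sum>j\<in>J. of_real (t' j) * g j i) = (\<Sum>j\<in>J. of_real (t j) * g j i)" if "i \<in> I" for i
    proof -
      have "(\<Sum>j\<in>J. of_real (t' j) * g j i)
          = (\<Sum>j\<in>J. of_real (t j) * g j i) - of_real s * (\<Sum>j\<in>J. of_real (\<mu> j) * g j i)"
        by (simp add: t'_def algebra_simps sum_subtractf sum_distrib_left)
      then show ?thesis using \<mu>g[OF that] by simp
    qed
    have "card (J - {j1}) < card J" using j1' less.prems(1) by (intro card_Diff1_less)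
    from less.hyps[OF this, of t'] less.prems(1) t'0 sum1
    obtain J' t'' where "J' \<subseteq> J - {j1}" "card J' \<le> 2 * card I + 1" "\<forall>j\<in>J'. 0 \<le> t'' j"
      "(\<Sum>j\<in>J'. t'' j) = 1"
      "\<forall>i\<in>I. (\<Sum>j\<in>J'. of_real (t'' j) * g j i) = (\<Sum>j\<in>J - {j1}. of_real (t' j) * g j i)"
      by auto
    then show ?thesis
      using drop sg by (intro exI[of _ J'] exI[of _ t'']) auto
  qed
qed

text \<open>The fixed number of points makes this set compact; it is convex, up to coordinates outside \<open>I\<close>, as
  soon as \<open>N > 2 |I|\<close>.\<close>

definition conv_combs :: "nat \<Rightarrow> ('i \<Rightarrow> complex) set \<Rightarrow> ('i \<Rightarrow> complex) set" where
  "conv_combs N G = {\<lambda>i. \<Sum>j<N. of_real (t j) * g j i | t g.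
     (\<forall>j. t j \<in> {0..1::real}) \<and> (\<Sum>j<N. t j) = 1 \<and> (\<forall>j. g j \<in> G)}"

text \<open>Continuous image of a compact set of weights and points. All entries of both sequences,
  also from index \<open>N\<close> on, range over compact sets, as Tychonoff's theorem for total
  functions requires.\<close>

lemma compact_conv_combs:
  assumes "compact G"
  shows "compact (conv_combs N G)"
proof -
  define P where "P = {t :: nat \<Rightarrow> real. \<forall>j. t j \<in> {0..1}} \<inter> {t. (\<Sum>j<N. t j) = 1}"
  define Q where "Q = {g :: nat \<Rightarrow> 'a \<Rightarrow> complex. \<forall>j. g j \<in> G}"
  have coord: "continuous_on UNIV (\<lambda>t :: nat \<Rightarrow> 'x::topological_space. t j)" for j
    by (rule continuous_on_product_coordinates)
  have "closed {t :: nat \<Rightarrow> real. (\<Sum>j<N. t j) = 1}"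
    by (intro closed_Collect_eq continuous_intros coord)
  then have "compact P"
    unfolding P_def by (intro compact_Int_closed compact_Pi_UNIV) auto
  moreover have "compact Q" unfolding Q_def by (intro compact_Pi_UNIV assms)
  ultimately have "compact (P \<times> Q)" by (rule compact_Times)
  moreover have "continuous_on (P \<times> Q) (\<lambda>(t, g) i. \<Sum>j<N. complex_of_real (t j) * g j i)"
  proof -
    have 1: "continuous_on (P \<times> Q) (\<lambda>x. fst x j)" for j
      by (rule continuous_on_compose2[OF coord continuous_on_fst[OF continuous_on_id]]) auto
    have 2: "continuous_on (P \<times> Q) (\<lambda>x. snd x j)" for j
      by (rule continuous_on_compose2[OF coord continuous_on_snd[OF continuous_on_id]]) auto
    have 3: "continuous_on (P \<times> Q) (\<lambda>x. snd x j i)" for j i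
      by (rule continuous_on_compose2[OF continuous_on_product_coordinates 2]) auto
    show ?thesis
      unfolding case_prod_beta
      by (intro continuous_on_coordinatewise_then_product continuous_intros 1 3)
  qed
  ultimately have "compact ((\<lambda>(t, g) i. \<Sum>j<N. complex_of_real (t j) * g j i) ` (P \<times> Q))"
    by (rule compact_continuous_image[rotated])
  moreover have "(\<lambda>(t, g) i. \<Sum>j<N. complex_of_real (t j) * g j i) ` (P \<times> Q) = conv_combs N G"
    by (auto simp: conv_combs_def P_def Q_def image_def)
  ultimately show ?thesis by simp
qed

lemma conv_combs_reduce:
  fixes t :: "'j \<Rightarrow> real"
  assumes I: "finite I" and N: "2 * card I + 1 \<le> N"
    and J: "finite J" "\<And>j. j \<in> J \<Longrightarrow> 0 \<le> t j" "(\<Sum>j\<in>J. t j) = 1" "\<And>j. j \<in> J \<Longrightarrow> g j \<in> G"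
  shows "\<exists>e\<in>conv_combs N G. \<forall>i\<in>I. e i = (\<Sum>j\<in>J. of_real (t j) * g j i)"
proof -
  have "\<exists>J' t'. J' \<subseteq> J \<and> card J' \<le> 2 * card I + 1 \<and> (\<forall>j\<in>J'. (0::real) \<le> t' j) \<and>
    (\<Sum>j\<in>J'. t' j) = 1 \<and> (\<forall>i\<in>I. (\<Sum>j\<in>J'. of_real (t' j) * g j i) = (\<Sum>j\<in>J. of_real (t j) * g j i))"
    by (rule caratheodory_fun) (use I J in auto)
  then obtain J' t' where "J' \<subseteq> J \<and> card J' \<le> 2 * card I + 1 \<and> (\<forall>j\<in>J'. (0::real) \<le> t' j) \<and>
    (\<Sum>j\<in>J'. t' j) = 1 \<and> (\<forall>i\<in>I. (\<Sum>j\<in>J'. of_real (t' j) * g j i) = (\<Sum>j\<in>J. of_real (t j) * g j i))"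
    by (elim exE) (rule that)
  then have J': "J' \<subseteq> J" "card J' \<le> 2 * card I + 1" "\<And>j. j \<in> J' \<Longrightarrow> 0 \<le> t' j"
      "(\<Sum>j\<in>J'. t' j) = 1"
      "\<And>i. i \<in> I \<Longrightarrow> (\<Sum>j\<in>J'. of_real (t' j) * g j i) = (\<Sum>j\<in>J. of_real (t j) * g j i)"
    by auto
  have fJ': "finite J'" using J' J finite_subset by blast
  have le1: "t' j \<le> 1" if "j \<in> J'" for j
    using sum_nonneg_leq_bound[OF fJ' J'(3) J'(4) that] by simp
  obtain e where e: "bij_betw e {..<card J'} J'"
    using ex_bij_betw_nat_finite[OF fJ'] by (auto simp: atLeast0LessThan)
  have "J' \<noteq> {}" using J'(4) by auto
  then obtain j0 where j0: "j0 \<in> J'" by blast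
  \<comment> \<open>Caratheodory may return fewer than \<open>N\<close> points; the remaining places
    get weight zero at the point \<open>g j0\<close> of \<open>G\<close>.\<close>
  define s where "s m = (if m < card J' then t' (e m) else 0)" for m
  define f where "f m = (if m < card J' then g (e m) else g j0)" for m
  have eJ: "e m \<in> J'" if "m < card J'" for m using e that by (auto simp: bij_betw_def)
  have geG: "g j \<in> G" if "j \<in> J'" for j using J(4) J'(1) that by blast
  have sum_s: "(\<Sum>m<N. of_real (s m) * (F (if m < card J' then e m else j0)))
      = (\<Sum>j\<in>J'. of_real (t' j) * F j)" for F :: "'j \<Rightarrow> complex"
  proof -
    have "(\<Sum>m<N. of_real (s m) * (F (if m < card J' then e m else j0)))
        = (\<Sum>m<card J'. of_real (t' (e m)) * F (e m))"
      by (rule sum.mono_neutral_cong_right) (use J'(2) N in \<open>auto simp: s_def\<close>)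
    also have "\<dots> = (\<Sum>j\<in>J'. of_real (t' j) * F j)"
      by (rule sum.reindex_bij_betw[OF e])
    finally show ?thesis .
  qed
  have "complex_of_real (\<Sum>m<N. s m) = complex_of_real 1"
    using sum_s[of "\<lambda>_. 1"] J'(4) by (simp flip: of_real_sum)
  then have "(\<Sum>m<N. s m) = 1" by (simp only: of_real_eq_iff)
  then have mem: "(\<lambda>i. \<Sum>m<N. of_real (s m) * f m i) \<in> conv_combs N G"
    unfolding conv_combs_def
    using J'(3) le1 eJ j0 geG
    by (intro CollectI exI[of _ s] exI[of _ f]) (auto simp: s_def f_def)
  have "(\<Sum>m<N. of_real (s m) * f m i) = (\<Sum>j\<in>J. of_real (t j) * g j i)" if "i \<in> I" for i
  proof -
    have "(\<Sum>m<N. of_real (s m) * f m i)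
        = (\<Sum>m<N. of_real (s m) * g (if m < card J' then e m else j0) i)"
      by (intro sum.cong) (auto simp: f_def)
    then show ?thesis using sum_s[of "\<lambda>j. g j i"] J'(5)[OF that] by simp
  qed
  then show ?thesis by (intro bexI[OF _ mem]) simp
qed

text \<open>A convex combination of two members has \<open>2 * N\<close> terms, indexed by a
  disjoint sum, and Caratheodory brings it back to \<open>N\<close> terms on \<open>I\<close>. So
  the nearest point argument applies to the compact set \<open>conv_combs N G\<close>, and its
  functional is then restricted to \<open>G\<close>.\<close>

lemma separation_conv_combs:
  fixes G :: "('i \<Rightarrow> complex) set"
  assumes I: "finite I" and G: "compact G" "G \<noteq> {}"
    and z: "\<And>f. f \<in> conv_combs (2 * card I + 1) G \<Longrightarrow> \<exists>i\<in>I. f i \<noteq> z i"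
  shows "\<exists>h. \<exists>\<delta>>0. \<forall>f\<in>G. Re (\<Sum>i\<in>I. h i * z i) + \<delta> \<le> Re (\<Sum>i\<in>I. h i * f i)"
proof -
  define N where "N = 2 * card I + 1"
  have single: "\<exists>e\<in>conv_combs N G. \<forall>i\<in>I. e i = f i" if "f \<in> G" for f
    using conv_combs_reduce[OF I, of N "{()}" "\<lambda>_. 1" "\<lambda>_. f" G] that by (simp add: N_def)
  have conv: "\<exists>e\<in>conv_combs N G. \<forall>i\<in>I. e i = of_real (1 - t) * f i + of_real t * g i"
    if fg: "f \<in> conv_combs N G" "g \<in> conv_combs N G" and t: "0 \<le> t" "t \<le> 1" for f g t
  proof -
    obtain a u where a: "\<And>j. a j \<in> {0..1}" "(\<Sum>j<N. a j) = 1" "\<And>j. u j \<in> G"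
      "f = (\<lambda>i. \<Sum>j<N. of_real (a j) * u j i)" using fg(1) unfolding conv_combs_def by auto
    obtain b v where b: "\<And>j. b j \<in> {0..1}" "(\<Sum>j<N. b j) = 1" "\<And>j. v j \<in> G"
      "g = (\<lambda>i. \<Sum>j<N. of_real (b j) * v j i)" using fg(2) unfolding conv_combs_def by auto
    define w where "w = case_sum (\<lambda>j. (1 - t) * a j) (\<lambda>j. t * b j)"
    have split: "(\<Sum>x\<in>{..<N} <+> {..<N}. F x) = (\<Sum>j<N. F (Inl j)) + (\<Sum>j<N. F (Inr j))"
      for F :: "nat + nat \<Rightarrow> 'y::comm_monoid_add"
      by (simp add: sum.Plus)
    have "\<exists>e\<in>conv_combs N G. \<forall>i\<in>I. e i
        = (\<Sum>x\<in>{..<N} <+> {..<N}. of_real (w x) * case_sum u v x i)"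
    proof (rule conv_combs_reduce[OF I])
      show "(\<Sum>x\<in>{..<N} <+> {..<N}. w x) = 1"
        using a(2) b(2) by (simp add: split w_def flip: sum_distrib_left)
    qed (use a b t in \<open>auto simp: N_def w_def\<close>)
    then show ?thesis
      by (simp add: split w_def a(4) b(4) sum_distrib_left mult.assoc)
  qed
  have ne: "conv_combs N G \<noteq> {}" using single G(2) by blast
  have "\<exists>h. \<exists>\<delta>>0. \<forall>f\<in>conv_combs N G.
      Re (\<Sum>i\<in>I. h i * z i) + \<delta> \<le> Re (\<Sum>i\<in>I. h i * f i)"
  proof (rule separation_fun[OF I compact_conv_combs[OF G(1)] ne])
    show "\<exists>e\<in>conv_combs N G. \<forall>i\<in>I. e i = of_real (1 - t) * f i + of_real t * g i"
      if "f \<in> conv_combs N G" "g \<in> conv_combs N G" "0 \<le> t" "t \<le> 1" for f g t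
      using that by (rule conv)
    show "\<exists>i\<in>I. f i \<noteq> z i" if "f \<in> conv_combs N G" for f
      using z that unfolding N_def by blast
  qed
  then obtain h \<delta> where h: "\<delta> > 0"
    "\<And>f. f \<in> conv_combs N G \<Longrightarrow> Re (\<Sum>i\<in>I. h i * z i) + \<delta> \<le> Re (\<Sum>i\<in>I. h i * f i)"
    by blast
  have "Re (\<Sum>i\<in>I. h i * z i) + \<delta> \<le> Re (\<Sum>i\<in>I. h i * f i)" if f: "f \<in> G" for f
  proof -
    obtain e where e: "e \<in> conv_combs N G" "\<forall>i\<in>I. e i = f i" using single[OF f] by blast
    then have "(\<Sum>i\<in>I. h i * e i) = (\<Sum>i\<in>I. h i * f i)" by (intro sum.cong) auto
    then show ?thesis using h(2)[OF e(1)] by simp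
  qed
  then show ?thesis using h(1) by blast
qed

section \<open>Matrix tuples\<close>

definition ent :: "('d \<Rightarrow> complex mat) \<Rightarrow> 'd option \<Rightarrow> nat \<Rightarrow> nat \<Rightarrow> complex" where
  "ent X k a b = (case k of None \<Rightarrow> if a = b then 1 else 0 | Some i \<Rightarrow> X i $$ (a, b))"

definition mat_form ::
    "nat \<Rightarrow> ('d \<Rightarrow> complex mat) \<Rightarrow> 'd option \<Rightarrow> (nat \<Rightarrow> complex) \<Rightarrow> (nat \<Rightarrow> complex) \<Rightarrow> complex" where
  "mat_form n X k v w = (\<Sum>a<n. \<Sum>b<n. cnj (v a) * ent X k a b * w b)"

text \<open>The dual description of the matrix range; \<open>matrix_range_eq_cpset\<close>
  identifies the two for self-adjoint tuples at positive levels. It mentions no map on the generated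
  C*-algebra, which is what makes membership easy to verify.\<close>

definition cpset :: "('d::finite \<Rightarrow> 'h::complex_hilbert \<Rightarrow>\<^sub>L 'h) \<Rightarrow> 'd graded_set" where
  "cpset A n = {X. (\<forall>i. X i \<in> carrier_mat n n) \<and> cp_rel (op_form A) (mat_form n X)}"

lemma ent_simps [simp]: "ent X None a b = (if a = b then 1 else 0)" "ent X (Some i) a b = X i $$ (a, b)"
  by (simp_all add: ent_def)

lemma sum_rotate3:
  "(\<Sum>s\<in>S. \<Sum>t\<in>T. \<Sum>m\<in>M. f s t m) = (\<Sum>m\<in>M. \<Sum>s\<in>S. \<Sum>t\<in>T. f s t m)"
proof -
  have "(\<Sum>s\<in>S. \<Sum>t\<in>T. \<Sum>m\<in>M. f s t m) = (\<Sum>s\<in>S. \<Sum>m\<in>M. \<Sum>t\<in>T. f s t m)"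
    by (intro sum.cong refl sum.swap)
  also have "\<dots> = (\<Sum>m\<in>M. \<Sum>s\<in>S. \<Sum>t\<in>T. f s t m)" by (rule sum.swap)
  finally show ?thesis .
qed

lemma sum_sum_mult_sum_sum:
  fixes F :: "'a \<Rightarrow> 'b \<Rightarrow> 'c::comm_semiring_0"
  shows "(\<Sum>a\<in>A. \<Sum>b\<in>B. (\<Sum>s\<in>S. u a s) * F a b * (\<Sum>t\<in>T. w b t))
    = (\<Sum>s\<in>S. \<Sum>t\<in>T. \<Sum>a\<in>A. \<Sum>b\<in>B. u a s * F a b * w b t)"
proof -
  have "(\<Sum>a\<in>A. \<Sum>b\<in>B. (\<Sum>s\<in>S. u a s) * F a b * (\<Sum>t\<in>T. w b t))
      = (\<Sum>a\<in>A. \<Sum>b\<in>B. \<Sum>s\<in>S. \<Sum>t\<in>T. u a s * F a b * w b t)"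
    by (intro sum.cong refl) (simp only: sum_distrib_right[where r = "F _ _"] sum_product)
  also have "\<dots> = (\<Sum>s\<in>S. \<Sum>a\<in>A. \<Sum>b\<in>B. \<Sum>t\<in>T. u a s * F a b * w b t)"
    by (rule sum_rotate3)
  also have "\<dots> = (\<Sum>s\<in>S. \<Sum>t\<in>T. \<Sum>a\<in>A. \<Sum>b\<in>B. u a s * F a b * w b t)"
    by (intro sum.cong refl sum_rotate3)
  finally show ?thesis .
qed

lemma sum_lessThan_single:
  fixes f :: "nat \<Rightarrow> complex"
  assumes "a < n" "\<And>c. c \<noteq> a \<Longrightarrow> f c = 0"
  shows "(\<Sum>c<n. f c) = f a"
  using sum.mono_neutral_right[of "{..<n}" "{a}" f] assms by auto

lemma quadratic_basis:
  fixes Y :: "nat \<Rightarrow> nat \<Rightarrow> complex"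
  assumes "a < n" "b < n"
  shows "(\<Sum>c<n. \<Sum>d<n. cnj (if c = a then 1 else 0) * Y c d * (if d = b then 1 else 0)) = Y a b"
  using assms by (subst sum_lessThan_single[of a] sum_lessThan_single[of b]; simp)+

lemma quadratic_two_points:
  fixes Y :: "nat \<Rightarrow> nat \<Rightarrow> complex" and z :: complex
  assumes "a < n" "b < n" "a \<noteq> b"
  defines "v \<equiv> \<lambda>c. if c = a then 1 else if c = b then z else 0"
  shows "(\<Sum>c<n. \<Sum>d<n. cnj (v c) * Y c d * v d)
    = Y a a + cnj z * Y b a + z * Y a b + cnj z * z * Y b b"
proof -
  have two: "(\<Sum>c<n. f c) = f a + f b" if "\<And>c. c \<noteq> a \<Longrightarrow> c \<noteq> b \<Longrightarrow> f c = 0" for f :: "nat \<Rightarrow> complex"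
  proof -
    have "(\<Sum>c<n. f c) = (\<Sum>c\<in>{a, b}. f c)"
      by (rule sum.mono_neutral_right) (use assms that in auto)
    then show ?thesis using assms by simp
  qed
  have "(\<Sum>c<n. \<Sum>d<n. cnj (v c) * Y c d * v d)
      = (\<Sum>d<n. cnj (v a) * Y a d * v d) + (\<Sum>d<n. cnj (v b) * Y b d * v d)"
    by (rule two) (simp add: v_def)
  also have "\<dots> = (cnj (v a) * Y a a * v a + cnj (v a) * Y a b * v b)
      + (cnj (v b) * Y b a * v a + cnj (v b) * Y b b * v b)"
    by (intro arg_cong2[where f = "(+)"] two) (simp_all add: v_def)
  finally show ?thesis using assms(3) by (simp add: v_def algebra_simps)
qed

text \<open>Basis vectors give a real diagonal; the vectors with entry 1 at \<open>a\<close> and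
  \<open>z\<close> at \<open>b\<close> compare the imaginary parts of the two off-diagonal entries
  for \<open>z = 1\<close> and their real parts for \<open>z = \<i>\<close>.\<close>

lemma hermitian_if_quadratic_real:
  fixes Y :: "nat \<Rightarrow> nat \<Rightarrow> complex"
  assumes re: "\<And>v. Im (\<Sum>a<n. \<Sum>b<n. cnj (v a) * Y a b * v b) = 0" and ab: "a < n" "b < n"
  shows "Y a b = cnj (Y b a)"
proof -
  have diag: "Im (Y a a) = 0" if a: "a < n" for a
    using re[of "\<lambda>c. if c = a then 1 else 0"] unfolding quadratic_basis[OF a a] .
  show ?thesis
  proof (cases "a = b")
    case True
    then show ?thesis using diag[OF ab(1)] by (simp add: complex_eq_iff)
  next
    case False
    have q: "Im (Y a a + cnj z * Y b a + z * Y a b + cnj z * z * Y b b) = 0" for z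
      using re[of "\<lambda>c. if c = a then 1 else if c = b then z else 0"]
      unfolding quadratic_two_points[OF ab False] .
    have "Im (Y b a) = - Im (Y a b)" "Re (Y b a) = Re (Y a b)"
      using q[of 1] q[of \<i>] diag[OF ab(1)] diag[OF ab(2)] by simp_all
    then show ?thesis by (simp add: complex_eq_iff)
  qed
qed

section \<open>Positivity and completely positive maps of matrices\<close>

lemma pos_mat_matrix_iff:
  assumes "\<And>i j. i < p \<Longrightarrow> j < p \<Longrightarrow> M i j \<in> carrier_mat n n"
  shows "pos_mat_matrix n p M \<longleftrightarrow>
    (\<forall>x :: nat \<Rightarrow> nat \<Rightarrow> complex.
      0 \<le> (\<Sum>i<p. \<Sum>j<p. \<Sum>a<n. \<Sum>b<n. cnj (x i a) * M i j $$ (a, b) * x j b))"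
proof -
  have eq: "(\<Sum>i<p. \<Sum>j<p. (M i j *\<^sub>v v j) \<bullet>c v i)
      = (\<Sum>i<p. \<Sum>j<p. \<Sum>a<n. \<Sum>b<n. cnj (vec_index (v i) a) * M i j $$ (a, b) * vec_index (v j) b)"
    if v: "\<forall>i<p. v i \<in> carrier_vec n" for v
  proof (intro sum.cong refl)
    fix i j assume "i \<in> {..<p}" "j \<in> {..<p}"
    then have "M i j \<in> carrier_mat n n" "v i \<in> carrier_vec n" "v j \<in> carrier_vec n"
      using assms v by auto
    then show "(M i j *\<^sub>v v j) \<bullet>c v i
        = (\<Sum>a<n. \<Sum>b<n. cnj (vec_index (v i) a) * M i j $$ (a, b) * vec_index (v j) b)"
      by (auto simp: scalar_prod_def sum_distrib_left sum_distrib_right atLeast0LessThan mult_ac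
          intro!: sum.cong)
  qed
  show ?thesis
  proof
    assume pos: "pos_mat_matrix n p M"
    show "\<forall>x :: nat \<Rightarrow> nat \<Rightarrow> complex.
      0 \<le> (\<Sum>i<p. \<Sum>j<p. \<Sum>a<n. \<Sum>b<n. cnj (x i a) * M i j $$ (a, b) * x j b)"
    proof
      fix x :: "nat \<Rightarrow> nat \<Rightarrow> complex"
      have "0 \<le> (\<Sum>i<p. \<Sum>j<p. (M i j *\<^sub>v Matrix.vec n (x j)) \<bullet>c Matrix.vec n (x i))"
        using pos by (simp add: pos_mat_matrix_def)
      then show "0 \<le> (\<Sum>i<p. \<Sum>j<p. \<Sum>a<n. \<Sum>b<n. cnj (x i a) * M i j $$ (a, b) * x j b)"
        by (subst (asm) eq) auto
    qed
  next
    assume "\<forall>x :: nat \<Rightarrow> nat \<Rightarrow> complex.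
      0 \<le> (\<Sum>i<p. \<Sum>j<p. \<Sum>a<n. \<Sum>b<n. cnj (x i a) * M i j $$ (a, b) * x j b)"
    then show "pos_mat_matrix n p M"
      unfolding pos_mat_matrix_def by (auto simp: eq)
  qed
qed

definition comb_mat :: "nat \<Rightarrow> ('d::finite \<Rightarrow> complex mat) \<Rightarrow> ('d option \<Rightarrow> complex) \<Rightarrow> complex mat" where
  "comb_mat n X c = Matrix.mat n n (\<lambda>(a, b). \<Sum>k\<in>UNIV. c k * ent X k a b)"

lemma comb_mat_carrier [simp]: "comb_mat n X c \<in> carrier_mat n n"
  by (simp add: comb_mat_def)

lemma form_pos_mat_form:
  "form_pos (mat_form n X) p c \<longleftrightarrow> pos_mat_matrix n p (\<lambda>i j. comb_mat n X (\<lambda>k. c k i j))"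
proof -
  have "(\<Sum>k\<in>UNIV. c k i j * mat_form n X k (x i) (x j))
      = (\<Sum>a<n. \<Sum>b<n. cnj (x i a) * comb_mat n X (\<lambda>k. c k i j) $$ (a, b) * x j b)"
    for x :: "nat \<Rightarrow> nat \<Rightarrow> complex" and i j
    unfolding mat_form_def sum_distrib_left
    by (subst sum_rotate3[symmetric])
      (auto simp: comb_mat_def sum_distrib_left sum_distrib_right mult_ac intro!: sum.cong)
  then show ?thesis
    by (simp add: form_pos_def pos_mat_matrix_iff)
qed

lemma linear_map_on_comb_mat:
  assumes lin: "linear_map_on smult_mat smult_mat (carrier_mat n n) \<phi>"
    and carr: "\<phi> ` carrier_mat n n \<subseteq> carrier_mat k k"
    and unit: "\<phi> (1\<^sub>m n) = 1\<^sub>m k" and X: "\<And>i. X i \<in> carrier_mat n n"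
  shows "\<phi> (comb_mat n X c) = comb_mat k (\<lambda>i. \<phi> (X i)) c"
proof -
  define E where "E l = (case l of None \<Rightarrow> 1\<^sub>m n | Some i \<Rightarrow> X i)" for l
  define P where "P I = Matrix.mat n n (\<lambda>(a, b). \<Sum>l\<in>I. c l * ent X l a b)" for I
  define Q where "Q I = Matrix.mat k k (\<lambda>(a, b). \<Sum>l\<in>I. c l * ent (\<lambda>i. \<phi> (X i)) l a b)" for I
  have PE: "P (insert l I) = P I + c l \<cdot>\<^sub>m E l" if "finite I" "l \<notin> I" for l I
    by (rule eq_matI) (use that in \<open>auto simp: P_def E_def carrier_matD[OF X] split: option.split\<close>)
  have carrX: "\<phi> (X i) \<in> carrier_mat k k" for i using carr X by blast
  have QE: "Q (insert l I) = Q I + c l \<cdot>\<^sub>m \<phi> (E l)" if "finite I" "l \<notin> I" for l I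
    by (rule eq_matI) (use that unit in \<open>auto simp: Q_def E_def carrier_matD[OF carrX] split: option.split\<close>)
  have E: "E l \<in> carrier_mat n n" for l using X by (auto simp: E_def split: option.split)
  have "\<phi> (P I) = Q I" if "finite I" for I
    using that
  proof induction
    case empty
    have "P {} = 0 \<cdot>\<^sub>m 1\<^sub>m n" by (rule eq_matI) (auto simp: P_def)
    then have "\<phi> (P {}) = 0 \<cdot>\<^sub>m 1\<^sub>m k"
      using lin unit by (auto simp: linear_map_on_def)
    also have "\<dots> = Q {}" by (rule eq_matI) (auto simp: Q_def)
    finally show ?case .
  next
    case (insert l I)
    have "P I \<in> carrier_mat n n" by (simp add: P_def)
    then have "\<phi> (P I + c l \<cdot>\<^sub>m E l) = \<phi> (P I) + c l \<cdot>\<^sub>m \<phi> (E l)"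
      using lin E[of l] by (auto simp: linear_map_on_def)
    then show ?case using insert by (simp add: PE QE)
  qed
  from this[of UNIV] show ?thesis by (simp add: P_def Q_def comb_mat_def)
qed

lemma cp_rel_ucp:
  assumes "ucp_mat_mat n k \<phi>" and X: "\<And>i. X i \<in> carrier_mat n n"
  shows "cp_rel (mat_form n X) (mat_form k (\<lambda>i. \<phi> (X i)))"
proof -
  have lin: "linear_map_on smult_mat smult_mat (carrier_mat n n) \<phi>"
    and carr: "\<phi> ` carrier_mat n n \<subseteq> carrier_mat k k" and unit: "\<phi> (1\<^sub>m n) = 1\<^sub>m k"
    and cp: "cp_on (pos_mat_matrix n) (pos_mat_matrix k) (carrier_mat n n) \<phi>"
    using assms by (auto simp: ucp_mat_mat_def)
  show ?thesis
    unfolding cp_rel_def form_pos_mat_form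
    using cp by (auto simp: cp_on_def simp flip: linear_map_on_comb_mat[OF lin carr unit X])
qed

text \<open>The sum over \<open>m\<close> of the adjoint of \<open>V m\<close> times
  \<open>Y\<close> times \<open>V m\<close>, where \<open>V m\<close> is the \<open>n\<close> by
  \<open>k\<close> matrix with entries \<open>V m a s\<close>.\<close>

definition kraus :: "nat \<Rightarrow> nat \<Rightarrow> nat \<Rightarrow> (nat \<Rightarrow> nat \<Rightarrow> nat \<Rightarrow> complex) \<Rightarrow> complex mat \<Rightarrow> complex mat" where
  "kraus r n k V Y =
     Matrix.mat k k (\<lambda>(s, t). \<Sum>m<r. \<Sum>a<n. \<Sum>b<n. cnj (V m a s) * Y $$ (a, b) * V m b t)"

text \<open>The form of the image at vectors \<open>x i\<close> is the sum over \<open>m\<close> of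
  the form of \<open>T\<close> at the vectors obtained by applying \<open>V m\<close> to
  \<open>x i\<close>, so positivity survives at every size \<open>p\<close>.\<close>

lemma ucp_kraus:
  assumes unit: "\<And>s t. s < k \<Longrightarrow> t < k \<Longrightarrow>
    (\<Sum>m<r. \<Sum>a<n. cnj (V m a s) * V m a t) = (if s = t then 1 else 0)"
  shows "ucp_mat_mat n k (kraus r n k V)"
  unfolding ucp_mat_mat_def
proof (intro conjI)
  show "kraus r n k V ` carrier_mat n n \<subseteq> carrier_mat k k" by (auto simp: kraus_def)
  show "linear_map_on smult_mat smult_mat (carrier_mat n n) (kraus r n k V)"
    unfolding linear_map_on_def
  proof (intro conjI ballI allI)
    fix x y :: "complex mat" assume xy: "x \<in> carrier_mat n n" "y \<in> carrier_mat n n"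
    show "kraus r n k V (x + y) = kraus r n k V x + kraus r n k V y"
      by (rule eq_matI) (use xy in \<open>auto simp: kraus_def algebra_simps sum.distrib\<close>)
  next
    fix c and x :: "complex mat" assume x: "x \<in> carrier_mat n n"
    show "kraus r n k V (c \<cdot>\<^sub>m x) = c \<cdot>\<^sub>m kraus r n k V x"
      by (rule eq_matI) (use x in \<open>auto simp: kraus_def mult_ac sum_distrib_left\<close>)
  qed
  show "kraus r n k V (1\<^sub>m n) = 1\<^sub>m k"
  proof (rule eq_matI)
    fix s t assume st: "s < dim_row (1\<^sub>m k :: complex mat)" "t < dim_col (1\<^sub>m k :: complex mat)"
    have "(\<Sum>b<n. cnj (V m a s) * 1\<^sub>m n $$ (a, b) * V m b t) = cnj (V m a s) * V m a t"
      if "a < n" for m a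
    proof -
      have "(\<Sum>b<n. cnj (V m a s) * 1\<^sub>m n $$ (a, b) * V m b t)
          = (\<Sum>b<n. if b = a then cnj (V m a s) * V m a t else 0)"
        using that by (intro sum.cong refl) auto
      then show ?thesis using that by simp
    qed
    then show "kraus r n k V (1\<^sub>m n) $$ (s, t) = 1\<^sub>m k $$ (s, t)"
      using st unit[of s t] by (simp add: kraus_def)
  qed (auto simp: kraus_def)
  show "cp_on (pos_mat_matrix n) (pos_mat_matrix k) (carrier_mat n n) (kraus r n k V)"
    unfolding cp_on_def
  proof (intro allI impI)
    fix p T
    assume T: "(\<forall>i<p. \<forall>j<p. T i j \<in> carrier_mat n n) \<and> pos_mat_matrix n p T"
    then have pos: "0 \<le> (\<Sum>i<p. \<Sum>j<p. \<Sum>a<n. \<Sum>b<n. cnj (x i a) * T i j $$ (a, b) * x j b)"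
      for x :: "nat \<Rightarrow> nat \<Rightarrow> complex"
      using pos_mat_matrix_iff[of p T n] by blast
    have "0 \<le> (\<Sum>i<p. \<Sum>j<p. \<Sum>s<k. \<Sum>t<k.
        cnj (x i s) * kraus r n k V (T i j) $$ (s, t) * x j t)" for x :: "nat \<Rightarrow> nat \<Rightarrow> complex"
    proof -
      define y where "y m i a = (\<Sum>s<k. V m a s * x i s)" for m i a
      have "(\<Sum>s<k. \<Sum>t<k. cnj (x i s) * kraus r n k V (T i j) $$ (s, t) * x j t)
          = (\<Sum>m<r. \<Sum>a<n. \<Sum>b<n. cnj (y m i a) * T i j $$ (a, b) * y m j b)" for i j
      proof -
        have "(\<Sum>s<k. \<Sum>t<k. cnj (x i s) * kraus r n k V (T i j) $$ (s, t) * x j t)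
            = (\<Sum>s<k. \<Sum>t<k. \<Sum>m<r. \<Sum>a<n. \<Sum>b<n.
                cnj (V m a s * x i s) * T i j $$ (a, b) * (V m b t * x j t))"
          by (intro sum.cong refl) (simp add: kraus_def sum_distrib_left sum_distrib_right mult_ac)
        also have "\<dots> = (\<Sum>m<r. \<Sum>s<k. \<Sum>t<k. \<Sum>a<n. \<Sum>b<n.
                cnj (V m a s * x i s) * T i j $$ (a, b) * (V m b t * x j t))"
          by (rule sum_rotate3)
        also have "\<dots> = (\<Sum>m<r. \<Sum>a<n. \<Sum>b<n. cnj (y m i a) * T i j $$ (a, b) * y m j b)"
          unfolding y_def cnj_sum by (simp only: sum_sum_mult_sum_sum)
        finally show ?thesis .
      qed
      then have "(\<Sum>i<p. \<Sum>j<p. \<Sum>s<k. \<Sum>t<k.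
          cnj (x i s) * kraus r n k V (T i j) $$ (s, t) * x j t)
        = (\<Sum>i<p. \<Sum>j<p. \<Sum>m<r. \<Sum>a<n. \<Sum>b<n. cnj (y m i a) * T i j $$ (a, b) * y m j b)"
        by simp
      also have "\<dots> = (\<Sum>m<r. \<Sum>i<p. \<Sum>j<p. \<Sum>a<n. \<Sum>b<n.
          cnj (y m i a) * T i j $$ (a, b) * y m j b)"
        by (rule sum_rotate3)
      finally show ?thesis using pos by (simp add: sum_nonneg)
    qed
    then show "pos_mat_matrix k p (\<lambda>i j. kraus r n k V (T i j))"
      by (subst pos_mat_matrix_iff) (auto simp: kraus_def)
  qed
qed

section \<open>Self-adjointness and matrix convexity of \<open>cpset A\<close>\<close>

lemma mat_form_direct_sum:
  assumes X: "\<And>i. X i \<in> carrier_mat n n" and Y: "\<And>i. Y i \<in> carrier_mat m m"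
  shows "mat_form (n + m) (\<lambda>i. mat_direct_sum (X i) (Y i)) k v w
    = mat_form n X k v w + mat_form m Y k (\<lambda>a. v (n + a)) (\<lambda>a. w (n + a))"
proof -
  let ?E = "ent (\<lambda>i. mat_direct_sum (X i) (Y i)) k"
  have E: "?E a b = ent X k a b" if "a < n" "b < n" for a b
    using that X Y by (cases k) (auto simp: mat_direct_sum_def carrier_matD[OF X] carrier_matD[OF Y])
  have E0: "?E a (n + b) = 0" if "a < n" "b < m" for a b
    using that by (cases k) (auto simp: mat_direct_sum_def carrier_matD[OF X] carrier_matD[OF Y])
  have E1: "?E (n + a) b = 0" if "a < m" "b < n" for a b
    using that by (cases k) (auto simp: mat_direct_sum_def carrier_matD[OF X] carrier_matD[OF Y])
  have E2: "?E (n + a) (n + b) = ent Y k a b" if "a < m" "b < m" for a b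
    using that by (cases k) (auto simp: mat_direct_sum_def carrier_matD[OF X] carrier_matD[OF Y])
  have split: "(\<Sum>a<n + m. f a) = (\<Sum>a<n. f a) + (\<Sum>a<m. f (n + a))" for f :: "nat \<Rightarrow> complex"
  proof -
    have "(\<Sum>a<n + m. f a) = (\<Sum>a<n. f a) + (\<Sum>a\<in>{n..<n + m}. f a)"
      by (metis atLeast0LessThan le_add1 le0 sum.atLeastLessThan_concat)
    also have "(\<Sum>a\<in>{n..<n + m}. f a) = (\<Sum>a<m. f (n + a))"
      using sum.shift_bounds_nat_ivl[of f 0 n m] by (simp add: atLeast0LessThan add.commute)
    finally show ?thesis .
  qed
  show ?thesis
    unfolding mat_form_def split by (simp add: E E0 E1 E2 sum.distrib)
qed

lemma selfadjoint_mats_iff: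
  "X \<in> selfadjoint_mats n \<longleftrightarrow>
    X \<in> carrier_mat n n \<and> (\<forall>a<n. \<forall>b<n. X $$ (a, b) = cnj (X $$ (b, a)))"
proof -
  have "mat_adjoint X = X \<longleftrightarrow> (\<forall>a<n. \<forall>b<n. X $$ (a, b) = cnj (X $$ (b, a)))"
    if X: "X \<in> carrier_mat n n"
  proof -
    have ent: "mat_adjoint X $$ (a, b) = cnj (X $$ (b, a))" if "a < n" "b < n" for a b
      using that X by (simp add: mat_adjoint_def mat_of_rows_def)
    have dim: "mat_adjoint X \<in> carrier_mat n n"
      using X by (simp add: mat_adjoint_def mat_of_rows_def)
    show ?thesis
    proof
      assume "mat_adjoint X = X"
      then show "\<forall>a<n. \<forall>b<n. X $$ (a, b) = cnj (X $$ (b, a))" using ent by metis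
    next
      assume sym: "\<forall>a<n. \<forall>b<n. X $$ (a, b) = cnj (X $$ (b, a))"
      show "mat_adjoint X = X"
      proof (rule eq_matI)
        fix a b assume "a < dim_row X" "b < dim_col X"
        then have "a < n" "b < n" using X by auto
        then show "mat_adjoint X $$ (a, b) = X $$ (a, b)" using ent sym by metis
      qed (use X dim in auto)
    qed
  qed
  then show ?thesis by (auto simp: selfadjoint_mats_def)
qed

lemma op_form_Some_Im:
  assumes "A i \<in> selfadjoint_ops"
  shows "Im (op_form A (Some i) x x) = 0"
proof -
  have "cinner (blinfun_apply (A i) x) x = cinner x (blinfun_apply (A i) x)"
    using assms by (auto simp: selfadjoint_ops_def is_adjoint_def)
  then have "cnj (cinner x (blinfun_apply (A i) x)) = cinner x (blinfun_apply (A i) x)"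
    by (metis cinner_commute)
  then show ?thesis by (simp add: op_form_def complex_eq_iff)
qed

lemma op_form_None: "op_form A None x x = of_real ((norm x)\<^sup>2)"
  by (simp add: op_form_def cinner_self)

lemma op_form_bound: "cmod (op_form A (Some i) x x) \<le> norm (A i) * (norm x)\<^sup>2"
proof -
  have "cmod (op_form A (Some i) x x) \<le> norm x * norm (blinfun_apply (A i) x)"
    by (simp add: op_form_def norm_cinner_le)
  also have "\<dots> \<le> norm x * (norm (A i) * norm x)"
    by (intro mult_left_mono norm_blinfun) simp
  finally show ?thesis by (simp add: power2_eq_square mult_ac)
qed

lemma sum_option_single:
  fixes G :: "'d::finite option \<Rightarrow> 'c::comm_semiring_0"
  shows "(\<Sum>k\<in>UNIV. (if k = None then z else if k = Some i then s else 0) * G k)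
    = z * G None + s * G (Some i)"
proof -
  have "(\<Sum>j\<in>UNIV. (if Some j = None then z else if Some j = Some i then s else 0) * G (Some j))
      = (\<Sum>j\<in>UNIV. if j = i then s * G (Some i) else 0)"
    by (intro sum.cong) auto
  then show ?thesis unfolding sum_option by simp
qed

text \<open>This is positivity of \<open>norm (A i)\<close> times the identity plus or minus
  \<open>A i\<close>. The same inequality later yields self-adjointness of the members of
  \<open>cpset A\<close> and boundedness of the state set.\<close>

lemma op_form_bound_pos:
  fixes A :: "'d::finite \<Rightarrow> 'h::complex_hilbert \<Rightarrow>\<^sub>L 'h"
  assumes A: "A i \<in> selfadjoint_ops" and s: "s = 1 \<or> s = -1"
  shows "0 \<le> (\<Sum>k\<in>UNIV. (if k = None then of_real (norm (A i)) else if k = Some i then s else 0)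
    * op_form A k x x)"
proof -
  let ?c = "\<lambda>k. if k = None then of_real (norm (A i)) else if k = Some i then s else 0"
  have eq: "(\<Sum>k\<in>UNIV. ?c k * op_form A k x x)
      = of_real (norm (A i) * (norm x)\<^sup>2) + s * op_form A (Some i) x x"
    by (subst sum_option_single) (simp add: op_form_None)
  have "\<bar>Re (op_form A (Some i) x x)\<bar> \<le> norm (A i) * (norm x)\<^sup>2"
    by (rule order_trans[OF abs_Re_le_cmod op_form_bound])
  then show ?thesis
    unfolding eq using op_form_Some_Im[of A i x, OF A] s
    by (auto simp: less_eq_complex_def simp del: of_real_mult of_real_power)
qed

text \<open>\<open>norm (A i)\<close> times the identity plus \<open>A i\<close> is positive, so the
  corresponding form built from \<open>X i\<close> is nonnegative, in particular real; subtracting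
  the real contribution of the unit leaves a real form for \<open>X i\<close>.\<close>

lemma cpset_selfadjoint:
  assumes A: "\<And>i. A i \<in> selfadjoint_ops" and X: "X \<in> cpset A n"
  shows "X i \<in> selfadjoint_mats n"
proof -
  have carr: "X i \<in> carrier_mat n n" and rel: "pos_rel (op_form A) (mat_form n X)"
    using X by (auto simp: cpset_def cp_rel_imp_pos_rel)
  have "Im (mat_form n X (Some i) v v) = 0" for v
  proof -
    let ?c = "\<lambda>k. if k = None then of_real (norm (A i)) else if k = Some i then 1 else 0"
    have eq: "(\<Sum>k\<in>UNIV. ?c k * mat_form n X k v v)
        = of_real (norm (A i)) * mat_form n X None v v + mat_form n X (Some i) v v"
      by (subst sum_option_single) simp
    have "0 \<le> (\<Sum>k\<in>UNIV. ?c k * mat_form n X k v v)"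
      using rel[unfolded pos_rel_def, rule_format, of ?c v] op_form_bound_pos[of A i 1, OF A] by auto
    moreover have "Im (mat_form n X None v v) = 0"
      by (simp add: mat_form_def if_distrib if_distribR cong: if_cong)
    ultimately show ?thesis unfolding eq by (auto simp: less_eq_complex_def)
  qed
  then have "\<And>v. Im (\<Sum>a<n. \<Sum>b<n. cnj (v a) * X i $$ (a, b) * v b) = 0"
    by (simp add: mat_form_def)
  note re = this
  show ?thesis
    unfolding selfadjoint_mats_iff
  proof (intro conjI allI impI)
    show "X i \<in> carrier_mat n n" by (rule carr)
    show "X i $$ (a, b) = cnj (X i $$ (b, a))" if "a < n" "b < n" for a b
      by (rule hermitian_if_quadratic_real[where Y = "\<lambda>a b. X i $$ (a, b)", OF re that])
  qed
qed

text \<open>The form of a direct sum is the sum of the two forms, and a unital completely positive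
  map is composed with the given relation by transitivity.\<close>

lemma matrix_convex_cpset:
  assumes A: "\<And>i. A i \<in> selfadjoint_ops"
  shows "matrix_convex (cpset A)"
  unfolding matrix_convex_def
proof (intro conjI allI impI ballI)
  fix n X i assume "X \<in> cpset A n"
  then show "X i \<in> selfadjoint_mats n" by (rule cpset_selfadjoint[OF A])
next
  fix n m :: nat and X Y
  assume X: "X \<in> cpset A n" and Y: "Y \<in> cpset A m"
  have Xc: "\<And>i. X i \<in> carrier_mat n n" and Yc: "\<And>i. Y i \<in> carrier_mat m m"
    using X Y by (auto simp: cpset_def)
  have "cp_rel (op_form A) (mat_form (n + m) (\<lambda>i. mat_direct_sum (X i) (Y i)))"
    unfolding cp_rel_def
  proof (intro allI impI)
    fix p c assume "form_pos (op_form A) p c"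
    then have "form_pos (mat_form n X) p c" "form_pos (mat_form m Y) p c"
      using X Y by (auto simp: cpset_def cp_rel_def)
    then have "0 \<le> (\<Sum>i<p. \<Sum>j<p. \<Sum>k\<in>UNIV. c k i j * mat_form n X k (x i) (x j)) +
        (\<Sum>i<p. \<Sum>j<p. \<Sum>k\<in>UNIV. c k i j * mat_form m Y k (\<lambda>a. x i (n + a)) (\<lambda>a. x j (n + a)))" for x
      unfolding form_pos_def by (intro add_nonneg_nonneg) (auto dest: spec[of _ "\<lambda>i a. x i (n + a)"])
    then show "form_pos (mat_form (n + m) (\<lambda>i. mat_direct_sum (X i) (Y i))) p c"
      unfolding form_pos_def mat_form_direct_sum[OF Xc Yc]
      by (simp add: sum.distrib distrib_left)
  qed
  moreover have "mat_direct_sum (X i) (Y i) \<in> carrier_mat (n + m) (n + m)" for i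
    using Xc[of i] Yc[of i] by (auto simp: mat_direct_sum_def)
  ultimately show "(\<lambda>i. mat_direct_sum (X i) (Y i)) \<in> cpset A (n + m)"
    by (simp add: cpset_def)
next
  fix n k :: nat and \<phi> X
  assume \<phi>: "ucp_mat_mat n k \<phi>" and X: "X \<in> cpset A n"
  have Xc: "\<And>i. X i \<in> carrier_mat n n" using X by (auto simp: cpset_def)
  have "cp_rel (op_form A) (mat_form k (\<lambda>i. \<phi> (X i)))"
    using X by (intro cp_rel_trans[OF _ cp_rel_ucp[of n k \<phi> X, OF \<phi> Xc]]) (simp add: cpset_def)
  moreover have "\<phi> (X i) \<in> carrier_mat k k" for i
    using \<phi> Xc by (auto simp: ucp_mat_mat_def)
  ultimately show "(\<lambda>i. \<phi> (X i)) \<in> cpset A k" by (simp add: cpset_def)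
qed

section \<open>The matrix range of an operator tuple\<close>

lemma op_form_scaleR: "op_form A k (r *\<^sub>R x) (s *\<^sub>R y) = of_real (r * s) * op_form A k x y"
proof -
  have "cinner (r *\<^sub>R x) z = of_real r * cinner x z" for z
    by (simp add: cinner_scaleC_left flip: scaleC_of_real)
  then show ?thesis by (simp add: op_form_def blinfun.scaleR_right cinner_scaleR_right)
qed

lemma bounded_linear_scaleC: "bounded_linear (\<lambda>y :: 'a::complex_hilbert. c *\<^sub>C y)"
proof (rule bounded_linear_intro[where K = "cmod c"])
  show "c *\<^sub>C r *\<^sub>R y = r *\<^sub>R c *\<^sub>C y" for r and y :: 'a
    by (simp add: scaleC_scaleC mult.commute flip: scaleC_of_real)
qed (simp_all add: scaleC_add_right norm_scaleC mult.commute)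

text \<open>Its purpose is that \<open>cstar A\<close> consists of complex linear operators, since
  members of \<open>cp_functionals\<close> are required to be positive only on matrices over
  \<open>bounded_ops\<close>.\<close>

lemma bounded_ops_cstar: "unital_cstar_subalgebra bounded_ops"
  unfolding unital_cstar_subalgebra_def
proof (intro conjI ballI allI impI)
  show "id_blinfun \<in> bounded_ops" by (simp add: bounded_ops_def)
  show "T + R \<in> bounded_ops" "T o\<^sub>L R \<in> bounded_ops"
    if "T \<in> bounded_ops" "R \<in> bounded_ops" for T R :: "'a \<Rightarrow>\<^sub>L 'a"
    using that by (simp_all add: bounded_ops_def blinfun.add_left scaleC_add_right)
  show "c *\<^sub>C T \<in> bounded_ops" if "T \<in> bounded_ops" for c and T :: "'a \<Rightarrow>\<^sub>L 'a"
    using that by (simp add: bounded_ops_def scaleC_scaleC mult.commute)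
  show "T' \<in> bounded_ops" if T: "T \<in> bounded_ops" and adj: "is_adjoint T T'" for T T' :: "'a \<Rightarrow>\<^sub>L 'a"
    unfolding bounded_ops_def
  proof (intro CollectI allI)
    fix c x
    let ?z = "blinfun_apply T' (c *\<^sub>C x) - c *\<^sub>C blinfun_apply T' x"
    have "cinner y ?z = 0" for y
      using adj[unfolded is_adjoint_def, rule_format, symmetric]
      by (simp add: cinner_diff_right cinner_scaleC_right)
    then have "?z = 0" using cinner_eq_zero_iff by blast
    then show "blinfun_apply T' (c *\<^sub>C x) = c *\<^sub>C blinfun_apply T' x" by simp
  qed
  have cont: "continuous_on UNIV (\<lambda>T. blinfun_apply T x)" for x :: 'a
    by (intro continuous_intros)
  have "closed {T :: 'a \<Rightarrow>\<^sub>L 'a. \<forall>c x. blinfun_apply T (c *\<^sub>C x) = c *\<^sub>C blinfun_apply T x}"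
    by (intro closed_Collect_all closed_Collect_eq cont
        bounded_linear.continuous_on[OF bounded_linear_scaleC])
  then show "closed (bounded_ops :: ('a \<Rightarrow>\<^sub>L 'a) set)" by (simp add: bounded_ops_def)
qed simp

lemma cstar_subset_bounded_ops:
  assumes "\<And>i. A i \<in> bounded_ops"
  shows "cstar A \<subseteq> bounded_ops"
  using assms bounded_ops_cstar by (auto simp: cstar_def)

lemma cstar_closed:
  shows "id_blinfun \<in> cstar A" "A i \<in> cstar A"
    and "T \<in> cstar A \<Longrightarrow> R \<in> cstar A \<Longrightarrow> T + R \<in> cstar A"
    and "T \<in> cstar A \<Longrightarrow> c *\<^sub>C T \<in> cstar A"
  by (auto simp: cstar_def unital_cstar_subalgebra_def)

lemma cstar_sum:
  assumes "finite I"
  shows "(\<Sum>l\<in>I. c l *\<^sub>C aug A l) \<in> cstar A"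
  using assms
proof induction
  case empty
  have "0 *\<^sub>C id_blinfun \<in> cstar A" by (intro cstar_closed)
  moreover have "0 *\<^sub>C id_blinfun = (0 :: 'b \<Rightarrow>\<^sub>L 'b)" by (rule blinfun_eqI) simp
  ultimately show ?case by simp
next
  case (insert l I)
  have "aug A l \<in> cstar A" by (cases l) (simp_all add: cstar_closed)
  then show ?case using insert by (simp add: cstar_closed)
qed

lemma comb_in_cstar: "comb A c \<in> cstar A"
  unfolding comb_def by (rule cstar_sum) simp

lemma ucp_to_mat_comb:
  assumes "ucp_to_mat (cstar A) n \<phi>"
  shows "\<phi> (comb A c) = comb_mat n (\<lambda>i. \<phi> (A i)) c"
proof -
  have lin: "linear_map_on scaleC smult_mat (cstar A) \<phi>"
    and carr: "\<phi> ` cstar A \<subseteq> carrier_mat n n" and unit: "\<phi> id_blinfun = 1\<^sub>m n"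
    using assms by (auto simp: ucp_to_mat_def)
  define P where "P I = (\<Sum>l\<in>I. c l *\<^sub>C aug A l)" for I
  define Q where "Q I = Matrix.mat n n (\<lambda>(a, b). \<Sum>l\<in>I. c l * ent (\<lambda>i. \<phi> (A i)) l a b)" for I
  have carrA: "\<phi> (A i) \<in> carrier_mat n n" for i using carr cstar_closed(2) by blast
  have QE: "Q (insert l I) = Q I + c l \<cdot>\<^sub>m \<phi> (aug A l)" if "finite I" "l \<notin> I" for l I
    by (cases l; rule eq_matI) (use that unit in \<open>auto simp: Q_def carrier_matD[OF carrA]\<close>)
  have aug: "aug A l \<in> cstar A" for l by (cases l) (simp_all add: cstar_closed)
  have "\<phi> (P I) = Q I" if "finite I" for I
    using that
  proof induction
    case empty
    have "P {} = 0 *\<^sub>C id_blinfun" by (rule blinfun_eqI) (simp add: P_def)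
    moreover have "\<phi> (0 *\<^sub>C id_blinfun) = 0 \<cdot>\<^sub>m \<phi> id_blinfun"
      using lin[unfolded linear_map_on_def] cstar_closed(1)[of A] by blast
    ultimately have "\<phi> (P {}) = 0 \<cdot>\<^sub>m 1\<^sub>m n" by (simp add: unit)
    also have "\<dots> = Q {}" by (rule eq_matI) (auto simp: Q_def)
    finally show ?case .
  next
    case (insert l I)
    have "P I \<in> cstar A" unfolding P_def by (rule cstar_sum) (rule insert)
    then have "\<phi> (P I + c l *\<^sub>C aug A l) = \<phi> (P I) + c l \<cdot>\<^sub>m \<phi> (aug A l)"
      using lin aug[of l] cstar_closed(4)[OF aug[of l]] by (simp add: linear_map_on_def)
    moreover have "P (insert l I) = P I + c l *\<^sub>C aug A l"
      using insert by (simp add: P_def add.commute)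
    ultimately show ?case using insert by (simp add: QE)
  qed
  from this[of UNIV] show ?thesis by (simp add: P_def Q_def comb_mat_def comb_def)
qed

lemma matrix_range_subset_cpset: "matrix_range A n \<subseteq> cpset A n"
proof
  fix X assume "X \<in> matrix_range A n"
  then obtain \<phi> where \<phi>: "ucp_to_mat (cstar A) n \<phi>" and X: "X = (\<lambda>i. \<phi> (A i))"
    by (auto simp: matrix_range_def)
  have carr: "X i \<in> carrier_mat n n" for i
    using \<phi> cstar_closed(2)[of A i] unfolding X ucp_to_mat_def by blast
  have cp: "pos_mat_matrix n p (\<lambda>i j. \<phi> (T i j))"
    if "\<forall>i<p. \<forall>j<p. T i j \<in> cstar A" "pos_op_matrix p T" for p T
    using \<phi> that by (simp add: ucp_to_mat_def cp_on_def)
  have "cp_rel (op_form A) (mat_form n X)"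
    unfolding cp_rel_def
  proof (intro allI impI)
    fix p c assume "form_pos (op_form A) p c"
    then have "pos_op_matrix p (\<lambda>i j. comb A (\<lambda>k. c k i j))" by (simp add: pos_op_matrix_comb)
    then have "pos_mat_matrix n p (\<lambda>i j. \<phi> (comb A (\<lambda>k. c k i j)))"
      by (intro cp) (simp_all add: comb_in_cstar)
    then show "form_pos (mat_form n X) p c"
      by (simp add: ucp_to_mat_comb[OF \<phi>] form_pos_mat_form X)
  qed
  then show "X \<in> cpset A n" using carr by (simp add: cpset_def)
qed

section \<open>The compact convex set of completely positive functionals\<close>

lemma closed_Collect_nonneg_complex:
  fixes g :: "'a::topological_space \<Rightarrow> complex"
  assumes "continuous_on UNIV g"
  shows "closed {f. 0 \<le> g f}"
proof -
  show ?thesis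
    unfolding less_eq_complex_def zero_complex.sel
    by (intro closed_Collect_conj closed_Collect_le closed_Collect_eq continuous_intros assms)
qed

text \<open>Completely positive maps into \<open>n \<times> n\<close> matrices, normalized by trace one at the unit. With
  the weaker normalization no Lagrange multiplier is needed for the condition \<open>f(I) = I/n\<close>, which
  becomes one more coordinate in the separation argument.\<close>

definition cp_functionals :: "nat \<Rightarrow> (('h::complex_hilbert \<Rightarrow>\<^sub>L 'h) \<times> nat \<times> nat \<Rightarrow> complex) set" where
  "cp_functionals n = {f.
     (\<forall>x. f x \<in> cball 0 (norm (fst x))) \<and>
     (\<forall>T R a b. f (T + R, a, b) = f (T, a, b) + f (R, a, b)) \<and>
     (\<forall>c T a b. f (c *\<^sub>C T, a, b) = c * f (T, a, b)) \<and>
     (\<Sum>a<n. f (id_blinfun, a, a)) = 1 \<and>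
     (\<forall>p T x. (\<forall>i<p. \<forall>j<p. T i j \<in> bounded_ops) \<and> pos_op_matrix p T \<longrightarrow>
       0 \<le> (\<Sum>i<p. \<Sum>j<p. \<Sum>a<n. \<Sum>b<n. cnj (x i a) * f (T i j, a, b) * x j b))}"

text \<open>Tychonoff: the norm bound confines each value to a disc, and every other condition
  involves finitely many values of \<open>f\<close>, hence is closed in the product
  topology.\<close>

lemma compact_cp_functionals: "compact (cp_functionals n)"
proof -
  have coord: "continuous_on UNIV (\<lambda>f :: ('a \<Rightarrow>\<^sub>L 'a) \<times> nat \<times> nat \<Rightarrow> complex. f x)" for x
    by (rule continuous_on_product_coordinates)
  have "compact {f :: ('a \<Rightarrow>\<^sub>L 'a) \<times> nat \<times> nat \<Rightarrow> complex. \<forall>x. f x \<in> cball 0 (norm (fst x))}"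
    by (intro compact_Pi_UNIV compact_cball)
  moreover have "closed {f :: ('a \<Rightarrow>\<^sub>L 'a) \<times> nat \<times> nat \<Rightarrow> complex.
     (\<forall>T R a b. f (T + R, a, b) = f (T, a, b) + f (R, a, b)) \<and>
     (\<forall>c T a b. f (c *\<^sub>C T, a, b) = c * f (T, a, b)) \<and>
     (\<Sum>a<n. f (id_blinfun, a, a)) = 1 \<and>
     (\<forall>p T x. (\<forall>i<p. \<forall>j<p. T i j \<in> bounded_ops) \<and> pos_op_matrix p T \<longrightarrow>
       0 \<le> (\<Sum>i<p. \<Sum>j<p. \<Sum>a<n. \<Sum>b<n. cnj (x i a) * f (T i j, a, b) * x j b))}"
  proof (intro closed_Collect_conj closed_Collect_all)
    fix p :: nat and T :: "nat \<Rightarrow> nat \<Rightarrow> 'a \<Rightarrow>\<^sub>L 'a" and x :: "nat \<Rightarrow> nat \<Rightarrow> complex"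
    show "closed {f. (\<forall>i<p. \<forall>j<p. T i j \<in> bounded_ops) \<and> pos_op_matrix p T \<longrightarrow>
       0 \<le> (\<Sum>i<p. \<Sum>j<p. \<Sum>a<n. \<Sum>b<n. cnj (x i a) * f (T i j, a, b) * x j b)}"
    proof (cases "(\<forall>i<p. \<forall>j<p. T i j \<in> bounded_ops) \<and> pos_op_matrix p T")
      case True
      have "closed {f. 0 \<le> (\<Sum>i<p. \<Sum>j<p. \<Sum>a<n. \<Sum>b<n. cnj (x i a) * f (T i j, a, b) * x j b)}"
        by (intro closed_Collect_nonneg_complex continuous_intros coord)
      then show ?thesis using True by simp
    next
      case False
      then have "{f. (\<forall>i<p. \<forall>j<p. T i j \<in> bounded_ops) \<and> pos_op_matrix p T \<longrightarrow>
        0 \<le> (\<Sum>i<p. \<Sum>j<p. \<Sum>a<n. \<Sum>b<n. cnj (x i a) * f (T i j, a, b) * x j b)} = UNIV"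
        by blast
      then show ?thesis by (simp only: closed_UNIV)
    qed
  qed (intro closed_Collect_eq continuous_intros coord)+
  ultimately show ?thesis
    unfolding cp_functionals_def Collect_conj_eq by (rule compact_Int_closed)
qed

lemma cp_functionals_bound: "f \<in> cp_functionals n \<Longrightarrow> cmod (f x) \<le> norm (fst x)"
  unfolding cp_functionals_def mem_Collect_eq mem_cball dist_0_norm by blast

lemma cp_functionals_pos:
  assumes "f \<in> cp_functionals n" "(\<forall>i<p. \<forall>j<p. T i j \<in> bounded_ops) \<and> pos_op_matrix p T"
  shows "0 \<le> (\<Sum>i<p. \<Sum>j<p. \<Sum>a<n. \<Sum>b<n. cnj (x i a) * f (T i j, a, b) * x j b)"
  using assms unfolding cp_functionals_def mem_Collect_eq by blast

lemma cp_functionals_convex: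
  fixes f g :: "('h::complex_hilbert \<Rightarrow>\<^sub>L 'h) \<times> nat \<times> nat \<Rightarrow> complex"
  assumes f: "f \<in> cp_functionals n" and g: "g \<in> cp_functionals n" and t: "0 \<le> t" "t \<le> 1"
  shows "(\<lambda>x. of_real (1 - t) * f x + of_real t * g x) \<in> cp_functionals n"
  unfolding cp_functionals_def
proof (intro CollectI conjI allI impI)
  fix x
  have "cmod (f x) \<le> norm (fst x)" "cmod (g x) \<le> norm (fst x)"
    using f g by (auto intro: cp_functionals_bound)
  then have "(1 - t) * cmod (f x) + t * cmod (g x) \<le> (1 - t) * norm (fst x) + t * norm (fst x)"
    using t by (intro add_mono mult_left_mono) auto
  moreover have "cmod (of_real (1 - t) * f x + of_real t * g x) \<le> (1 - t) * cmod (f x) + t * cmod (g x)"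
    using t by (intro norm_triangle_le) (simp add: norm_mult del: of_real_diff)
  ultimately show "of_real (1 - t) * f x + of_real t * g x \<in> cball 0 (norm (fst x))"
    by (simp add: algebra_simps)
next
  show "(\<Sum>a<n. of_real (1 - t) * f (id_blinfun, a, a) + of_real t * g (id_blinfun, a, a)) = 1"
  proof -
    have "(\<Sum>a<n. f (id_blinfun, a, a)) = 1" "(\<Sum>a<n. g (id_blinfun, a, a)) = 1"
      using f g by (auto simp: cp_functionals_def)
    then show ?thesis by (simp add: sum.distrib flip: sum_distrib_left)
  qed
next
  fix p and T :: "nat \<Rightarrow> nat \<Rightarrow> 'h \<Rightarrow>\<^sub>L 'h" and x
  assume T: "(\<forall>i<p. \<forall>j<p. T i j \<in> bounded_ops) \<and> pos_op_matrix p T"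
  let ?S = "\<lambda>f. \<Sum>i<p. \<Sum>j<p. \<Sum>a<n. \<Sum>b<n. cnj (x i a) * f (T i j, a, b) * x j b"
  have "0 \<le> ?S f" "0 \<le> ?S g" by (rule cp_functionals_pos[OF f T], rule cp_functionals_pos[OF g T])
  then have "0 \<le> of_real (1 - t) * ?S f + of_real t * ?S g"
    using t by (intro add_nonneg_nonneg mult_nonneg_nonneg) (auto simp: less_eq_complex_def)
  also have "\<dots> = ?S (\<lambda>x. of_real (1 - t) * f x + of_real t * g x)"
    unfolding sum_distrib_left sum.distrib[symmetric]
    by (intro sum.cong refl) (simp add: algebra_simps)
  finally show "0 \<le> ?S (\<lambda>x. of_real (1 - t) * f x + of_real t * g x)" .
qed (use f g in \<open>auto simp: cp_functionals_def algebra_simps\<close>)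

text \<open>Compressions to the vectors \<open>x a\<close> supply the members at which a separating
  functional is evaluated; the normalisation is trace one at the unit. The value 0 outside the block
  keeps the norm bound valid for all indices.\<close>

lemma compression_in_cp_functionals:
  fixes x :: "nat \<Rightarrow> 'h::complex_hilbert"
  assumes norm: "(\<Sum>a<n. (norm (x a))\<^sup>2) = 1"
  shows "(\<lambda>(T, a, b). if a < n \<and> b < n then cinner (x a) (blinfun_apply T (x b)) else 0)
    \<in> cp_functionals n"
  unfolding cp_functionals_def
proof (intro CollectI conjI allI impI)
  fix y :: "('h \<Rightarrow>\<^sub>L 'h) \<times> nat \<times> nat"
  obtain T a b where y: "y = (T, a, b)" by (cases y)
  have le1: "norm (x a) \<le> 1" if "a < n" for a
  proof -
    have "(norm (x a))\<^sup>2 \<le> (\<Sum>a<n. (norm (x a))\<^sup>2)"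
      using that by (intro member_le_sum) auto
    then show ?thesis using norm by (simp add: power_le_one_iff)
  qed
  have "cmod (cinner (x a) (blinfun_apply T (x b))) \<le> norm T" if "a < n" "b < n"
  proof -
    have "cmod (cinner (x a) (blinfun_apply T (x b))) \<le> norm (x a) * norm (blinfun_apply T (x b))"
      by (rule norm_cinner_le)
    also have "\<dots> \<le> 1 * (norm T * norm (x b))"
      using le1[OF that(1)] by (intro mult_mono norm_blinfun) auto
    also have "\<dots> \<le> norm T" using le1[OF that(2)] by (simp add: mult_left_le)
    finally show ?thesis .
  qed
  then show "(case y of (T, a, b) \<Rightarrow>
      if a < n \<and> b < n then cinner (x a) (blinfun_apply T (x b)) else 0) \<in> cball 0 (norm (fst y))"
    by (simp add: y)
next
  have "(\<Sum>a<n. cinner (x a) (x a)) = complex_of_real (\<Sum>a<n. (norm (x a))\<^sup>2)"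
    by (simp add: cinner_self)
  then show "(\<Sum>a<n. case (id_blinfun, a, a) of (T, a, b) \<Rightarrow>
      if a < n \<and> b < n then cinner (x a) (blinfun_apply T (x b)) else 0) = 1"
    using norm by simp
next
  fix p and T :: "nat \<Rightarrow> nat \<Rightarrow> 'h \<Rightarrow>\<^sub>L 'h" and v :: "nat \<Rightarrow> nat \<Rightarrow> complex"
  assume T: "(\<forall>i<p. \<forall>j<p. T i j \<in> bounded_ops) \<and> pos_op_matrix p T"
  define y where "y i = (\<Sum>a<n. v i a *\<^sub>C x a)" for i
  have "0 \<le> (\<Sum>i<p. \<Sum>j<p. cinner (y i) (blinfun_apply (T i j) (y j)))"
    using T by (simp add: pos_op_matrix_def)
  also have "\<dots> = (\<Sum>i<p. \<Sum>j<p. \<Sum>a<n. \<Sum>b<n.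
      cnj (v i a) * cinner (x a) (blinfun_apply (T i j) (x b)) * v j b)"
    unfolding y_def cinner_sum_left
    using T
    by (intro sum.cong refl)
      (simp add: cinner_sum_right blinfun.sum_right blinfun_apply_bounded_ops
        cinner_scaleC_left cinner_scaleC_right sum_distrib_left mult_ac)
  finally show "0 \<le> (\<Sum>i<p. \<Sum>j<p. \<Sum>a<n. \<Sum>b<n. cnj (v i a) *
      (case (T i j, a, b) of (T, a, b) \<Rightarrow>
        if a < n \<and> b < n then cinner (x a) (blinfun_apply T (x b)) else 0) * v j b)"
    by simp
qed (auto simp: blinfun.add_left cinner_add_right cinner_scaleC_right)

text \<open>Separation controls only the real part of a functional. Averaging \<open>h\<close> with
  its conjugate transpose produces coefficients whose value on Hermitian data is that real part, and
  the threshold \<beta> is absorbed into the coefficient of the unit.\<close>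

lemma hermitian_symmetrization:
  fixes F h :: "'k::finite option \<Rightarrow> nat \<Rightarrow> nat \<Rightarrow> complex" and \<beta> :: real
  assumes F: "\<And>k a b. a < n \<Longrightarrow> b < n \<Longrightarrow> F k b a = cnj (F k a b)"
  defines "c \<equiv> \<lambda>k a b. (h k a b + cnj (h k b a)) / 2 - (if k = None \<and> a = b then of_real \<beta> else 0)"
  shows "(\<Sum>a<n. \<Sum>b<n. \<Sum>k\<in>UNIV. c k a b * F k a b)
    = of_real (Re (\<Sum>a<n. \<Sum>b<n. \<Sum>k\<in>UNIV. h k a b * F k a b)) - of_real \<beta> * (\<Sum>a<n. F None a a)"
proof -
  define W where "W = (\<Sum>a<n. \<Sum>b<n. \<Sum>k\<in>UNIV. h k a b * F k a b)"
  have "(\<Sum>a<n. \<Sum>b<n. \<Sum>k\<in>UNIV. cnj (h k b a) * F k a b)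
      = (\<Sum>a<n. \<Sum>b<n. \<Sum>k\<in>UNIV. cnj (h k b a * F k b a))"
    by (intro sum.cong refl) (simp only: complex_cnj_mult F[symmetric] lessThan_iff)
  also have "\<dots> = (\<Sum>b<n. \<Sum>a<n. \<Sum>k\<in>UNIV. cnj (h k b a * F k b a))" by (rule sum.swap)
  also have "\<dots> = cnj W" by (simp add: W_def)
  finally have conj: "(\<Sum>a<n. \<Sum>b<n. \<Sum>k\<in>UNIV. cnj (h k b a) * F k a b) = cnj W" .
  have diag: "(\<Sum>b<n. \<Sum>k\<in>UNIV. (if k = None \<and> a = b then of_real \<beta> else 0) * F k a b)
      = of_real \<beta> * F None a a" if "a < n" for a
  proof -
    have "(\<Sum>k\<in>UNIV. (if k = None \<and> a = b then of_real \<beta> else 0) * F k a b)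
        = (if a = b then of_real \<beta> * F None a a else 0)" for b
      by (simp add: sum_option)
    then show ?thesis using that by simp
  qed
  have "(\<Sum>a<n. \<Sum>b<n. \<Sum>k\<in>UNIV. c k a b * F k a b)
      = (\<Sum>a<n. \<Sum>b<n. \<Sum>k\<in>UNIV. (h k a b * F k a b) / 2 + (cnj (h k b a) * F k a b) / 2
          - (if k = None \<and> a = b then of_real \<beta> else 0) * F k a b)"
    by (intro sum.cong refl) (simp add: c_def field_simps)
  also have "\<dots> = W / 2 + cnj W / 2
      - (\<Sum>a<n. \<Sum>b<n. \<Sum>k\<in>UNIV. (if k = None \<and> a = b then of_real \<beta> else 0) * F k a b)"
    by (simp add: sum.distrib sum_subtractf conj W_def flip: sum_divide_distrib)
  also have "W / 2 + cnj W / 2 = of_real (Re W)"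
    by (simp add: complex_eq_iff)
  also have "(\<Sum>a<n. \<Sum>b<n. \<Sum>k\<in>UNIV. (if k = None \<and> a = b then of_real \<beta> else 0) * F k a b)
      = of_real \<beta> * (\<Sum>a<n. F None a a)"
    by (simp add: diag sum_distrib_left)
  finally show ?thesis by (simp add: W_def)
qed

section \<open>The matrix range by separation\<close>

lemma op_form_hermitian:
  assumes "\<And>i. A i \<in> selfadjoint_ops"
  shows "op_form A k y x = cnj (op_form A k x y)"
proof (cases k)
  case None
  then show ?thesis using cinner_commute[of y x] by (simp add: op_form_def)
next
  case (Some i)
  have "cinner (blinfun_apply (A i) y) x = cinner y (blinfun_apply (A i) x)"
    using assms[of i] by (auto simp: selfadjoint_ops_def is_adjoint_def)
  then show ?thesis using Some cinner_commute by (metis op_form_def aug_simps(2))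
qed

lemma mat_form_basis:
  assumes "i < n" "j < n"
  shows "mat_form n X k (\<lambda>a. if a = i then 1 else 0) (\<lambda>a. if a = j then 1 else 0) = ent X k i j"
  unfolding mat_form_def by (rule quadratic_basis[OF assms])

lemma ent_hermitian:
  assumes X: "\<And>i. X i \<in> selfadjoint_mats n" and ab: "a < n" "b < n"
  shows "ent X k b a = cnj (ent X k a b)"
proof (cases k)
  case (Some i)
  have "X i $$ (b, a) = cnj (X i $$ (a, b))"
    using X[of i] ab unfolding selfadjoint_mats_iff by blast
  then show ?thesis using Some by simp
qed auto

text \<open>The separated point is \<open>X\<close> divided by \<open>n\<close>. After
  multiplication by \<open>n\<close> the unit contributes its trace \<open>n\<close>, so the
  symmetrized functional takes the value \<open>- n * \<delta>\<close> at \<open>X\<close>.\<close>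

lemma symmetrization_strict_neg:
  fixes h :: "'d::finite option \<Rightarrow> nat \<Rightarrow> nat \<Rightarrow> complex"
  assumes n: "n > 0" and \<delta>: "\<delta> > 0" and X: "\<And>i. X i \<in> selfadjoint_mats n"
    and \<beta>: "\<beta> = Re (\<Sum>a<n. \<Sum>b<n. \<Sum>k\<in>UNIV. h k a b * (ent X k a b / of_nat n)) + \<delta>"
  defines "c \<equiv> \<lambda>k a b. (h k a b + cnj (h k b a)) / 2 - (if k = None \<and> a = b then of_real \<beta> else 0)"
  shows "\<not> 0 \<le> (\<Sum>a<n. \<Sum>b<n. \<Sum>k\<in>UNIV. c k a b * ent X k a b)"
proof
  assume "0 \<le> (\<Sum>a<n. \<Sum>b<n. \<Sum>k\<in>UNIV. c k a b * ent X k a b)"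
  also have "\<dots> = of_real (Re (\<Sum>a<n. \<Sum>b<n. \<Sum>k\<in>UNIV. h k a b * ent X k a b))
      - of_real \<beta> * (\<Sum>a<n. ent X None a a)"
    unfolding c_def by (rule hermitian_symmetrization) (rule ent_hermitian[OF X])
  also have "(\<Sum>a<n. \<Sum>b<n. \<Sum>k\<in>UNIV. h k a b * ent X k a b)
      = of_nat n * (\<Sum>a<n. \<Sum>b<n. \<Sum>k\<in>UNIV. h k a b * (ent X k a b / of_nat n))"
    using n by (simp add: sum_distrib_left)
  also have "\<dots> = complex_of_real (real n) * (\<Sum>a<n. \<Sum>b<n. \<Sum>k\<in>UNIV. h k a b * (ent X k a b / of_nat n))"
    by simp
  finally have "0 \<le> complex_of_real (real n * (\<beta> - \<delta>) - \<beta> * real n)"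
    by (simp add: \<beta>)
  then have "0 \<le> real n * (\<beta> - \<delta>) - \<beta> * real n"
    by (simp only: less_eq_complex_def Re_complex_of_real zero_complex.sel)
  then have "0 \<le> - real n * \<delta>" by (simp add: algebra_simps)
  moreover have "0 < real n * \<delta>" using n \<delta> by simp
  ultimately show False by simp
qed

lemma sum_index_triples:
  "(\<Sum>x\<in>(UNIV :: 'k::finite set) \<times> {..<n} \<times> {..<n::nat}. g x) = (\<Sum>a<n. \<Sum>b<n. \<Sum>k\<in>UNIV. g (k, a, b))"
proof -
  have "(\<Sum>x\<in>(UNIV :: 'k set) \<times> {..<n} \<times> {..<n}. g x) = (\<Sum>k\<in>UNIV. \<Sum>a<n. \<Sum>b<n. g (k, a, b))"
    by (simp only: sum.cartesian_product')
  also have "\<dots> = (\<Sum>a<n. \<Sum>b<n. \<Sum>k\<in>UNIV. g (k, a, b))"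
    by (rule sum_rotate3[symmetric])
  finally show ?thesis .
qed

text \<open>If no functional restricts to \<open>X / n\<close>, the separating coefficients,
  symmetrized to an \<open>n\<close> by \<open>n\<close> coefficient matrix \<open>c\<close>, are
  positive on \<open>A\<close> because of compressions and negative on \<open>X\<close>. A
  functional that does restrict to \<open>X / n\<close> lives on all operators, so no extension step
  is needed.\<close>

lemma matrix_range_eq_cpset:
  fixes A :: "'d::finite \<Rightarrow> 'h::complex_hilbert \<Rightarrow>\<^sub>L 'h"
  assumes A: "\<And>i. A i \<in> selfadjoint_ops" and n: "n > 0"
  shows "matrix_range A n = cpset A n"
proof
  show "matrix_range A n \<subseteq> cpset A n" by (rule matrix_range_subset_cpset)
  show "cpset A n \<subseteq> matrix_range A n"
  proof
    fix X assume X: "X \<in> cpset A n"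
    then have carr: "\<And>i. X i \<in> carrier_mat n n" and cp: "cp_rel (op_form A) (mat_form n X)"
      by (auto simp: cpset_def)
    define I where "I = (UNIV :: 'd option set) \<times> {..<n} \<times> {..<n}"
    have I: "finite I" by (simp add: I_def)
    have sumI: "(\<Sum>x\<in>I. g x) = (\<Sum>a<n. \<Sum>b<n. \<Sum>k\<in>UNIV. g (k, a, b))" for g :: "_ \<Rightarrow> complex"
    unfolding I_def by (rule sum_index_triples)
    define ev :: "(('h \<Rightarrow>\<^sub>L 'h) \<times> nat \<times> nat \<Rightarrow> complex) \<Rightarrow> 'd option \<times> nat \<times> nat \<Rightarrow> complex"
      where "ev f = (\<lambda>(k, a, b). f (aug A k, a, b))" for f
    define z where "z = (\<lambda>(k, a, b). ent X k a b / of_nat n)"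
    have "\<exists>f\<in>cp_functionals n. \<forall>x\<in>I. ev f x = z x"
    proof (rule ccontr)
      assume neg: "\<not> ?thesis"
      have "\<exists>h. \<exists>\<delta>>0. \<forall>f\<in>ev ` cp_functionals n.
          Re (\<Sum>i\<in>I. h i * z i) + \<delta> \<le> Re (\<Sum>i\<in>I. h i * f i)"
      proof (rule separation_fun[OF I])
        have "continuous_on (cp_functionals n) ev"
          unfolding ev_def case_prod_beta
          by (intro continuous_on_coordinatewise_then_product
              continuous_on_subset[OF continuous_on_product_coordinates]) simp
        then show "compact (ev ` cp_functionals n)"
          by (intro compact_continuous_image compact_cp_functionals)
        show "ev ` cp_functionals n \<noteq> {}"
        proof -
          \<comment> \<open>On the zero space every form vanishes, so -1 would count as positive on
            \<open>A\<close>, yet it is not positive on the unit of a matrix algebra with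
            \<open>n > 0\<close>.\<close>
          have "id_blinfun \<noteq> (0 :: 'h \<Rightarrow>\<^sub>L 'h)"
          proof
            assume id0: "id_blinfun = (0 :: 'h \<Rightarrow>\<^sub>L 'h)"
            have z0: "x = 0" for x :: 'h
              by (metis id0 blinfun.zero_left id_blinfun.rep_eq id_apply)
            have op0: "op_form A k x y = 0" for k x y
              by (simp add: op_form_def z0[of x])
            have "form_pos (op_form A) 1 (\<lambda>k _ _. if k = None then -1 else 0)"
              by (simp add: form_pos_def op0)
            then have "form_pos (mat_form n X) 1 (\<lambda>k _ _. if k = None then -1 else 0)"
              using cp by (simp add: cp_rel_def)
            then have "0 \<le> (\<Sum>k\<in>UNIV. (if k = None then -1 else 0) *
                mat_form n X k (\<lambda>a. if a = 0 then 1 else 0) (\<lambda>a. if a = 0 then 1 else 0))"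
              unfolding form_pos_def by (drule_tac x="\<lambda>_ a. if a = 0 then 1 else 0" in spec) simp
            then show False
              using n by (simp add: mat_form_basis sum_option less_eq_complex_def)
          qed
          then obtain y :: 'h where "y \<noteq> 0" by (metis blinfun_eqI blinfun.zero_left id_blinfun.rep_eq id_apply)
          define x where "x a = (if a = (0::nat) then (1 / norm y) *\<^sub>R y else 0)" for a
          have "(\<Sum>a<n. (norm (x a))\<^sup>2) = (\<Sum>a<n. if a = 0 then 1 else 0)"
            using \<open>y \<noteq> 0\<close> by (intro sum.cong) (auto simp: x_def)
          also have "\<dots> = 1" using n by simp
          finally show ?thesis using compression_in_cp_functionals[of x n] by blast
        qed
        show "\<exists>e\<in>ev ` cp_functionals n. \<forall>i\<in>I. e i = of_real (1 - t) * f i + of_real t * g i"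
          if mem: "f \<in> ev ` cp_functionals n" "g \<in> ev ` cp_functionals n" and t: "0 \<le> t" "t \<le> 1"
          for f g t
        proof -
          obtain f' g' where fg: "f' \<in> cp_functionals n" "g' \<in> cp_functionals n" "f = ev f'" "g = ev g'"
            using mem by blast
          show ?thesis
            by (rule bexI[OF _ imageI[OF cp_functionals_convex[OF fg(1,2) t]]])
              (auto simp: ev_def fg(3,4))
        qed
        show "\<exists>i\<in>I. f i \<noteq> z i" if "f \<in> ev ` cp_functionals n" for f
          using neg that by blast
      qed
      then obtain h \<delta> where \<delta>: "\<delta> > 0" and
        h: "\<And>f. f \<in> cp_functionals n \<Longrightarrow> Re (\<Sum>i\<in>I. h i * z i) + \<delta> \<le> Re (\<Sum>i\<in>I. h i * ev f i)"
        by blast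
      define \<beta> where "\<beta> = Re (\<Sum>i\<in>I. h i * z i) + \<delta>"
      define c where "c = (\<lambda>k a b. (h (k, a, b) + cnj (h (k, b, a))) / 2
        - (if k = None \<and> a = b then complex_of_real \<beta> else 0))"
      \<comment> \<open>The separation inequality holds for families of vectors with total squared
        norm one; scaling by \<open>r\<close> extends it to all families.\<close>
      have hom: "\<beta> * (\<Sum>a<n. (norm (x a))\<^sup>2)
          \<le> Re (\<Sum>a<n. \<Sum>b<n. \<Sum>k\<in>UNIV. h (k, a, b) * op_form A k (x a) (x b))" for x
      proof (cases "(\<Sum>a<n. (norm (x a))\<^sup>2) = 0")
        case True
        then have "x a = 0" if "a < n" for a
          using that by (subst (asm) sum_nonneg_eq_0_iff) auto
        then show ?thesis using True by (simp add: op_form_def)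
      next
        case False
        define s where "s = (\<Sum>a<n. (norm (x a))\<^sup>2)"
        have "s > 0" using False unfolding s_def by (simp add: order_less_le sum_nonneg)
        define r where "r = 1 / sqrt s"
        have r: "r * r = 1 / s" using \<open>s > 0\<close> by (simp add: r_def)
        have "(\<Sum>a<n. (norm (r *\<^sub>R x a))\<^sup>2) = r * r * s"
          by (simp only: s_def norm_scaleR power_mult_distrib power2_abs sum_distrib_left power2_eq_square[of r])
        also have "\<dots> = 1" using r \<open>s > 0\<close> by simp
        finally have "\<beta> \<le> Re (\<Sum>i\<in>I. h i * ev (\<lambda>(T, a, b). if a < n \<and> b < n
            then cinner (r *\<^sub>R x a) (blinfun_apply T (r *\<^sub>R x b)) else 0) i)"
          unfolding \<beta>_def by (intro h compression_in_cp_functionals)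
        also have "\<dots> = Re (\<Sum>a<n. \<Sum>b<n. \<Sum>k\<in>UNIV. of_real (r * r) *
            (h (k, a, b) * op_form A k (x a) (x b)))"
          unfolding sumI
          by (intro arg_cong[where f = Re] sum.cong refl)
            (simp add: ev_def op_form_scaleR flip: op_form_def)
        also have "\<dots> = r * r * Re (\<Sum>a<n. \<Sum>b<n. \<Sum>k\<in>UNIV. h (k, a, b) * op_form A k (x a) (x b))"
          by (simp add: algebra_simps flip: sum_distrib_left)
        finally show ?thesis using r \<open>s > 0\<close> by (simp add: s_def[symmetric] field_simps)
      qed
      have "form_pos (op_form A) n c"
        unfolding form_pos_def
      proof
        fix x :: "nat \<Rightarrow> 'h"
        have "(\<Sum>a<n. \<Sum>b<n. \<Sum>k\<in>UNIV. c k a b * op_form A k (x a) (x b))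
          = of_real (Re (\<Sum>a<n. \<Sum>b<n. \<Sum>k\<in>UNIV. h (k, a, b) * op_form A k (x a) (x b)))
            - of_real \<beta> * (\<Sum>a<n. op_form A None (x a) (x a))"
          unfolding c_def
          by (rule hermitian_symmetrization[where h = "\<lambda>k a b. h (k, a, b)"])
            (rule op_form_hermitian[OF A])
        also have "\<dots> = of_real (Re (\<Sum>a<n. \<Sum>b<n. \<Sum>k\<in>UNIV. h (k, a, b) * op_form A k (x a) (x b))
            - \<beta> * (\<Sum>a<n. (norm (x a))\<^sup>2))"
          by (simp add: op_form_None)
        also have "0 \<le> \<dots>" using hom[of x] by (simp add: less_eq_complex_def)
        finally show "0 \<le> (\<Sum>a<n. \<Sum>b<n. \<Sum>k\<in>UNIV. c k a b * op_form A k (x a) (x b))" .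
      qed
      \<comment> \<open>Complete positivity enters at size \<open>n\<close>: the standard basis
        vectors turn the form back into the value of \<open>c\<close> at the entries of
        \<open>X\<close>.\<close>
      then have "form_pos (mat_form n X) n c" using cp by (simp add: cp_rel_def)
      then have "0 \<le> (\<Sum>i<n. \<Sum>j<n. \<Sum>k\<in>UNIV. c k i j *
          mat_form n X k (\<lambda>a. if a = i then 1 else 0) (\<lambda>a. if a = j then 1 else 0))"
        unfolding form_pos_def by (rule spec)
      also have "\<dots> = (\<Sum>i<n. \<Sum>j<n. \<Sum>k\<in>UNIV. c k i j * ent X k i j)"
        by (intro sum.cong refl) (simp add: mat_form_basis)
      finally show False
        using symmetrization_strict_neg[of n \<delta> X \<beta> "\<lambda>k a b. h (k, a, b)", OF n \<delta> cpset_selfadjoint[OF A X]]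
        by (simp add: c_def \<beta>_def sumI z_def)
    qed
    then obtain f where f: "f \<in> cp_functionals n" and fz: "\<And>x. x \<in> I \<Longrightarrow> ev f x = z x" by blast
    have fX: "of_nat n * f (aug A k, a, b) = ent X k a b" if "a < n" "b < n" for k a b
      using fz[of "(k, a, b)"] that n by (simp add: I_def ev_def z_def)
    \<comment> \<open>The factor \<open>n\<close> undoes the trace normalisation and makes the map
      unital.\<close>
    define \<phi> where "\<phi> T = Matrix.mat n n (\<lambda>(a, b). of_nat n * f (T, a, b))" for T
    have "ucp_to_mat (cstar A) n \<phi>"
      unfolding ucp_to_mat_def
    proof (intro conjI)
      show "\<phi> ` cstar A \<subseteq> carrier_mat n n" by (auto simp: \<phi>_def)
      show "linear_map_on scaleC smult_mat (cstar A) \<phi>"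
        unfolding linear_map_on_def
        using f by (auto simp: \<phi>_def cp_functionals_def algebra_simps intro!: eq_matI)
      show "\<phi> id_blinfun = 1\<^sub>m n"
        by (rule eq_matI) (use fX[of _ _ None] in \<open>auto simp: \<phi>_def\<close>)
      show "cp_on pos_op_matrix (pos_mat_matrix n) (cstar A) \<phi>"
        unfolding cp_on_def
      proof (intro allI impI)
        fix p T assume T: "(\<forall>i<p. \<forall>j<p. T i j \<in> cstar A) \<and> pos_op_matrix p T"
        have "\<And>i. A i \<in> bounded_ops" using A by (simp add: selfadjoint_ops_def)
        then have "(\<forall>i<p. \<forall>j<p. T i j \<in> bounded_ops) \<and> pos_op_matrix p T"
          using T cstar_subset_bounded_ops[of A] by blast
        then have "0 \<le> (\<Sum>i<p. \<Sum>j<p. \<Sum>a<n. \<Sum>b<n. cnj (x i a) * f (T i j, a, b) * x j b)" for x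
          by (rule cp_functionals_pos[OF f])
        then have "0 \<le> of_nat n *
            (\<Sum>i<p. \<Sum>j<p. \<Sum>a<n. \<Sum>b<n. cnj (x i a) * f (T i j, a, b) * x j b)" for x
          by (intro mult_nonneg_nonneg) (auto simp: less_eq_complex_def)
        then show "pos_mat_matrix n p (\<lambda>i j. \<phi> (T i j))"
          by (subst pos_mat_matrix_iff) (auto simp: \<phi>_def sum_distrib_left mult_ac)
      qed
    qed
    moreover have "X = (\<lambda>i. \<phi> (A i))"
    proof
      fix i
      show "X i = \<phi> (A i)"
        by (rule eq_matI) (use fX[of _ _ "Some i"] carr[of i] in \<open>auto simp: \<phi>_def\<close>)
    qed
    ultimately show "X \<in> matrix_range A n" by (auto simp: matrix_range_def)
  qed
qed

section \<open>Positive semidefinite matrices and states\<close>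

definition psd :: "nat \<Rightarrow> (nat \<Rightarrow> nat \<Rightarrow> complex) \<Rightarrow> bool" where
  "psd n P \<longleftrightarrow> (\<forall>v. 0 \<le> (\<Sum>i<n. \<Sum>j<n. cnj (v i) * P i j * v j))"

lemma psd_hermitian: "psd n P \<Longrightarrow> a < n \<Longrightarrow> b < n \<Longrightarrow> P a b = cnj (P b a)"
  by (rule hermitian_if_quadratic_real[where n = n]) (auto simp: psd_def less_eq_complex_def)

text \<open>Both \<open>Z\<close> and its multiple by \<open>\<i>\<close> have real quadratic form,
  so both are Hermitian, which forces \<open>Z\<close> to vanish.\<close>

lemma zero_if_quadratic_zero:
  fixes Z :: "nat \<Rightarrow> nat \<Rightarrow> complex"
  assumes q: "\<And>v. (\<Sum>a<n. \<Sum>b<n. cnj (v a) * Z a b * v b) = 0" and ab: "a < n" "b < n"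
  shows "Z a b = 0"
proof -
  have 1: "Z a b = cnj (Z b a)"
    by (rule hermitian_if_quadratic_real[where n = n]) (simp_all add: q ab)
  have "(\<Sum>a<n. \<Sum>b<n. cnj (v a) * (\<i> * Z a b) * v b) = \<i> * (\<Sum>a<n. \<Sum>b<n. cnj (v a) * Z a b * v b)"
    for v by (simp add: sum_distrib_left mult_ac)
  then have "\<i> * Z a b = cnj (\<i> * Z b a)"
    by (intro hermitian_if_quadratic_real[where n = n and Y = "\<lambda>a b. \<i> * Z a b"])
      (simp_all add: q ab)
  then show ?thesis using 1 by (simp add: complex_eq_iff)
qed

lemma sum_lessThan_Suc_Suc:
  fixes f :: "nat \<Rightarrow> nat \<Rightarrow> complex"
  shows "(\<Sum>i<Suc n. \<Sum>j<Suc n. f i j)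
    = (\<Sum>i<n. \<Sum>j<n. f i j) + (\<Sum>i<n. f i n) + (\<Sum>j<n. f n j) + f n n"
  by (simp add: sum.distrib)

lemma psd_restrict:
  assumes "psd (Suc n) D"
  shows "psd n D"
  unfolding psd_def
proof
  fix v :: "nat \<Rightarrow> complex"
  have "0 \<le> (\<Sum>i<Suc n. \<Sum>j<Suc n. cnj ((v(n := 0)) i) * D i j * (v(n := 0)) j)"
    using assms by (simp only: psd_def)
  then show "0 \<le> (\<Sum>i<n. \<Sum>j<n. cnj (v i) * D i j * v j)"
    unfolding sum_lessThan_Suc_Suc by simp
qed

lemma psd_diag:
  assumes "psd n P" "a < n"
  shows "0 \<le> P a a"
  using assms(1)[unfolded psd_def, rule_format, of "\<lambda>c. if c = a then 1 else 0"]
  unfolding quadratic_basis[OF assms(2,2)] .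

text \<open>With \<open>P b b = 0\<close> the form at the vector with entries 1 at \<open>a\<close>
  and \<open>z\<close> at \<open>b\<close> has no quadratic term in \<open>z\<close>, so it is
  unbounded below unless \<open>P a b\<close> vanishes; \<open>s\<close> is chosen to give the value
  -1.\<close>

lemma psd_zero_diag:
  assumes P: "psd n P" and ab: "a < n" "b < n" "a \<noteq> b" and 0: "P b b = 0"
  shows "P a b = 0"
proof (rule ccontr)
  assume nz: "P a b \<noteq> 0"
  define w where "w = (cmod (P a b))\<^sup>2"
  have w: "w > 0" using nz by (simp add: w_def)
  define s where "s = (Re (P a a) + 1) / (2 * w)"
  define z where "z = - of_real s * cnj (P a b)"
  have "0 \<le> P a a + cnj z * P b a + z * P a b + cnj z * z * P b b"
    using P[unfolded psd_def, rule_format, of "\<lambda>c. if c = a then 1 else if c = b then z else 0"]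
    unfolding quadratic_two_points[OF ab] .
  also have "P b a = cnj (P a b)" by (rule psd_hermitian[OF P ab(2,1)])
  finally have "0 \<le> Re (P a a) + Re (cnj z * cnj (P a b)) + Re (z * P a b)"
    by (simp add: 0 less_eq_complex_def)
  also have "Re (cnj z * cnj (P a b)) = - s * w"
    unfolding w_def cmod_power2 z_def by (simp add: power2_eq_square algebra_simps)
  also have "Re (z * P a b) = - s * w"
    unfolding w_def cmod_power2 z_def by (simp add: power2_eq_square algebra_simps)
  finally have "2 * (s * w) \<le> Re (P a a)" by simp
  moreover have "2 * (s * w) = Re (P a a) + 1" using w by (simp add: s_def field_simps)
  ultimately show False by simp
qed

text \<open>Each induction step splits off one rank one summand of \<open>P\<close>, as in the Cholesky decomposition.\<close>

lemma psd_pairing: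
  assumes "psd n P" "psd n D"
  shows "0 \<le> (\<Sum>i<n. \<Sum>j<n. D i j * P i j)"
  using assms
proof (induction n arbitrary: P)
  case 0
  then show ?case by simp
next
  case (Suc n)
  show ?case
  proof (cases "P n n = 0")
    case True
    have "P i n = 0" "P n i = 0" if "i < n" for i
      using psd_zero_diag[OF Suc.prems(1), of i n] psd_hermitian[OF Suc.prems(1), of n i] that True
      by auto
    then show ?thesis
      unfolding sum_lessThan_Suc_Suc
      using Suc.IH[OF psd_restrict[OF Suc.prems(1)] psd_restrict[OF Suc.prems(2)]] True by simp
  next
    case False
    define q where "q = Re (P n n)"
    have "0 \<le> P n n" by (rule psd_diag[OF Suc.prems(1)]) simp
    then have Pn: "P n n = of_real q" and q: "q > 0"
      using False by (auto simp: q_def less_eq_complex_def complex_eq_iff)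
    have herm: "P i n = cnj (P n i)" if "i \<le> n" for i
      using psd_hermitian[OF Suc.prems(1), of i n] that by simp
    \<comment> \<open>The Schur complement of the last diagonal entry. Below, the last coordinate of
      \<open>w\<close> completes the square, so that the form of \<open>P\<close> at
      \<open>w\<close> is the form of \<open>P'\<close> at \<open>v\<close>.\<close>
    define P' where "P' i j = P i j - P i n * P n j / of_real q" for i j
    have "psd n P'"
      unfolding psd_def
    proof
      fix v :: "nat \<Rightarrow> complex"
      define R where "R = (\<Sum>j<n. P n j * v j)"
      define w where "w = v(n := - R / of_real q)"
      have wn: "w n = - R / of_real q" and wj: "\<And>j. j < n \<Longrightarrow> w j = v j" by (auto simp: w_def)
      have R': "(\<Sum>i<n. cnj (v i) * P i n) = cnj R"
        by (simp add: R_def herm mult.commute)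
      have "0 \<le> (\<Sum>i<Suc n. \<Sum>j<Suc n. cnj (w i) * P i j * w j)"
        using Suc.prems(1) by (simp only: psd_def)
      also have "\<dots> = (\<Sum>i<n. \<Sum>j<n. cnj (v i) * P i j * v j) + (\<Sum>i<n. cnj (v i) * P i n) * w n
          + cnj (w n) * R + cnj (w n) * P n n * w n"
        unfolding sum_lessThan_Suc_Suc
        by (simp add: wj R_def sum_distrib_left sum_distrib_right mult.assoc)
      also have "\<dots> = (\<Sum>i<n. \<Sum>j<n. cnj (v i) * P i j * v j) - cnj R * R / of_real q"
        unfolding R' wn Pn using q by (simp add: field_simps)
      also have "cnj R * R / of_real q = (\<Sum>i<n. \<Sum>j<n. cnj (v i) * (P i n * P n j / of_real q) * v j)"
        unfolding R'[symmetric] unfolding R_def sum_product sum_divide_distrib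
        by (intro sum.cong refl) simp
      finally show "0 \<le> (\<Sum>i<n. \<Sum>j<n. cnj (v i) * P' i j * v j)"
        by (simp add: P'_def algebra_simps sum_subtractf)
    qed
    \<comment> \<open>Up to the factor \<open>1 / q\<close>, the pairing of \<open>D\<close> with
      the split-off rank one summand is the form of \<open>D\<close> at the last row of
      \<open>P\<close>.\<close>
    have "0 \<le> (\<Sum>i<Suc n. \<Sum>j<Suc n. cnj (P n i) * D i j * P n j)"
      using Suc.prems(2) by (simp only: psd_def)
    also have "\<dots> = (\<Sum>i<Suc n. \<Sum>j<Suc n. D i j * (P i n * P n j))"
      by (intro sum.cong refl) (use herm in \<open>simp add: mult_ac\<close>)
    finally have "0 \<le> of_real (1 / q) * (\<Sum>i<Suc n. \<Sum>j<Suc n. D i j * (P i n * P n j))"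
      using q by (intro mult_nonneg_nonneg) (auto simp: less_eq_complex_def)
    moreover have "0 \<le> (\<Sum>i<n. \<Sum>j<n. D i j * P' i j)"
      by (rule Suc.IH[OF \<open>psd n P'\<close> psd_restrict[OF Suc.prems(2)]])
    ultimately have "0 \<le> of_real (1 / q) * (\<Sum>i<Suc n. \<Sum>j<Suc n. D i j * (P i n * P n j))
        + (\<Sum>i<n. \<Sum>j<n. D i j * P' i j)" by (rule add_nonneg_nonneg)
    also have "\<dots> = (\<Sum>i<Suc n. \<Sum>j<Suc n. D i j * P i j)"
      unfolding sum_lessThan_Suc_Suc P'_def Pn using q
      by (simp add: sum.distrib sum_subtractf sum_distrib_left algebra_simps)
    finally show ?thesis .
  qed
qed

section \<open>States and the first level of the matrix range\<close>

definition pt :: "real ^ 'd \<Rightarrow> 'd option \<Rightarrow> complex" where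
  "pt x k = (case k of None \<Rightarrow> 1 | Some i \<Rightarrow> of_real (vec_nth x i))"

definition pt_mat :: "real ^ 'd \<Rightarrow> 'd \<Rightarrow> complex mat" where
  "pt_mat x = (\<lambda>i. Matrix.mat 1 1 (\<lambda>_. complex_of_real (vec_nth x i)))"

text \<open>The joint values of states at the generators, given by the inequalities they satisfy.
  For a tuple in \<open>bounded_ops\<close> this is the first level of \<open>cpset\<close>, by
  \<open>level1_real_cpset\<close>.\<close>

definition state_set :: "('d option \<Rightarrow> 'v \<Rightarrow> 'v \<Rightarrow> complex) \<Rightarrow> (real ^ 'd::finite) set" where
  "state_set F = {x. \<forall>c. (\<forall>v. 0 \<le> (\<Sum>k\<in>UNIV. c k * F k v v)) \<longrightarrow> 0 \<le> (\<Sum>k\<in>UNIV. c k * pt x k)}"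

lemma pt_simps [simp]: "pt x None = 1" "pt x (Some i) = of_real (vec_nth x i)"
  by (simp_all add: pt_def)

lemma state_setD:
  "x \<in> state_set F \<Longrightarrow> (\<And>v. 0 \<le> (\<Sum>k\<in>UNIV. c k * F k v v)) \<Longrightarrow> 0 \<le> (\<Sum>k\<in>UNIV. c k * pt x k)"
  by (simp add: state_set_def)

lemma level1_real_iff: "x \<in> level1_real S \<longleftrightarrow> pt_mat x \<in> S 1"
  by (simp add: level1_real_def pt_mat_def)

lemma mat_form_pt_mat: "mat_form 1 (pt_mat x) k v w = cnj (v 0) * pt x k * w 0"
  by (cases k) (simp_all add: mat_form_def pt_mat_def)

text \<open>Positive functionals are completely positive: scalar test vectors contract the
  coefficient matrix \<open>c\<close> to one coefficient vector \<open>d\<close>, and the form of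
  \<open>d\<close> at \<open>v\<close> is the form of \<open>c\<close> at the multiples of
  \<open>v\<close> by the scalars \<open>y i 0\<close>.\<close>

lemma cp_rel_pt_mat:
  assumes A: "\<And>i. A i \<in> bounded_ops" and x: "x \<in> state_set (op_form A)"
  shows "cp_rel (op_form A) (mat_form 1 (pt_mat x))"
  unfolding cp_rel_def
proof (intro allI impI)
  fix p c assume pos: "form_pos (op_form A) p c"
  have hom: "op_form A k (a *\<^sub>C u) (b *\<^sub>C v) = cnj a * b * op_form A k u v" for k a b u v
    using A by (cases k) (auto simp: op_form_def blinfun_apply_bounded_ops cinner_scaleC_left
        cinner_scaleC_right)
  show "form_pos (mat_form 1 (pt_mat x)) p c"
    unfolding form_pos_def mat_form_pt_mat
  proof
    fix y :: "nat \<Rightarrow> nat \<Rightarrow> complex"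
    define d where "d k = (\<Sum>i<p. \<Sum>j<p. c k i j * (cnj (y i 0) * y j 0))" for k
    have swap: "(\<Sum>k\<in>UNIV. d k * G k)
        = (\<Sum>i<p. \<Sum>j<p. \<Sum>k\<in>UNIV. c k i j * (cnj (y i 0) * y j 0 * G k))" for G
    proof -
      have "(\<Sum>k\<in>UNIV. d k * G k) = (\<Sum>k\<in>UNIV. \<Sum>i<p. \<Sum>j<p. c k i j * (cnj (y i 0) * y j 0 * G k))"
        by (simp add: d_def sum_distrib_right mult.assoc)
      also have "\<dots> = (\<Sum>i<p. \<Sum>j<p. \<Sum>k\<in>UNIV. c k i j * (cnj (y i 0) * y j 0 * G k))"
        by (rule sum_rotate3[symmetric])
      finally show ?thesis .
    qed
    have "0 \<le> (\<Sum>k\<in>UNIV. d k * op_form A k v v)" for v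
    proof -
      have "0 \<le> (\<Sum>i<p. \<Sum>j<p. \<Sum>k\<in>UNIV. c k i j * op_form A k (y i 0 *\<^sub>C v) (y j 0 *\<^sub>C v))"
        using pos by (simp add: form_pos_def)
      then show ?thesis unfolding swap hom .
    qed
    then have "0 \<le> (\<Sum>k\<in>UNIV. d k * pt x k)" using x by (simp add: state_set_def)
    then show "0 \<le> (\<Sum>i<p. \<Sum>j<p. \<Sum>k\<in>UNIV. c k i j * (cnj (y i 0) * pt x k * y j 0))"
      unfolding swap by (simp add: mult_ac)
  qed
qed

lemma level1_real_cpset:
  assumes A: "\<And>i. A i \<in> bounded_ops"
  shows "level1_real (cpset A) = state_set (op_form A)"
proof (intro equalityI subsetI)
  fix x assume "x \<in> level1_real (cpset A)"
  then have "pos_rel (op_form A) (mat_form 1 (pt_mat x))"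
    by (simp add: level1_real_iff cpset_def cp_rel_imp_pos_rel)
  then have "0 \<le> (\<Sum>k\<in>UNIV. c k * mat_form 1 (pt_mat x) k (\<lambda>_. 1) (\<lambda>_. 1))"
    if "\<forall>v. 0 \<le> (\<Sum>k\<in>UNIV. c k * op_form A k v v)" for c
    using that by (simp add: pos_rel_def)
  then show "x \<in> state_set (op_form A)"
    unfolding mat_form_pt_mat state_set_def by simp
next
  fix x assume "x \<in> state_set (op_form A)"
  then show "x \<in> level1_real (cpset A)"
    using cp_rel_pt_mat[OF A] by (auto simp: level1_real_iff cpset_def pt_mat_def)
qed

lemma state_set_bound:
  assumes A: "\<And>i. A i \<in> selfadjoint_ops" and x: "x \<in> state_set (op_form A)"
  shows "\<bar>vec_nth x i\<bar> \<le> norm (A i)"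
proof -
  have "0 \<le> of_real (norm (A i)) * pt x None + s * pt x (Some i)" if "s = 1 \<or> s = -1" for s
  proof -
    have "0 \<le> (\<Sum>k\<in>UNIV. (if k = None then of_real (norm (A i)) else if k = Some i then s else 0) * pt x k)"
      by (rule state_setD[OF x]) (rule op_form_bound_pos[of A i s, OF A that])
    then show ?thesis by (subst (asm) sum_option_single)
  qed
  from this[of 1] this[of "-1"] show ?thesis
    by (auto simp: less_eq_complex_def)
qed

lemma compact_state_set:
  assumes A: "\<And>i. A i \<in> selfadjoint_ops"
  shows "compact (state_set (op_form A))"
proof -
  have "norm x \<le> (\<Sum>i\<in>UNIV. norm (A i))" if "x \<in> state_set (op_form A)" for x
    using norm_le_l1_cart[of x] state_set_bound[OF A that] by (meson order_trans sum_mono)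
  then have "bounded (state_set (op_form A))" by (auto simp: bounded_iff)
  moreover have "closed (state_set (op_form A))"
  proof -
    have cont: "continuous_on UNIV (\<lambda>x :: real ^ 'a. pt x k)" for k
      by (cases k) (auto intro!: continuous_intros)
    have "closed {x :: real ^ 'a. 0 \<le> (\<Sum>k\<in>UNIV. c k * pt x k)}" for c
      by (intro closed_Collect_nonneg_complex continuous_intros cont)
    moreover have "state_set (op_form A)
        = (\<Inter>c\<in>{c. \<forall>v. 0 \<le> (\<Sum>k\<in>UNIV. c k * op_form A k v v)}. {x. 0 \<le> (\<Sum>k\<in>UNIV. c k * pt x k)})"
      by (auto simp: state_set_def)
    ultimately show ?thesis by auto
  qed
  ultimately show ?thesis by (simp add: compact_eq_bounded_closed)
qed

lemma vector_state:
  assumes A: "\<And>i. A i \<in> selfadjoint_ops" and v: "norm v = 1"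
  shows "(\<chi> i. Re (op_form A (Some i) v v)) \<in> state_set (op_form A)"
proof -
  have "pt (\<chi> i. Re (op_form A (Some i) v v)) k = op_form A k v v" for k
    using op_form_Some_Im[of A _ v, OF A] v
    by (cases k) (auto simp: op_form_None complex_eq_iff)
  then show ?thesis by (simp add: state_set_def)
qed

text \<open>Vector states belong to the state set and already detect positivity in the operator
  system of \<open>A\<close>, each vector being a multiple of a unit vector. Together with
  \<open>state_set_mono\<close> this ties positivity to inclusion of first levels.\<close>

lemma pos_rel_op_form_if_states:
  assumes A: "\<And>i. A i \<in> selfadjoint_ops"
    and pos: "\<And>c x. (\<forall>v. 0 \<le> (\<Sum>k\<in>UNIV. c k * F k v v)) \<Longrightarrow> x \<in> state_set (op_form A) \<Longrightarrow>
      0 \<le> (\<Sum>k\<in>UNIV. c k * pt x k)"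
  shows "pos_rel F (op_form A)"
  unfolding pos_rel_def
proof (intro allI impI)
  fix c v assume c: "\<forall>v. 0 \<le> (\<Sum>k\<in>UNIV. c k * F k v v)"
  show "0 \<le> (\<Sum>k\<in>UNIV. c k * op_form A k v v)"
  proof (cases "v = 0")
    case True
    then show ?thesis by (simp add: op_form_def)
  next
    case False
    define u where "u = (1 / norm v) *\<^sub>R v"
    have u: "norm u = 1" using False by (simp add: u_def)
    have v: "v = norm v *\<^sub>R u" using False by (simp add: u_def)
    let ?x = "\<chi> i. Re (op_form A (Some i) u u)"
    have ptu: "pt ?x k = op_form A k u u" for k
      using op_form_Some_Im[of A _ u, OF A] u
      by (cases k) (auto simp: op_form_None complex_eq_iff)
    have "op_form A k v v = of_real ((norm v)\<^sup>2) * op_form A k u u" for k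
      by (subst (1 2) v) (simp only: op_form_scaleR power2_eq_square)
    then have "(\<Sum>k\<in>UNIV. c k * op_form A k v v) = of_real ((norm v)\<^sup>2) * (\<Sum>k\<in>UNIV. c k * pt ?x k)"
      by (simp add: ptu sum_distrib_left mult_ac)
    also have "0 \<le> \<dots>"
      using pos[OF c vector_state[OF A u]]
      by (intro mult_nonneg_nonneg) (auto simp: less_eq_complex_def)
    finally show ?thesis .
  qed
qed

section \<open>Dilations to diagonal tuples\<close>

lemma matrix_convex_selfadjoint:
  "matrix_convex T \<Longrightarrow> n > 0 \<Longrightarrow> X \<in> T n \<Longrightarrow> X i \<in> selfadjoint_mats n"
  by (simp add: matrix_convex_def)

lemma matrix_convex_direct_sum:
  "matrix_convex T \<Longrightarrow> n > 0 \<Longrightarrow> m > 0 \<Longrightarrow> X \<in> T n \<Longrightarrow> Y \<in> T m \<Longrightarrow>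
    (\<lambda>i. mat_direct_sum (X i) (Y i)) \<in> T (n + m)"
  by (simp add: matrix_convex_def)

lemma matrix_convex_ucp:
  "matrix_convex T \<Longrightarrow> n > 0 \<Longrightarrow> k > 0 \<Longrightarrow> ucp_mat_mat n k \<phi> \<Longrightarrow> X \<in> T n \<Longrightarrow>
    (\<lambda>i. \<phi> (X i)) \<in> T k"
  by (simp add: matrix_convex_def)

lemma diagonal_in_matrix_convex:
  fixes x :: "nat \<Rightarrow> real ^ 'd::finite"
  assumes T: "matrix_convex T" and "r > 0" "\<And>m. m < r \<Longrightarrow> pt_mat (x m) \<in> T 1"
  shows "(\<lambda>k. Matrix.mat r r (\<lambda>(i, j). if i = j then of_real (vec_nth (x i) k) else 0)) \<in> T r"
  using assms(2-)
proof (induction r)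
  case (Suc r)
  let ?D = "\<lambda>r k. Matrix.mat r r (\<lambda>(i, j). if i = j then complex_of_real (vec_nth (x i) k) else 0)"
  show ?case
  proof (cases "r = 0")
    \<comment> \<open>The induction effectively starts at size one, because
      \<open>matrix_convex\<close> says nothing about level zero.\<close>
    case True
    have "?D (Suc r) = pt_mat (x 0)"
      unfolding pt_mat_def using True by (intro ext eq_matI) auto
    then show ?thesis using Suc.prems(2)[of 0] True by simp
  next
    case False
    then have "(\<lambda>k. mat_direct_sum (?D r k) (pt_mat (x r) k)) \<in> T (r + 1)"
      using Suc.IH Suc.prems(2) by (intro matrix_convex_direct_sum[OF T]) auto
    also have "(\<lambda>k. mat_direct_sum (?D r k) (pt_mat (x r) k)) = ?D (Suc r)"
      unfolding mat_direct_sum_def pt_mat_def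
      by (intro ext eq_matI) (auto simp: less_Suc_eq)
    finally show ?thesis by simp
  qed
qed simp

text \<open>The tuple is the compression of the diagonal tuple with entries \<open>x m\<close> by
  the isometry whose entries are \<open>cnj (a m s)\<close>; the hypothesis on \<open>a\<close> says
  that it is an isometry.\<close>

lemma dilation_in_matrix_convex:
  fixes x :: "nat \<Rightarrow> real ^ 'd::finite"
  assumes T: "matrix_convex T" and n: "n > 0" and x: "\<And>m. m < r \<Longrightarrow> pt_mat (x m) \<in> T 1"
    and a: "\<And>i j. i < n \<Longrightarrow> j < n \<Longrightarrow> (\<Sum>m<r. a m i * cnj (a m j)) = (if i = j then 1 else 0)"
  shows "(\<lambda>k. Matrix.mat n n (\<lambda>(i, j). \<Sum>m<r. of_real (vec_nth (x m) k) * a m i * cnj (a m j))) \<in> T n"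
proof -
  have r: "r > 0" using a[OF n n] by (cases r) auto
  let ?D = "\<lambda>k. Matrix.mat r r (\<lambda>(i, j). if i = j then complex_of_real (vec_nth (x i) k) else 0)"
  have D: "?D \<in> T r" by (rule diagonal_in_matrix_convex[OF T r x])
  have "ucp_mat_mat r n (kraus 1 r n (\<lambda>_ m s. cnj (a m s)))"
    by (rule ucp_kraus) (simp add: a)
  then have "(\<lambda>k. kraus 1 r n (\<lambda>_ m s. cnj (a m s)) (?D k)) \<in> T n"
    by (rule matrix_convex_ucp[OF T r n _ D])
  also have "(\<lambda>k. kraus 1 r n (\<lambda>_ m s. cnj (a m s)) (?D k))
      = (\<lambda>k. Matrix.mat n n (\<lambda>(i, j). \<Sum>m<r. of_real (vec_nth (x m) k) * a m i * cnj (a m j)))"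
  proof (intro ext eq_matI)
    fix k i j
    assume "i < dim_row (Matrix.mat n n (\<lambda>(i, j). \<Sum>m<r. of_real (vec_nth (x m) k) * a m i * cnj (a m j)))"
      "j < dim_col (Matrix.mat n n (\<lambda>(i, j). \<Sum>m<r. of_real (vec_nth (x m) k) * a m i * cnj (a m j)))"
    then have ij: "i < n" "j < n" by auto
    have "(\<Sum>b<r. cnj (cnj (a m i)) * ?D k $$ (m, b) * cnj (a b j))
        = of_real (vec_nth (x m) k) * a m i * cnj (a m j)" if "m < r" for m
    proof -
      have "(\<Sum>b<r. cnj (cnj (a m i)) * ?D k $$ (m, b) * cnj (a b j))
          = (\<Sum>b<r. if b = m then of_real (vec_nth (x m) k) * a m i * cnj (a m j) else 0)"
        using that by (intro sum.cong refl) auto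
      then show ?thesis using that by simp
    qed
    then show "kraus 1 r n (\<lambda>_ m s. cnj (a m s)) (?D k) $$ (i, j)
      = Matrix.mat n n (\<lambda>(i, j). \<Sum>m<r. of_real (vec_nth (x m) k) * a m i * cnj (a m j)) $$ (i, j)"
      using ij by (simp add: kraus_def)
  qed (simp_all add: kraus_def)
  finally show ?thesis .
qed

section \<open>Finite dilations by separation\<close>

definition unit_vecs :: "nat \<Rightarrow> (nat \<Rightarrow> complex) set" where
  "unit_vecs n = {v. (\<forall>i. v i \<in> cball 0 1) \<and> (\<Sum>i<n. (cmod (v i))\<^sup>2) = 1}"

text \<open>Tychonoff needs every coordinate bounded, also those from \<open>n\<close> on, hence the
  disc condition in \<open>unit_vecs\<close> for all indices.\<close>

lemma compact_unit_vecs: "compact (unit_vecs n)"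
proof -
  have "closed {v :: nat \<Rightarrow> complex. (\<Sum>i<n. (cmod (v i))\<^sup>2) = 1}"
    by (intro closed_Collect_eq continuous_intros continuous_on_product_coordinates)
  then show ?thesis
    unfolding unit_vecs_def Collect_conj_eq
    by (intro compact_Int_closed compact_Pi_UNIV compact_cball)
qed

lemma unit_vecs_normalize:
  fixes v :: "nat \<Rightarrow> complex"
  assumes s: "s = (\<Sum>i<n. (cmod (v i))\<^sup>2)" "s \<noteq> 0"
  obtains w where "w \<in> unit_vecs n" "\<And>i. i < n \<Longrightarrow> v i = of_real (sqrt s) * w i"
proof -
  have "s > 0" using s by (simp add: order_less_le sum_nonneg)
  define w where "w i = (if i < n then v i / of_real (sqrt s) else 0)" for i
  have "cmod (w i) \<le> 1" for i
  proof (cases "i < n")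
    case True
    have "(cmod (v i))\<^sup>2 \<le> s"
      unfolding s(1) using True by (intro member_le_sum) auto
    then have "cmod (v i) \<le> sqrt s" by (rule real_le_rsqrt)
    then show ?thesis using True \<open>s > 0\<close> by (simp add: w_def norm_divide)
  qed (simp add: w_def)
  moreover have "(\<Sum>i<n. (cmod (w i))\<^sup>2) = 1"
  proof -
    have "(\<Sum>i<n. (cmod (w i))\<^sup>2) = (\<Sum>i<n. (cmod (v i))\<^sup>2 / s)"
      using \<open>s > 0\<close> by (intro sum.cong refl) (simp add: w_def norm_divide power_divide)
    also have "\<dots> = 1" using s by (simp flip: sum_divide_distrib)
    finally show ?thesis .
  qed
  ultimately have "w \<in> unit_vecs n" by (simp add: unit_vecs_def)
  moreover have "v i = of_real (sqrt s) * w i" if "i < n" for i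
    using that \<open>s > 0\<close> by (simp add: w_def)
  ultimately show ?thesis using that by blast
qed

lemma unit_vecs_nonempty: "n > 0 \<Longrightarrow> unit_vecs n \<noteq> {}"
proof -
  assume n: "n > 0"
  have "(\<Sum>i<n. (cmod (if i = 0 then 1 else 0))\<^sup>2) = (\<Sum>i<n. if i = 0 then 1 else 0)"
    by (intro sum.cong) auto
  then have "(\<lambda>i. if i = 0 then 1 else 0) \<in> unit_vecs n"
    using n by (simp add: unit_vecs_def)
  then show ?thesis by blast
qed

lemma quadratic_lower_bound:
  fixes B :: "nat \<Rightarrow> nat \<Rightarrow> complex"
  assumes "\<And>w. w \<in> unit_vecs n \<Longrightarrow> \<beta> \<le> Re (\<Sum>i<n. \<Sum>j<n. B i j * (cnj (w i) * w j))"
  shows "\<beta> * (\<Sum>i<n. (cmod (v i))\<^sup>2) \<le> Re (\<Sum>i<n. \<Sum>j<n. B i j * (cnj (v i) * v j))"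
proof -
  define s where "s = (\<Sum>i<n. (cmod (v i))\<^sup>2)"
  show ?thesis
  proof (cases "s = 0")
    case True
    then have "v i = 0" if "i < n" for i
      using that unfolding s_def by (subst (asm) sum_nonneg_eq_0_iff) auto
    then show ?thesis by simp
  next
    case False
    obtain w where w: "w \<in> unit_vecs n" "\<And>i. i < n \<Longrightarrow> v i = of_real (sqrt s) * w i"
      using unit_vecs_normalize[OF s_def False] by blast
    have s: "s \<ge> 0" by (simp add: s_def sum_nonneg)
    have "(\<Sum>i<n. \<Sum>j<n. B i j * (cnj (v i) * v j))
        = (\<Sum>i<n. \<Sum>j<n. of_real (sqrt s * sqrt s) * (B i j * (cnj (w i) * w j)))"
      by (intro sum.cong refl)
        (simp only: w(2) lessThan_iff of_real_mult complex_cnj_mult complex_cnj_complex_of_real mult_ac)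
    also have "\<dots> = of_real s * (\<Sum>i<n. \<Sum>j<n. B i j * (cnj (w i) * w j))"
      using s by (simp add: sum_distrib_left)
    finally have "Re (\<Sum>i<n. \<Sum>j<n. B i j * (cnj (v i) * v j))
        = s * Re (\<Sum>i<n. \<Sum>j<n. B i j * (cnj (w i) * w j))" by simp
    then show ?thesis
      using mult_left_mono[OF assms[OF w(1)] s] by (simp add: s_def mult.commute)
  qed
qed

text \<open>The set \<open>G\<close> consists of the products of a point of \<open>K\<close> with a
  rank one projection, so \<open>X / n\<close> has the right trace to be a convex combination of
  them. Caratheodory makes the hull compact on the relevant coordinates, and a separating
  functional, once symmetrized, violates \<open>H\<close>.\<close>

lemma dilation_exists:
  fixes K :: "(real ^ 'd::finite) set"
  assumes K: "compact K" "K \<noteq> {}" and n: "n > 0" and X: "\<And>i. X i \<in> selfadjoint_mats n"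
    and H: "\<And>c. (\<And>x v. x \<in> K \<Longrightarrow>
        0 \<le> (\<Sum>i<n. \<Sum>j<n. \<Sum>k\<in>UNIV. c k i j * (pt x k * (cnj (v i) * v j)))) \<Longrightarrow>
      0 \<le> (\<Sum>i<n. \<Sum>j<n. \<Sum>k\<in>UNIV. c k i j * ent X k i j)"
  obtains r x a where "\<And>m. m < r \<Longrightarrow> x m \<in> K"
    and "\<And>i j. i < n \<Longrightarrow> j < n \<Longrightarrow> (\<Sum>m<r. a m i * cnj (a m j)) = (if i = j then 1 else 0)"
    and "X = (\<lambda>k. Matrix.mat n n (\<lambda>(i, j). \<Sum>m<(r::nat). of_real (vec_nth (x m) k) * a m i * cnj (a m j)))"
proof -
  define I where "I = (UNIV :: 'd option set) \<times> {..<n} \<times> {..<n}"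
  have I: "finite I" by (simp add: I_def)
  have sumI: "(\<Sum>x\<in>I. g x) = (\<Sum>a<n. \<Sum>b<n. \<Sum>k\<in>UNIV. g (k, a, b))" for g :: "_ \<Rightarrow> complex"
    unfolding I_def by (rule sum_index_triples)
  define f :: "(real ^ 'd) \<times> (nat \<Rightarrow> complex) \<Rightarrow> 'd option \<times> nat \<times> nat \<Rightarrow> complex"
    where "f p = (\<lambda>(k, i, j). pt (fst p) k * (cnj (snd p i) * snd p j))" for p
  define G where "G = f ` (K \<times> unit_vecs n)"
  define z where "z = (\<lambda>(k, i, j). ent X k i j / of_nat n)"
  have cont: "continuous_on (K \<times> unit_vecs n) f"
  proof -
    have 1: "continuous_on (K \<times> unit_vecs n) (\<lambda>p. pt (fst p) k)" for k
      by (cases k) (auto intro!: continuous_intros)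
    have 2: "continuous_on (K \<times> unit_vecs n) (\<lambda>p. snd p j)" for j
      by (rule continuous_on_compose2[OF continuous_on_product_coordinates
            continuous_on_snd[OF continuous_on_id]]) auto
    show ?thesis
      unfolding f_def case_prod_beta
      by (intro continuous_on_coordinatewise_then_product continuous_intros 1 2)
  qed
  have G: "compact G" "G \<noteq> {}"
    unfolding G_def using K unit_vecs_nonempty[OF n]
    by (auto intro!: compact_continuous_image cont compact_Times compact_unit_vecs)
  have "\<exists>g\<in>conv_combs (2 * card I + 1) G. \<forall>i\<in>I. g i = z i"
  proof (rule ccontr)
    assume neg: "\<not> ?thesis"
    have "\<exists>h. \<exists>\<delta>>0. \<forall>g\<in>G. Re (\<Sum>i\<in>I. h i * z i) + \<delta> \<le> Re (\<Sum>i\<in>I. h i * g i)"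
    proof (rule separation_conv_combs[OF I G])
      show "\<exists>i\<in>I. g i \<noteq> z i" if "g \<in> conv_combs (2 * card I + 1) G" for g
        using neg that by blast
    qed
    then obtain h \<delta> where \<delta>: "\<delta> > 0"
      and h: "\<And>g. g \<in> G \<Longrightarrow> Re (\<Sum>i\<in>I. h i * z i) + \<delta> \<le> Re (\<Sum>i\<in>I. h i * g i)"
      by blast
    define \<beta> where "\<beta> = Re (\<Sum>i\<in>I. h i * z i) + \<delta>"
    define c where "c = (\<lambda>k i j. (h (k, i, j) + cnj (h (k, j, i))) / 2
      - (if k = None \<and> i = j then complex_of_real \<beta> else 0))"
    have "0 \<le> (\<Sum>i<n. \<Sum>j<n. \<Sum>k\<in>UNIV. c k i j * ent X k i j)"
    proof (rule H)
      fix x v assume x: "x \<in> K"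
      have "\<beta> \<le> Re (\<Sum>i<n. \<Sum>j<n. (\<Sum>k\<in>UNIV. h (k, i, j) * pt x k) * (cnj (w i) * w j))"
        if w: "w \<in> unit_vecs n" for w
      proof -
        have "f (x, w) \<in> G" using x w by (auto simp: G_def)
        from h[OF this] show ?thesis
          unfolding sumI \<beta>_def by (simp add: f_def sum_distrib_right mult.assoc)
      qed
      from quadratic_lower_bound[OF this, of v]
      have le: "\<beta> * (\<Sum>i<n. (cmod (v i))\<^sup>2)
          \<le> Re (\<Sum>i<n. \<Sum>j<n. \<Sum>k\<in>UNIV. h (k, i, j) * (pt x k * (cnj (v i) * v j)))"
        by (simp add: sum_distrib_right mult.assoc)
      have "(\<Sum>i<n. \<Sum>j<n. \<Sum>k\<in>UNIV. c k i j * (pt x k * (cnj (v i) * v j)))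
        = of_real (Re (\<Sum>i<n. \<Sum>j<n. \<Sum>k\<in>UNIV. h (k, i, j) * (pt x k * (cnj (v i) * v j))))
          - of_real \<beta> * (\<Sum>i<n. pt x None * (cnj (v i) * v i))"
        unfolding c_def
      proof (rule hermitian_symmetrization[where h = "\<lambda>k a b. h (k, a, b)"
            and F = "\<lambda>k i j. pt x k * (cnj (v i) * v j)"])
        show "pt x k * (cnj (v j) * v i) = cnj (pt x k * (cnj (v i) * v j))" for k i j
          by (cases k) simp_all
      qed
      also have "(\<Sum>i<n. pt x None * (cnj (v i) * v i)) = of_real (\<Sum>i<n. (cmod (v i))\<^sup>2)"
        unfolding of_real_sum by (intro sum.cong refl) (simp only: pt_simps mult_1_left complex_norm_square mult.commute)
      finally show "0 \<le> (\<Sum>i<n. \<Sum>j<n. \<Sum>k\<in>UNIV. c k i j * (pt x k * (cnj (v i) * v j)))"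
        using le by (simp add: less_eq_complex_def)
    qed
    then show False
      using symmetrization_strict_neg[of n \<delta> X \<beta> "\<lambda>k a b. h (k, a, b)", OF n \<delta> X]
      by (simp add: c_def \<beta>_def sumI z_def)
  qed
  then obtain g where g: "g \<in> conv_combs (2 * card I + 1) G" and gz: "\<And>i. i \<in> I \<Longrightarrow> g i = z i"
    by blast
  define r where "r = 2 * card I + 1"
  obtain t e where t: "\<And>m. t m \<in> {0..1::real}" and e: "\<And>m. e m \<in> G"
    and g_eq: "g = (\<lambda>i. \<Sum>m<r. of_real (t m) * e m i)"
    using g unfolding conv_combs_def r_def by auto
  have "\<exists>p. p \<in> K \<times> unit_vecs n \<and> e m = f p" for m
    using e[of m] unfolding G_def by (rule imageE) blast
  then obtain p where p: "\<And>m. p m \<in> K \<times> unit_vecs n" "\<And>m. e m = f (p m)" by metis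
  \<comment> \<open>The square root absorbs the weight \<open>t m\<close> together with the factor
    \<open>n\<close> that undoes the trace normalisation; the conjugate matches the convention that
    \<open>a m i\<close> occurs unconjugated and \<open>a m j\<close> conjugated.\<close>
  define a where "a m i = of_real (sqrt (real n * t m)) * cnj (snd (p m) i)" for m i
  have key: "(\<Sum>m<r. pt (fst (p m)) k * a m i * cnj (a m j)) = ent X k i j" if "i < n" "j < n" for k i j
  proof -
    have "pt (fst (p m)) k * a m i * cnj (a m j) = of_nat n * (of_real (t m) * e m (k, i, j))" for m
    proof -
      have "complex_of_real (sqrt (real n * t m)) * of_real (sqrt (real n * t m)) = of_nat n * of_real (t m)"
      proof -
        have "sqrt (real n * t m) * sqrt (real n * t m) = real n * t m" using t[of m] by simp
        then show ?thesis by (metis of_real_mult of_real_of_nat_eq)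
      qed
      then show ?thesis
        by (simp add: a_def p(2) f_def algebra_simps)
    qed
    then have "(\<Sum>m<r. pt (fst (p m)) k * a m i * cnj (a m j)) = of_nat n * g (k, i, j)"
      by (simp add: g_eq sum_distrib_left)
    also have "\<dots> = ent X k i j"
      using gz[of "(k, i, j)"] that n by (simp add: I_def z_def)
    finally show ?thesis .
  qed
  show ?thesis
  proof (rule that)
    show "fst (p m) \<in> K" for m using p(1)[of m] by auto
    show "(\<Sum>m<r. a m i * cnj (a m j)) = (if i = j then 1 else 0)" if "i < n" "j < n" for i j
      using key[OF that, of None] by simp
    have "X i \<in> carrier_mat n n" for i using X[of i] by (simp add: selfadjoint_mats_def)
    then show "X = (\<lambda>k. Matrix.mat n n (\<lambda>(i, j). \<Sum>m<r.
        of_real (vec_nth (fst (p m)) k) * a m i * cnj (a m j)))"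
      using key[of _ _ "Some _"] by (intro ext eq_matI) auto
  qed
qed

text \<open>A duality criterion that tests functionals only over the points of \<open>K\<close>.
  Since the dilation is a finite sum, it lands in \<open>T\<close> itself even though
  \<open>T\<close> may fail to be closed.\<close>

lemma mem_matrix_convex_if_functionals:
  fixes K :: "(real ^ 'd::finite) set"
  assumes T: "matrix_convex T" "K \<subseteq> level1_real T"
    and K: "compact K" "K \<noteq> {}" and n: "n > 0" and X: "\<And>i. X i \<in> selfadjoint_mats n"
    and H: "\<And>c. (\<And>x v. x \<in> K \<Longrightarrow>
        0 \<le> (\<Sum>i<n. \<Sum>j<n. \<Sum>k\<in>UNIV. c k i j * (pt x k * (cnj (v i) * v j)))) \<Longrightarrow>
      0 \<le> (\<Sum>i<n. \<Sum>j<n. \<Sum>k\<in>UNIV. c k i j * ent X k i j)"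
  shows "X \<in> T n"
proof -
  show ?thesis
  proof (rule dilation_exists[OF K n X H])
    fix r x and a :: "nat \<Rightarrow> nat \<Rightarrow> complex"
    assume x: "\<And>m. m < r \<Longrightarrow> x m \<in> K"
      and a: "\<And>i j. i < n \<Longrightarrow> j < n \<Longrightarrow> (\<Sum>m<r. a m i * cnj (a m j)) = (if i = j then 1 else 0)"
      and X: "X = (\<lambda>k. Matrix.mat n n (\<lambda>(i, j). \<Sum>m<r. of_real (vec_nth (x m) k) * a m i * cnj (a m j)))"
    have "pt_mat (x m) \<in> T 1" if "m < r" for m
      using x[OF that] T(2) by (auto simp: level1_real_iff simp del: One_nat_def)
    then show ?thesis
      unfolding X by (rule dilation_in_matrix_convex[OF T(1) n _ a])
  qed
qed

section \<open>Vector states of matrix tuples and rank one matrices\<close>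

lemma matrix_state:
  fixes X :: "'d::finite \<Rightarrow> complex mat"
  assumes T: "matrix_convex T" and n: "n > 0" and X: "X \<in> T n" and v: "(\<Sum>a<n. (cmod (v a))\<^sup>2) = 1"
  obtains x where "x \<in> level1_real T" "\<And>k. pt x k = mat_form n X k v v"
proof -
  have one: "(\<Sum>a<n. cnj (v a) * v a) = 1"
  proof -
    have "(\<Sum>a<n. cnj (v a) * v a) = of_real (\<Sum>a<n. (cmod (v a))\<^sup>2)"
      unfolding of_real_sum by (intro sum.cong refl) (simp only: complex_norm_square mult.commute)
    then show ?thesis by (simp add: v)
  qed
  let ?\<phi> = "kraus 1 n 1 (\<lambda>_ a _. v a)"
  \<comment> \<open>Compression to a unit vector is a unital completely positive map into 1 by 1
    matrices, so vector states of members of \<open>T n\<close> are points of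
    \<open>T 1\<close>.\<close>
  have "ucp_mat_mat n 1 ?\<phi>"
    by (rule ucp_kraus) (simp add: one)
  from matrix_convex_ucp[OF T n _ this X]
  have mem: "(\<lambda>i. ?\<phi> (X i)) \<in> T 1" by simp
  have val: "?\<phi> (X i) = Matrix.mat 1 1 (\<lambda>_. mat_form n X (Some i) v v)" for i
    by (rule eq_matI) (auto simp: kraus_def mat_form_def)
  have re: "Im (mat_form n X (Some i) v v) = 0" for i
  proof -
    have "?\<phi> (X i) \<in> selfadjoint_mats 1"
      using matrix_convex_selfadjoint[OF T _ mem] by simp
    then have "?\<phi> (X i) $$ (0, 0) = cnj (?\<phi> (X i) $$ (0, 0))"
      unfolding selfadjoint_mats_iff by blast
    then show ?thesis unfolding val by (simp add: complex_eq_iff)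
  qed
  define x where "x = (\<chi> i. Re (mat_form n X (Some i) v v))"
  have pt: "pt x k = mat_form n X k v v" for k
  proof (cases k)
    case None
    have "(\<Sum>b<n. cnj (v a) * (if a = b then 1 else 0) * v b) = cnj (v a) * v a" if "a < n" for a
    proof -
      have "(\<Sum>b<n. cnj (v a) * (if a = b then 1 else 0) * v b) = (\<Sum>b<n. if b = a then cnj (v a) * v a else 0)"
        by (intro sum.cong refl) auto
      then show ?thesis using that by simp
    qed
    then show ?thesis using None one by (simp add: mat_form_def)
  next
    case (Some i)
    then show ?thesis using re[of i] by (simp add: x_def complex_eq_iff)
  qed
  have "pt_mat x = (\<lambda>i. ?\<phi> (X i))"
    unfolding val pt_mat_def using pt[of "Some _"] by simp
  then have "x \<in> level1_real T" using mem by (simp add: level1_real_iff)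
  then show ?thesis using pt that by blast
qed

lemma mat_form_cong:
  assumes "\<And>a. a < n \<Longrightarrow> v a = v' a" "\<And>a. a < n \<Longrightarrow> w a = w' a"
  shows "mat_form n X k v w = mat_form n X k v' w'"
  unfolding mat_form_def using assms by (intro sum.cong refl) simp

lemma mat_form_pos_if_level1:
  fixes X :: "'d::finite \<Rightarrow> complex mat"
  assumes T: "matrix_convex T" and n: "n > 0" and X: "X \<in> T n"
    and c: "\<And>x. x \<in> level1_real T \<Longrightarrow> 0 \<le> (\<Sum>k\<in>UNIV. c k * pt x k)"
  shows "0 \<le> (\<Sum>k\<in>UNIV. c k * mat_form n X k v v)"
proof (cases "(\<Sum>a<n. (cmod (v a))\<^sup>2) = 0")
  case True
  then have "v a = 0" if "a < n" for a
    using that by (subst (asm) sum_nonneg_eq_0_iff) auto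
  then have "mat_form n X k v v = 0" for k by (simp add: mat_form_def)
  then show ?thesis by simp
next
  case False
  define s where "s = (\<Sum>a<n. (cmod (v a))\<^sup>2)"
  have s: "s \<ge> 0" by (simp add: s_def sum_nonneg)
  obtain w where w: "w \<in> unit_vecs n" "\<And>a. a < n \<Longrightarrow> v a = of_real (sqrt s) * w a"
    using unit_vecs_normalize[OF s_def] False unfolding s_def by blast
  have "(\<Sum>a<n. (cmod (w a))\<^sup>2) = 1" using w(1) by (simp add: unit_vecs_def)
  then obtain x where x: "x \<in> level1_real T" "\<And>k. pt x k = mat_form n X k w w"
    using matrix_state[OF T n X] by blast
  have "mat_form n X k v v = of_real s * pt x k" for k
  proof -
    have "mat_form n X k v v = mat_form n X k (\<lambda>a. of_real (sqrt s) * w a) (\<lambda>a. of_real (sqrt s) * w a)"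
      by (rule mat_form_cong) (rule w(2), assumption)+
    also have "\<dots> = (of_real (sqrt s) * of_real (sqrt s)) * mat_form n X k w w"
      unfolding mat_form_def sum_distrib_left
      by (intro sum.cong refl) (simp only: complex_cnj_mult complex_cnj_complex_of_real mult_ac)
    also have "complex_of_real (sqrt s) * of_real (sqrt s) = of_real s"
      using s by (simp flip: of_real_mult)
    finally show ?thesis by (simp add: x(2))
  qed
  then have "(\<Sum>k\<in>UNIV. c k * mat_form n X k v v) = of_real s * (\<Sum>k\<in>UNIV. c k * pt x k)"
    by (simp add: sum_distrib_left mult_ac)
  also have "0 \<le> \<dots>"
    using c[OF x(1)] s by (intro mult_nonneg_nonneg) (auto simp: less_eq_complex_def)
  finally show ?thesis .
qed

text \<open>For each \<open>m\<close>, let \<open>\<alpha>\<close> and \<open>\<gamma>\<close> be the extreme values of the quadratic form of \<open>Y = w\<^sub>m \<cdot> X\<close>. If they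
  differ, \<open>Y = \<alpha> P + \<gamma> Q\<close> with \<open>P = (\<gamma> - Y)/(\<gamma> - \<alpha>)\<close> and \<open>Q = (Y - \<alpha>)/(\<gamma> - \<alpha>)\<close> positive and \<open>P + Q = 1\<close>,
  and \<open>\<alpha> u\<^sub>m / C\<close>, \<open>\<gamma> u\<^sub>m / C\<close> are points of \<open>K\<close>.\<close>

lemma rank_one_positivity:
  fixes K :: "(real ^ 'd::finite) set" and u w :: "'m \<Rightarrow> real ^ 'd"
  assumes T: "matrix_convex T" "level1_real T \<subseteq> K" and n: "n > 0" and X: "X \<in> T n"
    and C: "C > 0" and M: "finite M" and t: "\<And>m. m \<in> M \<Longrightarrow> 0 \<le> t m" "sum t M = 1"
    and id: "\<And>a b. (\<Sum>m\<in>M. t m * (vec_nth (u m) a * vec_nth (w m) b)) = (if a = b then 1 else 0)"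
    and inv: "\<And>m x. m \<in> M \<Longrightarrow> x \<in> K \<Longrightarrow> (inner (w m) x / C) *\<^sub>R u m \<in> K"
    and c: "\<And>x v. x \<in> K \<Longrightarrow>
        0 \<le> (\<Sum>i<n. \<Sum>j<n. \<Sum>k\<in>UNIV. c k i j * (pt x k * (cnj (v i) * v j)))"
  shows "0 \<le> (\<Sum>i<n. \<Sum>j<n. \<Sum>k\<in>UNIV. c k i j * ent (tuple_scale (1 / C) X) k i j)"
proof -
  have carr: "X l \<in> carrier_mat n n" for l
    using matrix_convex_selfadjoint[OF T(1) n X] by (simp add: selfadjoint_mats_def)
  define E where "E m i j = (\<Sum>l\<in>UNIV. c (Some l) i j * of_real (vec_nth (u m) l / C))" for m i j
  define Y where "Y m i j = (\<Sum>l\<in>UNIV. of_real (vec_nth (w m) l) * X l $$ (i, j))" for m i j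
  \<comment> \<open>The value of \<open>c\<close> at the tuple with entries \<open>u m\<close> times
    \<open>Y m\<close> divided by \<open>C\<close>. Weighted by \<open>t m\<close>, these tuples add
    up to \<open>X / C\<close>, since the rank one matrices average to the identity.\<close>
  define R where "R m = (\<Sum>i<n. \<Sum>j<n. c None i j * (if i = j then 1 else 0) + E m i j * Y m i j)" for m
  have R: "0 \<le> R m" if m: "m \<in> M" for m
  proof -
    define q where "q v = (\<Sum>i<n. \<Sum>j<n. Y m i j * (cnj (v i) * v j))" for v
    have q_eq: "q v = (\<Sum>l\<in>UNIV. of_real (vec_nth (w m) l) * mat_form n X (Some l) v v)" for v
    proof -
      have "q v = (\<Sum>i<n. \<Sum>j<n. \<Sum>l\<in>UNIV. of_real (vec_nth (w m) l) * (cnj (v i) * X l $$ (i, j) * v j))"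
        by (simp add: q_def Y_def sum_distrib_right sum_distrib_left mult_ac)
      also have "\<dots> = (\<Sum>l\<in>UNIV. \<Sum>i<n. \<Sum>j<n. of_real (vec_nth (w m) l) * (cnj (v i) * X l $$ (i, j) * v j))"
        by (rule sum_rotate3)
      finally show ?thesis by (simp add: mat_form_def sum_distrib_left)
    qed
    have state: "\<exists>x\<in>K. q v = of_real (inner (w m) x)" if v: "v \<in> unit_vecs n" for v
    proof -
      have "(\<Sum>a<n. (cmod (v a))\<^sup>2) = 1" using v by (simp add: unit_vecs_def)
      then obtain x where x: "x \<in> level1_real T" "\<And>k. pt x k = mat_form n X k v v"
        using matrix_state[OF T(1) n X] by blast
      then show ?thesis using T(2) by (intro bexI[of _ x]) (auto simp: q_eq inner_vec_def simp flip: x(2))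
    qed
    have cont: "continuous_on (unit_vecs n) (\<lambda>v. Re (q v))"
      unfolding q_def
      by (intro continuous_intros continuous_on_subset[OF continuous_on_product_coordinates]) simp_all
    obtain v0 where v0: "v0 \<in> unit_vecs n" "\<And>v. v \<in> unit_vecs n \<Longrightarrow> Re (q v0) \<le> Re (q v)"
      using continuous_attains_inf[OF compact_unit_vecs unit_vecs_nonempty[OF n] cont] by blast
    obtain v1 where v1: "v1 \<in> unit_vecs n" "\<And>v. v \<in> unit_vecs n \<Longrightarrow> Re (q v) \<le> Re (q v1)"
      using continuous_attains_sup[OF compact_unit_vecs unit_vecs_nonempty[OF n] cont] by blast
    define \<alpha> where "\<alpha> = Re (q v0)"
    define \<gamma> where "\<gamma> = Re (q v1)"
    \<comment> \<open>Both extreme values are attained, hence of the form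
      \<open>inner (w m) x\<close> with \<open>x\<close> in \<open>K\<close>; the invariance
      hypothesis then puts \<open>(y / C) *\<^sub>R u m\<close> into \<open>K\<close>, where
      \<open>c\<close> is nonnegative.\<close>
    have psdD: "psd n (\<lambda>i j. c None i j + of_real y * E m i j)" if y: "y = \<alpha> \<or> y = \<gamma>" for y
    proof -
      obtain x where "x \<in> K" "y = inner (w m) x"
        using y state[OF v0(1)] state[OF v1(1)] by (auto simp: \<alpha>_def \<gamma>_def)
      then have yK: "(y / C) *\<^sub>R u m \<in> K" using inv[OF m] by simp
      have "(\<Sum>k\<in>UNIV. c k i j * (pt ((y / C) *\<^sub>R u m) k * z)) = (c None i j + of_real y * E m i j) * z"
        for i j z
        by (simp add: sum_option E_def sum_distrib_left sum_distrib_right algebra_simps)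
      note ev = this
      have "(\<Sum>i<n. \<Sum>j<n. \<Sum>k\<in>UNIV. c k i j * (pt ((y / C) *\<^sub>R u m) k * (cnj (v i) * v j)))
          = (\<Sum>i<n. \<Sum>j<n. cnj (v i) * (c None i j + of_real y * E m i j) * v j)" for v
        by (intro sum.cong refl) (subst ev, simp only: mult_ac)
      then show ?thesis unfolding psd_def using c[OF yK] by simp
    qed
    have im: "Im (q v) = 0" for v
    proof -
      have "X l \<in> selfadjoint_mats n" for l using matrix_convex_selfadjoint[OF T(1) n X] .
      have "Im (mat_form n X (Some l) v v) = 0" for l
      proof -
        have sym: "cnj (X l $$ (i, j)) = X l $$ (j, i)" if "i < n" "j < n" for i j
          using \<open>\<And>l. X l \<in> selfadjoint_mats n\<close>[of l] that unfolding selfadjoint_mats_iff by metis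
        have "cnj (mat_form n X (Some l) v v) = (\<Sum>i<n. \<Sum>j<n. cnj (v j) * X l $$ (j, i) * v i)"
          unfolding mat_form_def cnj_sum
          by (intro sum.cong refl) (simp add: sym mult_ac)
        also have "\<dots> = mat_form n X (Some l) v v"
          unfolding mat_form_def ent_simps by (rule sum.swap)
        finally show ?thesis by (simp add: complex_eq_iff)
      qed
      then show ?thesis by (simp add: q_eq)
    qed
    define S where "S v = (\<Sum>i<n. (cmod (v i))\<^sup>2)" for v :: "nat \<Rightarrow> complex"
    have lower: "\<alpha> * S v \<le> Re (q v)" for v
      unfolding S_def q_def by (rule quadratic_lower_bound) (use v0(2) in \<open>simp add: \<alpha>_def q_def\<close>)
    have upper: "Re (q v) \<le> \<gamma> * S v" for v
    proof -
      have "(- \<gamma>) * S v \<le> Re (\<Sum>i<n. \<Sum>j<n. (- Y m i j) * (cnj (v i) * v j))"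
        unfolding S_def
        by (rule quadratic_lower_bound) (use v1(2) in \<open>simp add: \<gamma>_def q_def sum_negf\<close>)
      then show ?thesis by (simp add: q_def sum_negf)
    qed
    have delta: "(\<Sum>i<n. \<Sum>j<n. cnj (v i) * (if i = j then 1 else 0) * v j) = of_real (S v)" for v
    proof -
      have "(\<Sum>j<n. cnj (v i) * (if i = j then 1 else 0) * v j) = of_real ((cmod (v i))\<^sup>2)" if "i < n" for i
      proof -
        have "(\<Sum>j<n. cnj (v i) * (if i = j then 1 else 0) * v j)
            = (\<Sum>j<n. if j = i then cnj (v i) * v i else 0)"
          by (intro sum.cong refl) auto
        then show ?thesis using that by (simp only: complex_norm_square) (simp add: mult.commute)
      qed
      then show ?thesis by (simp add: S_def)
    qed
    have quad: "(\<Sum>i<n. \<Sum>j<n. cnj (v i) * (x * Y m i j + y * (if i = j then 1 else 0)) * v j)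
        = x * q v + y * of_real (S v)" for x y v
    proof -
      have "(\<Sum>i<n. \<Sum>j<n. cnj (v i) * (x * Y m i j + y * (if i = j then 1 else 0)) * v j)
          = x * q v + y * (\<Sum>i<n. \<Sum>j<n. cnj (v i) * (if i = j then 1 else 0) * v j)"
        unfolding q_def sum_distrib_left sum.distrib[symmetric]
        by (intro sum.cong refl) (simp add: algebra_simps)
      then show ?thesis by (simp only: delta)
    qed
    show ?thesis
    proof (cases "\<alpha> = \<gamma>")
      case True
      \<comment> \<open>Here \<open>P\<close> and \<open>Q\<close> would divide by zero, but
        \<open>Y m\<close> is a scalar matrix and one point of \<open>K\<close> suffices.\<close>
      have Y\<alpha>: "Y m i j = of_real \<alpha> * (if i = j then 1 else 0)" if "i < n" "j < n" for i j
      proof -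
        have "1 * Y m i j + (- of_real \<alpha>) * (if i = j then 1 else 0) = 0"
        proof (rule zero_if_quadratic_zero[OF _ that])
          fix v
          have "q v = of_real (\<alpha> * S v)"
            using lower[of v] upper[of v] True im[of v] by (simp add: complex_eq_iff)
          then show "(\<Sum>i<n. \<Sum>j<n. cnj (v i) * (1 * Y m i j + (- of_real \<alpha>) * (if i = j then 1 else 0)) * v j) = 0"
            unfolding quad by simp
        qed
        then show ?thesis by (simp add: add_eq_0_iff)
      qed
      have psd1: "psd n (\<lambda>i j. if i = j then 1 else 0)"
        unfolding psd_def delta by (simp add: less_eq_complex_def S_def sum_nonneg)
      have "0 \<le> (\<Sum>i<n. \<Sum>j<n. (c None i j + of_real \<alpha> * E m i j) * (if i = j then 1 else 0))"
        by (rule psd_pairing[OF psd1 psdD]) simp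
      also have "\<dots> = R m"
        unfolding R_def using Y\<alpha> by (intro sum.cong refl) (simp add: algebra_simps)
      finally show ?thesis .
    next
      case False
      have "\<alpha> \<le> \<gamma>" using v0(2)[OF v1(1)] by (simp add: \<alpha>_def \<gamma>_def)
      then have lt: "\<alpha> < \<gamma>" using False by simp
      define d where "d = \<gamma> - \<alpha>"
      have d: "d > 0" using lt by (simp add: d_def)
      define P where "P i j = of_real (- 1 / d) * Y m i j + of_real (\<gamma> / d) * (if i = j then 1 else 0)" for i j
      define Q where "Q i j = of_real (1 / d) * Y m i j + of_real (- \<alpha> / d) * (if i = j then 1 else 0)" for i j
      have qre: "q v = of_real (Re (q v))" for v using im[of v] by (simp add: complex_eq_iff)
      have "psd n P"
        unfolding psd_def P_def quad
      proof
        fix v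
        have "of_real (- 1 / d) * q v + of_real (\<gamma> / d) * of_real (S v)
            = complex_of_real ((\<gamma> * S v - Re (q v)) / d)"
          by (subst qre) (simp add: diff_divide_distrib)
        then show "0 \<le> of_real (- 1 / d) * q v + of_real (\<gamma> / d) * of_real (S v)"
          using upper[of v] d by (simp add: less_eq_complex_def)
      qed
      moreover have "psd n Q"
        unfolding psd_def Q_def quad
      proof
        fix v
        have "of_real (1 / d) * q v + of_real (- \<alpha> / d) * of_real (S v)
            = complex_of_real ((Re (q v) - \<alpha> * S v) / d)"
          by (subst qre) (simp add: diff_divide_distrib)
        then show "0 \<le> of_real (1 / d) * q v + of_real (- \<alpha> / d) * of_real (S v)"
          using lower[of v] d by (simp add: less_eq_complex_def)
      qed
      ultimately have "0 \<le> (\<Sum>i<n. \<Sum>j<n. (c None i j + of_real \<alpha> * E m i j) * P i j)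
          + (\<Sum>i<n. \<Sum>j<n. (c None i j + of_real \<gamma> * E m i j) * Q i j)"
        by (intro add_nonneg_nonneg psd_pairing psdD) auto
      also have "\<dots> = R m"
        unfolding R_def sum.distrib[symmetric]
      proof (intro sum.cong refl)
        fix i j :: nat
        define \<delta> :: complex where "\<delta> = (if i = j then 1 else 0)"
        have D: "complex_of_real \<gamma> - of_real \<alpha> = of_real d" "complex_of_real d \<noteq> 0"
          using d by (simp_all add: d_def)
        have P: "P i j = (of_real \<gamma> * \<delta> - Y m i j) / of_real d"
          unfolding P_def \<delta>_def[symmetric] by (simp add: diff_divide_distrib)
        have Q: "Q i j = (Y m i j - of_real \<alpha> * \<delta>) / of_real d"
          unfolding Q_def \<delta>_def[symmetric] by (simp add: diff_divide_distrib)
        have "P i j + Q i j = (complex_of_real \<gamma> - of_real \<alpha>) * \<delta> / of_real d"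
          by (simp add: P Q algebra_simps flip: add_divide_distrib)
        moreover have "of_real \<alpha> * P i j + of_real \<gamma> * Q i j
            = (complex_of_real \<gamma> - of_real \<alpha>) * Y m i j / of_real d"
          unfolding P Q times_divide_eq_right add_divide_distrib[symmetric]
          by (simp add: algebra_simps)
        ultimately have 1: "P i j + Q i j = \<delta>" "of_real \<alpha> * P i j + of_real \<gamma> * Q i j = Y m i j"
          using D(2) unfolding D(1) by simp_all
        have "(c None i j + of_real \<alpha> * E m i j) * P i j + (c None i j + of_real \<gamma> * E m i j) * Q i j
            = c None i j * (P i j + Q i j) + E m i j * (of_real \<alpha> * P i j + of_real \<gamma> * Q i j)"
          by (simp add: algebra_simps)
        then show "(c None i j + of_real \<alpha> * E m i j) * P i j + (c None i j + of_real \<gamma> * E m i j) * Q i j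
            = c None i j * (if i = j then 1 else 0) + E m i j * Y m i j"
          by (simp only: 1 \<delta>_def)
      qed
      finally show ?thesis .
    qed
  qed
  have "0 \<le> (\<Sum>m\<in>M. of_real (t m) * R m)"
    using R t(1) by (intro sum_nonneg mult_nonneg_nonneg) (auto simp: less_eq_complex_def)
  also have "(\<Sum>m\<in>M. of_real (t m) * R m)
      = (\<Sum>i<n. \<Sum>j<n. \<Sum>m\<in>M. of_real (t m) * (c None i j * (if i = j then 1 else 0) + E m i j * Y m i j))"
    unfolding R_def sum_distrib_left by (rule sum_rotate3[symmetric])
  also have "\<dots> = (\<Sum>i<n. \<Sum>j<n. \<Sum>k\<in>UNIV. c k i j * ent (tuple_scale (1 / C) X) k i j)"
  proof (intro sum.cong refl)
    fix i j assume "i \<in> {..<n}" "j \<in> {..<n}"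
    then have ij: "i < n" "j < n" by auto
    have "(\<Sum>m\<in>M. of_real (t m) * (E m i j * Y m i j))
        = (\<Sum>m\<in>M. \<Sum>a\<in>UNIV. \<Sum>b\<in>UNIV. of_real (t m * (vec_nth (u m) a * vec_nth (w m) b)) *
            (c (Some a) i j * of_real (1 / C) * X b $$ (i, j)))"
      unfolding E_def Y_def sum_product
      unfolding sum_distrib_left
      by (intro sum.cong refl) (simp add: mult_ac divide_inverse)
    also have "\<dots> = (\<Sum>a\<in>UNIV. \<Sum>b\<in>UNIV. \<Sum>m\<in>M. of_real (t m * (vec_nth (u m) a * vec_nth (w m) b)) *
            (c (Some a) i j * of_real (1 / C) * X b $$ (i, j)))"
      by (rule sum_rotate3[symmetric])
    also have "\<dots> = (\<Sum>a\<in>UNIV. \<Sum>b\<in>UNIV. of_real (\<Sum>m\<in>M. t m * (vec_nth (u m) a * vec_nth (w m) b)) *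
            (c (Some a) i j * of_real (1 / C) * X b $$ (i, j)))"
      by (simp only: of_real_sum sum_distrib_right)
    also have "\<dots> = (\<Sum>a\<in>UNIV. c (Some a) i j * (of_real (1 / C) * X a $$ (i, j)))"
      unfolding id
    proof (intro sum.cong refl)
      fix a
      have "(\<Sum>b\<in>UNIV. of_real (if a = b then 1 else 0) * (c (Some a) i j * of_real (1 / C) * X b $$ (i, j)))
          = (\<Sum>b\<in>UNIV. if b = a then c (Some a) i j * (of_real (1 / C) * X a $$ (i, j)) else 0)"
        by (intro sum.cong refl) (auto simp: mult_ac)
      then show "(\<Sum>b\<in>UNIV. of_real (if a = b then 1 else 0) * (c (Some a) i j * of_real (1 / C) * X b $$ (i, j)))
          = c (Some a) i j * (of_real (1 / C) * X a $$ (i, j))" by simp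
    qed
    finally have 1: "(\<Sum>m\<in>M. of_real (t m) * (E m i j * Y m i j))
        = (\<Sum>a\<in>UNIV. c (Some a) i j * (of_real (1 / C) * X a $$ (i, j)))" .
    have 2: "(\<Sum>m\<in>M. of_real (t m) * z) = z" for z :: complex
      using t(2) by (simp flip: sum_distrib_right of_real_sum)
    have "(\<Sum>k\<in>UNIV. c k i j * ent (tuple_scale (1 / C) X) k i j)
        = c None i j * (if i = j then 1 else 0)
          + (\<Sum>a\<in>UNIV. c (Some a) i j * (of_real (1 / C) * X a $$ (i, j)))"
      using ij carrier_matD[OF carr] by (simp add: sum_option tuple_scale_def)
    then show "(\<Sum>m\<in>M. of_real (t m) * (c None i j * (if i = j then 1 else 0) + E m i j * Y m i j))
        = (\<Sum>k\<in>UNIV. c k i j * ent (tuple_scale (1 / C) X) k i j)"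
      by (simp only: distrib_left sum.distrib 1 2)
  qed
  finally show ?thesis .
qed

lemma tuple_scale_selfadjoint:
  assumes "\<And>i. X i \<in> selfadjoint_mats n"
  shows "tuple_scale s X i \<in> selfadjoint_mats n"
  unfolding selfadjoint_mats_iff
proof (intro conjI allI impI)
  have carr: "X i \<in> carrier_mat n n" using assms[of i] by (simp add: selfadjoint_mats_def)
  then show "tuple_scale s X i \<in> carrier_mat n n" by (simp add: tuple_scale_def)
  fix a b assume ab: "a < n" "b < n"
  have "X i $$ (a, b) = cnj (X i $$ (b, a))"
    using assms[of i] ab unfolding selfadjoint_mats_iff by blast
  then show "tuple_scale s X i $$ (a, b) = cnj (tuple_scale s X i $$ (b, a))"
    using ab carrier_matD[OF carr] by (simp only: tuple_scale_def index_smult_mat complex_cnj_mult complex_cnj_complex_of_real)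
qed

text \<open>Two matrix convex sets around \<open>K\<close> allow one statement for both constants:
  \<open>T'\<close> becomes \<open>cpset A\<close> for \<sigma>, and \<open>T\<close> becomes
  \<open>cpset A\<close> for \<rho>.\<close>

lemma rank_one_scaling:
  fixes K :: "(real ^ 'd::finite) set" and u w :: "'m \<Rightarrow> real ^ 'd"
  assumes T: "matrix_convex T" "level1_real T \<subseteq> K" and T': "matrix_convex T'" "K \<subseteq> level1_real T'"
    and K: "compact K" "K \<noteq> {}" and n: "n > 0" and X: "X \<in> T n"
    and C: "C > 0" and M: "finite M" and t: "\<And>m. m \<in> M \<Longrightarrow> 0 \<le> t m" "sum t M = 1"
    and id: "\<And>a b. (\<Sum>m\<in>M. t m * (vec_nth (u m) a * vec_nth (w m) b)) = (if a = b then 1 else 0)"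
    and inv: "\<And>m x. m \<in> M \<Longrightarrow> x \<in> K \<Longrightarrow> (inner (w m) x / C) *\<^sub>R u m \<in> K"
  shows "tuple_scale (1 / C) X \<in> T' n"
proof (rule mem_matrix_convex_if_functionals[OF T' K n])
  show "tuple_scale (1 / C) X i \<in> selfadjoint_mats n" for i
    by (rule tuple_scale_selfadjoint) (rule matrix_convex_selfadjoint[OF T(1) n X])
  show "0 \<le> (\<Sum>i<n. \<Sum>j<n. \<Sum>k\<in>UNIV. c k i j * ent (tuple_scale (1 / C) X) k i j)"
    if "\<And>x v. x \<in> K \<Longrightarrow> 0 \<le> (\<Sum>i<n. \<Sum>j<n. \<Sum>k\<in>UNIV. c k i j * (pt x k * (cnj (v i) * v j)))" for c
    by (rule rank_one_positivity[OF T n X C M t id inv that])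
qed

section \<open>The two constants\<close>

text \<open>The unit stays unscaled, as in the map sending I to I and the generators to
  multiples.\<close>

definition scale_form :: "real \<Rightarrow> ('d option \<Rightarrow> 'v \<Rightarrow> 'v \<Rightarrow> complex) \<Rightarrow> 'd option \<Rightarrow> 'v \<Rightarrow> 'v \<Rightarrow> complex" where
  "scale_form s F k x y = (case k of None \<Rightarrow> F None x y | Some i \<Rightarrow> of_real s * F (Some i) x y)"

lemma op_form_scale: "op_form (\<lambda>i. s *\<^sub>R B i) = scale_form s (op_form B)"
proof (intro ext)
  show "op_form (\<lambda>i. s *\<^sub>R B i) k x y = scale_form s (op_form B) k x y" for k x y
    by (cases k) (simp_all add: op_form_def scale_form_def blinfun.scaleR_left cinner_scaleR_right)
qed

lemma mat_form_tuple_scale: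
  assumes X: "\<And>i. X i \<in> carrier_mat n n"
  shows "mat_form n (tuple_scale s X) = scale_form s (mat_form n X)"
proof (intro ext)
  show "mat_form n (tuple_scale s X) k v w = scale_form s (mat_form n X) k v w" for k v w
  proof (cases k)
    case None
    then show ?thesis by (simp add: mat_form_def scale_form_def)
  next
    case (Some i)
    have "ent (tuple_scale s X) k a b = of_real s * X i $$ (a, b)" if "a < n" "b < n" for a b
      using that carrier_matD[OF X[of i]] Some by (simp add: tuple_scale_def)
    then show ?thesis
      using Some by (simp add: mat_form_def scale_form_def sum_distrib_left mult_ac)
  qed
qed

text \<open>The scale is moved from the forms to the coefficients, where the unscaled relation
  between \<open>G\<close> and \<open>H\<close> applies.\<close>

lemma cp_rel_scale_trans:
  fixes F :: "'d::finite option \<Rightarrow> 'u \<Rightarrow> 'u \<Rightarrow> complex"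
  assumes FG: "cp_rel F (scale_form s G)" and GH: "cp_rel G H"
  shows "cp_rel F (scale_form s H)"
  unfolding cp_rel_def
proof (intro allI impI)
  fix p c assume "form_pos F p c"
  then have pos: "form_pos (scale_form s G) p c" using FG by (simp add: cp_rel_def)
  define d where "d k i j = (case k of None \<Rightarrow> c None i j | Some l \<Rightarrow> of_real s * c (Some l) i j)" for k i j
  have d: "c k i j * scale_form s E k x y = d k i j * E k x y" for E k i j x y
    by (cases k) (simp_all add: scale_form_def d_def)
  have "form_pos G p d" using pos unfolding form_pos_def d .
  then have "form_pos H p d" using GH by (simp add: cp_rel_def)
  then show "form_pos (scale_form s H) p c" unfolding form_pos_def d .
qed

text \<open>For fixed coefficients and test vectors the form is continuous and affine in
  \<open>s\<close>, so the admissible scales are an intersection of closed convex sets.\<close>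

lemma closed_convex_cp_scales:
  fixes F :: "'d::finite option \<Rightarrow> 'u \<Rightarrow> 'u \<Rightarrow> complex"
  shows "closed {s. cp_rel F (scale_form s G)}" "convex {s. cp_rel F (scale_form s G)}"
proof -
  define h where "h p c x s = (\<Sum>i<p. \<Sum>j<p. \<Sum>k\<in>UNIV. c k i j * scale_form s G k (x i) (x j))"
    for p :: nat and c :: "'d option \<Rightarrow> nat \<Rightarrow> nat \<Rightarrow> complex" and x :: "nat \<Rightarrow> _" and s
  have eq: "{s. cp_rel F (scale_form s G)} = {s. \<forall>p c x. form_pos F p c \<longrightarrow> 0 \<le> h p c x s}"
    by (auto simp: cp_rel_def form_pos_def h_def)
  have cont: "continuous_on UNIV (h p c x)" for p c x
  proof -
    have "continuous_on UNIV (\<lambda>s. scale_form s G k u v)" for k u v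
      by (cases k) (auto simp: scale_form_def intro!: continuous_intros)
    then show ?thesis unfolding h_def by (intro continuous_intros)
  qed
  have "closed {s. form_pos F p c \<longrightarrow> 0 \<le> h p c x s}" for p c x
    by (cases "form_pos F p c") (simp_all add: closed_Collect_nonneg_complex[OF cont])
  then show "closed {s. cp_rel F (scale_form s G)}"
    unfolding eq by (intro closed_Collect_all)
  have affine: "h p c x (a * s + b * t) = of_real a * h p c x s + of_real b * h p c x t"
    if "a + b = 1" for p c x a b s t
  proof -
    have ab: "complex_of_real a + of_real b = 1" using that by (simp flip: of_real_add)
    have "scale_form (a * s + b * t) G k u v
        = of_real a * scale_form s G k u v + of_real b * scale_form t G k u v" for k u v
    proof (cases k)
      case None
      have "G None u v = (complex_of_real a + of_real b) * G None u v" by (simp add: ab)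
      then show ?thesis using None by (simp add: scale_form_def distrib_right)
    qed (simp add: scale_form_def algebra_simps)
    then show ?thesis
      unfolding h_def sum_distrib_left sum.distrib[symmetric]
      by (intro sum.cong refl) (simp add: algebra_simps)
  qed
  show "convex {s. cp_rel F (scale_form s G)}"
    unfolding convex_def
  proof (intro ballI allI impI)
    fix s t a b :: real
    assume st: "s \<in> {s. cp_rel F (scale_form s G)}" "t \<in> {s. cp_rel F (scale_form s G)}"
      and ab: "0 \<le> a" "0 \<le> b" "a + b = 1"
    have "0 \<le> of_real a * h p c x s + of_real b * h p c x t" if "form_pos F p c" for p c x
      using st[unfolded eq] that ab
      by (intro add_nonneg_nonneg mult_nonneg_nonneg) (auto simp: less_eq_complex_def)
    then show "a *\<^sub>R s + b *\<^sub>R t \<in> {s. cp_rel F (scale_form s G)}"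
      unfolding eq by (simp add: affine[OF ab(3)])
  qed
qed

text \<open>Here \<open>R\<close> is the set whose supremum defines a constant, and \<open>Q\<close>
  the possibly larger set of scales that work in one situation. Neither attainment nor finiteness of
  the supremum is available; \<open>Q\<close> contains the segments from 0 to members of
  \<open>R\<close>, and closedness adds the endpoint \<open>r\<close>.\<close>

lemma mem_if_ennreal_le_Sup:
  assumes Q: "closed Q" "convex Q" "0 \<in> Q" and R: "R \<subseteq> Q" "\<And>s. s \<in> R \<Longrightarrow> 0 \<le> s"
    and r: "0 \<le> r" "ennreal r \<le> Sup {ennreal s | s. s \<in> R}"
  shows "r \<in> Q"
proof (cases "r = 0")
  case False
  then have "r > 0" using r by simp
  have "{0..<r} \<subseteq> Q"
  proof
    fix s assume s: "s \<in> {0..<r}"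
    then have "ennreal s < ennreal r" using \<open>r > 0\<close> by (simp add: ennreal_lessI)
    also note r(2)
    finally obtain t where t: "t \<in> R" "ennreal s < ennreal t" by (auto simp: less_Sup_iff)
    then have "s < t" using s by (simp add: ennreal_less_iff)
    moreover have "t \<in> Q" using t R by blast
    ultimately have "(1 - s / t) *\<^sub>R 0 + (s / t) *\<^sub>R t \<in> Q"
      using s Q by (intro convexD_alt) auto
    then show "s \<in> Q" using \<open>s < t\<close> s by simp
  qed
  then have "closure {0..<r} \<subseteq> Q" using Q(1) by (rule closure_minimal)
  then show ?thesis using \<open>r > 0\<close> by auto
qed (use Q in simp)

section \<open>Compressions to finite dimensional subspaces\<close>

lemma orthonormal_residual:
  assumes on: "\<And>a b. a < n \<Longrightarrow> b < n \<Longrightarrow> cinner (e a) (e b) = (if a = b then 1 else 0)" and b: "b < (n::nat)"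
  shows "cinner (e b) (x - (\<Sum>a<n. cinner (e a) x *\<^sub>C e a)) = 0"
proof -
  have "(\<Sum>a<n. cinner (e a) x * cinner (e b) (e a)) = (\<Sum>a<n. if a = b then cinner (e b) x else 0)"
    using b by (intro sum.cong refl) (auto simp: on)
  also have "\<dots> = cinner (e b) x" using b by simp
  finally have "(\<Sum>a<n. cinner (e a) x * cinner (e b) (e a)) = cinner (e b) x" .
  then show ?thesis by (simp add: cinner_diff_right cinner_sum_right cinner_scaleC_right)
qed

text \<open>Zero residuals are skipped, so \<open>n\<close> may be smaller than \<open>p\<close> and
  linearly dependent families are covered.\<close>

lemma gram_schmidt_span:
  fixes x :: "nat \<Rightarrow> 'h::complex_hilbert"
  shows "\<exists>(n::nat) e. (\<forall>a<n. \<forall>b<n. cinner (e a) (e b) = (if a = b then 1 else 0)) \<and>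
    (\<forall>i<p. \<exists>v. x i = (\<Sum>a<n. v a *\<^sub>C e a))"
proof (induction p)
  case 0
  show ?case by (rule exI[of _ "0::nat"]) simp
next
  case (Suc p)
  then obtain n :: nat and e where on: "\<And>a b. a < n \<Longrightarrow> b < n \<Longrightarrow> cinner (e a) (e b) = (if a = b then 1 else 0)"
    and sp: "\<And>i. i < p \<Longrightarrow> \<exists>v. x i = (\<Sum>a<n. v a *\<^sub>C e a)" by blast
  define v where "v a = cinner (e a) (x p)" for a
  define r where "r = x p - (\<Sum>a<n. v a *\<^sub>C e a)"
  have orth: "cinner (e b) r = 0" if "b < n" for b
    unfolding r_def v_def by (rule orthonormal_residual[OF on that])
  show ?case
  proof (cases "r = 0")
    case True
    then have "x p = (\<Sum>a<n. v a *\<^sub>C e a)" by (simp add: r_def)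
    then have "\<forall>i<Suc p. \<exists>v. x i = (\<Sum>a<n. v a *\<^sub>C e a)" using sp by (auto simp: less_Suc_eq)
    then show ?thesis using on by (intro exI[of _ n] exI[of _ e]) auto
  next
    case False
    define f where "f a = (if a < n then e a else (1 / norm r) *\<^sub>R r)" for a
    have fr: "cinner (e b) ((1 / norm r) *\<^sub>R r) = 0" if "b < n" for b
      using orth[OF that] by (simp add: cinner_scaleR_right)
    then have rf: "cinner ((1 / norm r) *\<^sub>R r) (e b) = 0" if "b < n" for b
      using that by (metis cinner_commute complex_cnj_zero)
    have "norm ((1 / norm r) *\<^sub>R r) = 1" using False by simp
    then have rr: "cinner ((1 / norm r) *\<^sub>R r) ((1 / norm r) *\<^sub>R r) = 1"
      by (simp only: cinner_self) simp
    have "\<forall>a<Suc n. \<forall>b<Suc n. cinner (f a) (f b) = (if a = b then 1 else 0)"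
      using on fr rf rr by (auto simp: f_def less_Suc_eq)
    moreover have "\<exists>v. x i = (\<Sum>a<Suc n. v a *\<^sub>C f a)" if i: "i < Suc p" for i
    proof (cases "i < p")
      case True
      then obtain u where "x i = (\<Sum>a<n. u a *\<^sub>C e a)" using sp by blast
      then have "x i = (\<Sum>a<Suc n. (u(n := 0)) a *\<^sub>C f a)" by (simp add: f_def)
      then show ?thesis by blast
    next
      case False
      have "x p = (\<Sum>a<n. v a *\<^sub>C e a) + of_real (norm r) *\<^sub>C ((1 / norm r) *\<^sub>R r)"
        using \<open>r \<noteq> 0\<close> unfolding scaleC_of_real by (simp add: r_def)
      then have "x p = (\<Sum>a<Suc n. (v(n := of_real (norm r))) a *\<^sub>C f a)" by (simp add: f_def)
      then show ?thesis using False i by (metis less_SucE)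
    qed
    ultimately show ?thesis by (intro exI[of _ "Suc n"] exI[of _ f]) auto
  qed
qed

lemma op_form_compression:
  fixes B :: "'d \<Rightarrow> 'k::complex_hilbert \<Rightarrow>\<^sub>L 'k"
  assumes B: "\<And>i. B i \<in> bounded_ops"
    and on: "\<And>a b. a < n \<Longrightarrow> b < n \<Longrightarrow> cinner (e a) (e b) = (if a = b then 1 else 0)"
    and X: "\<And>i a b. a < n \<Longrightarrow> b < n \<Longrightarrow> X i $$ (a, b) = op_form B (Some i) (e a) (e b)"
  shows "op_form B k (\<Sum>a<n. v a *\<^sub>C e a) (\<Sum>b<n. w b *\<^sub>C e b) = mat_form n X k v w"
proof -
  have aug: "aug B k \<in> bounded_ops" using B by (cases k) (auto simp: bounded_ops_def)
  have "op_form B k (\<Sum>a<n. v a *\<^sub>C e a) (\<Sum>b<n. w b *\<^sub>C e b)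
      = (\<Sum>a<n. \<Sum>b<n. cnj (v a) * op_form B k (e a) (e b) * w b)"
    unfolding op_form_def cinner_sum_left
    by (intro sum.cong refl)
      (simp add: blinfun.sum_right blinfun_apply_bounded_ops[OF aug] cinner_sum_right
        cinner_scaleC_left cinner_scaleC_right sum_distrib_left mult_ac)
  also have "\<dots> = mat_form n X k v w"
    unfolding mat_form_def
    by (intro sum.cong refl) (cases k; simp add: X on; simp add: op_form_def on)
  finally show ?thesis .
qed

text \<open>Each instance of complete positivity involves finitely many vectors. They span a finite
  dimensional subspace, and the compression of \<open>B\<close> to it belongs to
  \<open>cpset B\<close>, so the hypothesis on matrix tuples applies.\<close>

lemma cp_rel_scale_op_form:
  fixes B :: "'d::finite \<Rightarrow> 'k::complex_hilbert \<Rightarrow>\<^sub>L 'k" and F :: "'d option \<Rightarrow> 'u \<Rightarrow> 'u \<Rightarrow> complex"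
  assumes B: "\<And>i. B i \<in> bounded_ops"
    and cp: "\<And>n Y. n > 0 \<Longrightarrow> Y \<in> cpset B n \<Longrightarrow> cp_rel F (scale_form s (mat_form n Y))"
  shows "cp_rel F (scale_form s (op_form B))"
  unfolding cp_rel_def form_pos_def[of "scale_form s (op_form B)"]
proof (intro allI impI)
  fix p c and x :: "nat \<Rightarrow> 'k"
  assume pos: "form_pos F p c"
  obtain n and e :: "nat \<Rightarrow> 'k"
    where on: "\<And>a b. a < n \<Longrightarrow> b < n \<Longrightarrow> cinner (e a) (e b) = (if a = b then 1 else 0)"
    and sp: "\<forall>i<p. \<exists>v. x i = (\<Sum>a<n. v a *\<^sub>C e a)" using gram_schmidt_span[of p x] by blast
  obtain v where v: "\<And>i. i < p \<Longrightarrow> x i = (\<Sum>a<n. v i a *\<^sub>C e a)" using sp by metis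
  define Y where "Y i = Matrix.mat n n (\<lambda>(a, b). op_form B (Some i) (e a) (e b))" for i
  have comp: "op_form B k (\<Sum>a<n. v a *\<^sub>C e a) (\<Sum>b<n. w b *\<^sub>C e b) = mat_form n Y k v w" for k v w
    by (rule op_form_compression[OF B on]) (simp_all add: Y_def)
  have comp': "scale_form s (op_form B) k (\<Sum>a<n. v a *\<^sub>C e a) (\<Sum>b<n. w b *\<^sub>C e b)
      = scale_form s (mat_form n Y) k v w" for k v w
    by (cases k) (simp_all add: scale_form_def comp)
  show "0 \<le> (\<Sum>i<p. \<Sum>j<p. \<Sum>k\<in>UNIV. c k i j * scale_form s (op_form B) k (x i) (x j))"
  \<comment> \<open>An empty orthonormal family means that all test vectors are zero; the hypothesis
    covers positive levels only.\<close>
  proof (cases "n = 0")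
    case True
    have "scale_form s (op_form B) k (x i) (x j) = 0" if "i < p" "j < p" for k i j
      using v[OF that(1)] v[OF that(2)] True by (cases k) (simp_all add: scale_form_def op_form_def)
    then show ?thesis by simp
  next
    case False
    have "cp_rel (op_form B) (mat_form n Y)"
      unfolding cp_rel_def
    proof (intro allI impI)
      fix q d assume posB: "form_pos (op_form B) q d"
      show "form_pos (mat_form n Y) q d"
        unfolding form_pos_def comp[symmetric]
      proof
        fix y :: "nat \<Rightarrow> nat \<Rightarrow> complex"
        from posB[unfolded form_pos_def, rule_format, of "\<lambda>i. \<Sum>a<n. y i a *\<^sub>C e a"]
        show "0 \<le> (\<Sum>i<q. \<Sum>j<q. \<Sum>k\<in>UNIV. d k i j *
            op_form B k (\<Sum>a<n. y i a *\<^sub>C e a) (\<Sum>b<n. y j b *\<^sub>C e b))" .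
      qed
    qed
    then have "Y \<in> cpset B n" by (simp add: cpset_def Y_def)
    then have "cp_rel F (scale_form s (mat_form n Y))" using cp False by blast
    then have "form_pos (scale_form s (mat_form n Y)) p c" using pos by (simp add: cp_rel_def)
    then have "0 \<le> (\<Sum>i<p. \<Sum>j<p. \<Sum>k\<in>UNIV. c k i j * scale_form s (mat_form n Y) k (v i) (v j))"
      by (simp add: form_pos_def)
    also have "\<dots> = (\<Sum>i<p. \<Sum>j<p. \<Sum>k\<in>UNIV. c k i j * scale_form s (op_form B) k (x i) (x j))"
      using v by (intro sum.cong refl) (simp add: comp')
    finally show ?thesis .
  qed
qed

section \<open>Sets of admissible scales\<close>

lemma state_set_mono:
  assumes "pos_rel F G"
  shows "state_set G \<subseteq> state_set F"
  using assms unfolding state_set_def pos_rel_def by blast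

lemma cpset_level1:
  assumes A: "\<And>i. A i \<in> selfadjoint_ops"
  shows "cpset A 1 = pt_mat ` state_set (op_form A)"
proof -
  have Ab: "A i \<in> bounded_ops" for i using A[of i] by (simp add: selfadjoint_ops_def)
  have "\<exists>x. X = pt_mat x" if X: "X \<in> cpset A 1" for X
  proof
    have sa: "X i \<in> selfadjoint_mats 1" for i by (rule cpset_selfadjoint[OF A X])
    show "X = pt_mat (\<chi> i. Re (X i $$ (0, 0)))"
    proof
      fix i
      have "X i $$ (0, 0) = cnj (X i $$ (0, 0))" and carr: "X i \<in> carrier_mat 1 1"
        using sa[of i] unfolding selfadjoint_mats_iff by auto
      then have "X i $$ (0, 0) = of_real (Re (X i $$ (0, 0)))" by (simp add: complex_eq_iff)
      then show "X i = pt_mat (\<chi> i. Re (X i $$ (0, 0))) i"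
        using carr unfolding pt_mat_def by (intro eq_matI) auto
    qed
  qed
  note ex = this
  show ?thesis
    unfolding level1_real_cpset[of A, OF Ab, symmetric]
  proof (intro equalityI subsetI)
    fix X assume X: "X \<in> cpset A 1"
    then obtain x where "X = pt_mat x" using ex by blast
    then show "X \<in> pt_mat ` level1_real (cpset A)" using X by (simp add: level1_real_iff)
  next
    fix X assume "X \<in> pt_mat ` level1_real (cpset A)"
    then show "X \<in> cpset A 1" by (auto simp: level1_real_iff)
  qed
qed

lemma cpset_level1_mono:
  assumes "\<And>i. A i \<in> selfadjoint_ops" "\<And>i. B i \<in> selfadjoint_ops"
    and "pos_rel (op_form A) (op_form B)"
  shows "cpset B 1 \<subseteq> cpset A 1"
  using state_set_mono[OF assms(3)] cpset_level1[of A] cpset_level1[of B] assms(1,2) by auto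

text \<open>The real numbers whose supremum is \<open>sigma_const\<close>, kept as a set because the
  arguments work with membership; \<open>rho_set\<close> plays the same role for
  \<open>rho_level\<close>.\<close>

definition sigma_set :: "('d::finite \<Rightarrow> 'h::complex_hilbert \<Rightarrow>\<^sub>L 'h) \<Rightarrow> real set" where
  "sigma_set A = {s. 0 \<le> s \<and>
     (\<forall>T. matrix_convex T \<and> T 1 \<subseteq> cpset A 1 \<longrightarrow> (\<forall>n>0. tuple_scale s ` T n \<subseteq> cpset A n))}"

definition rho_set :: "('d::finite \<Rightarrow> 'h::complex_hilbert \<Rightarrow>\<^sub>L 'h) \<Rightarrow> nat \<Rightarrow> real set" where
  "rho_set A n = {t. 0 \<le> t \<and>
     (\<forall>T. matrix_convex T \<and> cpset A 1 \<subseteq> T 1 \<longrightarrow> tuple_scale t ` cpset A n \<subseteq> T n)}"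

text \<open>Positivity of the map from \<open>A\<close> to \<open>B\<close> puts the first level of
  \<open>cpset B\<close> inside that of \<open>cpset A\<close>, so \<open>cpset B\<close> is one of
  the matrix convex sets over which \<sigma> is tested.\<close>

lemma sigma_setD:
  assumes A: "\<And>i. A i \<in> selfadjoint_ops" and B: "\<And>i. B i \<in> selfadjoint_ops"
    and rel: "pos_rel (op_form A) (op_form B)" and s: "s \<in> sigma_set A"
  shows "cp_rel (op_form A) (scale_form s (op_form B))"
proof (rule cp_rel_scale_op_form)
  show "B i \<in> bounded_ops" for i using B[of i] by (simp add: selfadjoint_ops_def)
  fix n Y assume n: "n > 0" and Y: "Y \<in> cpset B n"
  have carr: "Y i \<in> carrier_mat n n" for i using Y by (simp add: cpset_def)
  have "cpset B 1 \<subseteq> cpset A 1" by (rule cpset_level1_mono[of A B, OF A B rel])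
  then have "tuple_scale s Y \<in> cpset A n"
    using s n Y matrix_convex_cpset[of B, OF B] unfolding sigma_set_def by blast
  then have "cp_rel (op_form A) (mat_form n (tuple_scale s Y))" by (simp add: cpset_def)
  then show "cp_rel (op_form A) (scale_form s (mat_form n Y))"
    unfolding mat_form_tuple_scale[of Y, OF carr] .
qed

text \<open>The inclusion of first levels is reversed here, so \<open>cpset B\<close> is a
  competitor in the definition of \<rho>. The statement stops at matrix tuples, because the
  admissible scales depend on the level.\<close>

lemma rho_setD:
  assumes A: "\<And>i. A i \<in> selfadjoint_ops" and B: "\<And>i. B i \<in> selfadjoint_ops"
    and rel: "pos_rel (op_form B) (op_form A)" and s: "s \<in> rho_set A n" and Y: "Y \<in> cpset A n"
  shows "cp_rel (op_form B) (scale_form s (mat_form n Y))"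
proof -
  have carr: "Y i \<in> carrier_mat n n" for i using Y by (simp add: cpset_def)
  have "cpset A 1 \<subseteq> cpset B 1" by (rule cpset_level1_mono[of B A, OF B A rel])
  then have "tuple_scale s Y \<in> cpset B n"
    using s Y matrix_convex_cpset[of B, OF B] unfolding rho_set_def by blast
  then have "cp_rel (op_form B) (mat_form n (tuple_scale s Y))" by (simp add: cpset_def)
  then show ?thesis unfolding mat_form_tuple_scale[of Y, OF carr] .
qed

text \<open>A dilation with all points zero and the identity matrix as coefficients. It makes 0 an
  admissible scale, which the passage to the supremum needs.\<close>

lemma zero_mem_matrix_convex:
  fixes T :: "'d::finite graded_set"
  assumes T: "matrix_convex T" and z: "pt_mat 0 \<in> T 1" and n: "n > 0" and X: "\<And>i. X i \<in> carrier_mat n n"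
  shows "tuple_scale 0 X \<in> T n"
proof -
  have "(\<lambda>k. Matrix.mat n n (\<lambda>(i, j). \<Sum>m<n. of_real (vec_nth (0 :: real ^ 'd) k) *
      (if i = m then 1 else 0) * cnj (if j = m then 1 else 0))) \<in> T n"
  proof (rule dilation_in_matrix_convex[OF T n])
    fix i j assume "i < n" "j < n"
    have "(\<Sum>m<n. (if i = m then 1 else 0) * cnj (if j = m then 1 else 0))
        = (\<Sum>m<n. if m = i then (if i = j then 1 else 0) else (0 :: complex))"
      by (intro sum.cong refl) auto
    then show "(\<Sum>m<n. (if i = m then 1 else 0) * cnj (if j = m then 1 else 0))
        = (if i = j then 1 else (0 :: complex))" using \<open>i < n\<close> by simp
  qed (rule z)
  also have "(\<lambda>k. Matrix.mat n n (\<lambda>(i, j). \<Sum>m<n. of_real (vec_nth (0 :: real ^ 'd) k) *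
      (if i = m then 1 else 0) * cnj (if j = m then 1 else 0))) = tuple_scale 0 X"
    unfolding tuple_scale_def
    by (intro ext eq_matI) (auto simp: carrier_matD[OF X])
  finally show ?thesis .
qed

lemma zero_in_sigma_set:
  assumes A: "\<And>i. A i \<in> selfadjoint_ops" and z: "0 \<in> state_set (op_form A)"
  shows "0 \<in> sigma_set A"
proof -
  have "pt_mat 0 \<in> cpset A 1" unfolding cpset_level1[of A, OF A] using z by blast
  then have "tuple_scale 0 X \<in> cpset A n" if "matrix_convex T" "n > 0" "X \<in> T n" for T n X
    using matrix_convex_selfadjoint[OF that]
    by (intro zero_mem_matrix_convex matrix_convex_cpset[of A, OF A] that)
      (auto simp: selfadjoint_mats_def)
  then show ?thesis by (auto simp: sigma_set_def)
qed

lemma zero_in_rho_set: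
  assumes A: "\<And>i. A i \<in> selfadjoint_ops" and z: "0 \<in> state_set (op_form A)" and n: "n > 0"
  shows "0 \<in> rho_set A n"
proof -
  have "pt_mat 0 \<in> cpset A 1" unfolding cpset_level1[of A, OF A] using z by blast
  then have "tuple_scale 0 X \<in> T n" if "matrix_convex T" "cpset A 1 \<subseteq> T 1" "X \<in> cpset A n" for T X
    using that n by (intro zero_mem_matrix_convex) (auto simp: cpset_def)
  then show ?thesis by (auto simp: rho_set_def)
qed

text \<open>Serves finiteness of the constants: a nonzero self-adjoint operator has a nonzero value
  at some vector state.\<close>

lemma nonzero_state:
  fixes A :: "'d::finite \<Rightarrow> 'h::complex_hilbert \<Rightarrow>\<^sub>L 'h"
  assumes A: "\<And>i. A i \<in> selfadjoint_ops" and nz: "A i \<noteq> 0"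
  obtains x where "x \<in> state_set (op_form A)" "vec_nth x i \<noteq> 0"
proof -
  have "A i \<in> bounded_ops" using A[of i] by (simp add: selfadjoint_ops_def)
  then obtain v where v: "op_form A (Some i) v v \<noteq> 0"
    using op_eq_zero_if_quadratic_zero[of "A i"] nz by (auto simp: op_form_def)
  then have "v \<noteq> 0" by (auto simp: op_form_def)
  define u where "u = (1 / norm v) *\<^sub>R v"
  have u: "norm u = 1" using \<open>v \<noteq> 0\<close> by (simp add: u_def)
  have "op_form A (Some i) u u \<noteq> 0"
    unfolding u_def op_form_scaleR using v \<open>v \<noteq> 0\<close> by simp
  then have "Re (op_form A (Some i) u u) \<noteq> 0"
    using op_form_Some_Im[of A i u, OF A] by (simp add: complex_eq_iff)
  then show ?thesis using that[OF vector_state[of A u, OF A u]] by simp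
qed

lemma tuple_scale_pt_mat: "tuple_scale s (pt_mat x) = pt_mat (s *\<^sub>R x)"
  unfolding tuple_scale_def pt_mat_def by (intro ext eq_matI) auto

text \<open>Such scales map the bounded state set into itself, so a state with a nonzero coordinate
  bounds them all at once.\<close>

lemma scales_bounded:
  fixes A :: "'d::finite \<Rightarrow> 'h::complex_hilbert \<Rightarrow>\<^sub>L 'h"
  assumes A: "\<And>i. A i \<in> selfadjoint_ops" and x: "x \<in> state_set (op_form A)" "vec_nth x i \<noteq> 0"
    and R: "\<And>s. s \<in> R \<Longrightarrow> 0 \<le> s \<and> tuple_scale s ` cpset A 1 \<subseteq> cpset A 1"
  shows "Sup {ennreal s | s. s \<in> R} \<noteq> \<infinity>"
proof -
  have Ab: "A i \<in> bounded_ops" for i using A[of i] by (simp add: selfadjoint_ops_def)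
  have "s \<le> norm (A i) / \<bar>vec_nth x i\<bar>" if s: "s \<in> R" for s
  proof -
    have "tuple_scale s (pt_mat x) \<in> cpset A 1"
      using R[OF s] x(1) unfolding cpset_level1[of A, OF A] by blast
    then have "s *\<^sub>R x \<in> level1_real (cpset A)" by (simp add: tuple_scale_pt_mat level1_real_iff)
    then have "s *\<^sub>R x \<in> state_set (op_form A)" by (simp add: level1_real_cpset[of A, OF Ab])
    then have "\<bar>vec_nth (s *\<^sub>R x) i\<bar> \<le> norm (A i)" by (rule state_set_bound[of A, OF A])
    then show ?thesis using R[OF s] x(2) by (simp add: abs_mult field_simps)
  qed
  then have "Sup {ennreal s | s. s \<in> R} \<le> ennreal (norm (A i) / \<bar>vec_nth x i\<bar>)"
    by (intro Sup_least) (auto intro: ennreal_leI)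
  then show ?thesis using ennreal_less_top le_less_trans by (metis infinity_ennreal_def less_irrefl)
qed

lemma sigma_set_self:
  assumes A: "\<And>i. A i \<in> selfadjoint_ops" and s: "s \<in> sigma_set A"
  shows "0 \<le> s \<and> tuple_scale s ` cpset A 1 \<subseteq> cpset A 1"
  using s matrix_convex_cpset[of A, OF A] unfolding sigma_set_def by auto

lemma rho_set_self:
  assumes A: "\<And>i. A i \<in> selfadjoint_ops" and s: "s \<in> rho_set A 1"
  shows "0 \<le> s \<and> tuple_scale s ` cpset A 1 \<subseteq> cpset A 1"
  using s matrix_convex_cpset[of A, OF A] unfolding rho_set_def by auto

section \<open>Matrix tuples on \<open>ell2\<close> and optimality of \<sigma>\<close>

definition unit_ell2 :: "nat \<Rightarrow> ell2" where
  "unit_ell2 a = Abs_ell2 (\<lambda>m. if m = a then 1 else 0)"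

lemma Rep_unit_ell2: "Rep_ell2 (unit_ell2 a) m = (if m = a then 1 else 0)"
proof -
  have "summable (\<lambda>m. (cmod (if m = a then 1 else 0))\<^sup>2)"
    by (rule summable_finite[of "{a}"]) auto
  then show ?thesis by (simp add: unit_ell2_def Abs_ell2_inverse)
qed

lemma cinner_unit_ell2: "cinner (unit_ell2 a) f = Rep_ell2 f a"
  using suminf_finite[of "{a}" "\<lambda>n. cnj (Rep_ell2 (unit_ell2 a) n) * Rep_ell2 f n"]
  by (simp add: cinner_ell2.rep_eq Rep_unit_ell2)

lemma orthonormal_unit_ell2: "cinner (unit_ell2 a) (unit_ell2 b) = (if a = b then 1 else 0)"
  by (simp add: cinner_unit_ell2 Rep_unit_ell2)

text \<open>When the first \<open>n\<close> members of \<open>e\<close> are orthonormal, this acts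
  as \<open>M\<close> on their span and as zero on the orthogonal complement.\<close>

definition mat_op :: "nat \<Rightarrow> (nat \<Rightarrow> 'h::complex_hilbert) \<Rightarrow> complex mat \<Rightarrow> 'h \<Rightarrow>\<^sub>L 'h" where
  "mat_op n e M = Blinfun (\<lambda>f. \<Sum>a<n. \<Sum>b<n. (M $$ (a, b) * cinner (e b) f) *\<^sub>C e a)"

lemma mat_op_apply:
  "blinfun_apply (mat_op n e M) f = (\<Sum>a<n. \<Sum>b<n. (M $$ (a, b) * cinner (e b) f) *\<^sub>C e a)"
proof -
  have "bounded_linear (\<lambda>f. (M $$ (a, b) * cinner (e b) f) *\<^sub>C e a)" for a b
  proof (rule bounded_linear_intro[where K = "cmod (M $$ (a, b)) * norm (e b) * norm (e a)"])
    show "(M $$ (a, b) * cinner (e b) (r *\<^sub>R f)) *\<^sub>C e a = r *\<^sub>R (M $$ (a, b) * cinner (e b) f) *\<^sub>C e a"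
      for r f
      unfolding cinner_scaleR_right unfolding scaleC_of_real[symmetric] scaleC_scaleC
      by (simp only: mult_ac)
    show "norm ((M $$ (a, b) * cinner (e b) f) *\<^sub>C e a)
        \<le> norm f * (cmod (M $$ (a, b)) * norm (e b) * norm (e a))" for f
    proof -
      have "cmod (M $$ (a, b)) * cmod (cinner (e b) f) * norm (e a)
          \<le> cmod (M $$ (a, b)) * (norm (e b) * norm f) * norm (e a)"
        by (intro mult_right_mono mult_left_mono norm_cinner_le) simp_all
      then show ?thesis by (simp add: norm_scaleC norm_mult mult_ac)
    qed
  qed (simp add: cinner_add_right distrib_left scaleC_add_left)
  then have "bounded_linear (\<lambda>f. \<Sum>a<n. \<Sum>b<n. (M $$ (a, b) * cinner (e b) f) *\<^sub>C e a)"
    by (intro bounded_linear_sum)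
  then show ?thesis unfolding mat_op_def by (simp add: bounded_linear_Blinfun_apply)
qed

lemma cinner_mat_op:
  "cinner x (blinfun_apply (mat_op n e M) y) = (\<Sum>a<n. \<Sum>b<n. cnj (cinner (e a) x) * M $$ (a, b) * cinner (e b) y)"
  unfolding mat_op_apply cinner_sum_right cinner_scaleC_right
  by (intro sum.cong refl) (simp add: mult_ac flip: cinner_commute)

lemma mat_op_selfadjoint:
  assumes M: "M \<in> selfadjoint_mats n"
  shows "mat_op n e M \<in> selfadjoint_ops"
proof -
  have "mat_op n e M \<in> bounded_ops"
    by (simp add: bounded_ops_def mat_op_apply cinner_scaleC_right scaleC_sum_right scaleC_scaleC mult_ac)
  moreover have "cinner (blinfun_apply (mat_op n e M) x) y = cinner x (blinfun_apply (mat_op n e M) y)" for x y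
  proof -
    have "cinner (blinfun_apply (mat_op n e M) x) y = cnj (cinner y (blinfun_apply (mat_op n e M) x))"
      by (rule cinner_commute)
    also have "\<dots> = (\<Sum>a<n. \<Sum>b<n. cnj (cinner (e b) x) * M $$ (b, a) * cinner (e a) y)"
      unfolding cinner_mat_op cnj_sum
    proof (intro sum.cong refl)
      fix a b assume "a \<in> {..<n}" "b \<in> {..<n}"
      then have "M $$ (b, a) = cnj (M $$ (a, b))" using M unfolding selfadjoint_mats_iff by blast
      then show "cnj (cnj (cinner (e a) y) * M $$ (a, b) * cinner (e b) x)
          = cnj (cinner (e b) x) * M $$ (b, a) * cinner (e a) y" by simp
    qed
    also have "\<dots> = cinner x (blinfun_apply (mat_op n e M) y)"
      unfolding cinner_mat_op by (rule sum.swap)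
    finally show ?thesis .
  qed
  ultimately show ?thesis by (simp add: selfadjoint_ops_def is_adjoint_def)
qed

lemma bessel_inequality:
  fixes e :: "nat \<Rightarrow> 'h::complex_hilbert"
  assumes on: "\<And>a b. a < n \<Longrightarrow> b < n \<Longrightarrow> cinner (e a) (e b) = (if a = b then 1 else 0)"
  shows "0 \<le> cinner x x - (\<Sum>a<n. cnj (cinner (e a) x) * cinner (e a) x)"
proof -
  define v where "v a = cinner (e a) x" for a
  define r where "r = x - (\<Sum>a<n. v a *\<^sub>C e a)"
  have orth: "cinner (e b) r = 0" if "b < n" for b
    unfolding r_def v_def by (rule orthonormal_residual[OF on that])
  have "cinner (\<Sum>a<n. v a *\<^sub>C e a) r = 0"
    by (simp add: cinner_sum_left cinner_scaleC_left orth)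
  moreover have "cinner x r = cinner (r + (\<Sum>a<n. v a *\<^sub>C e a)) r"
    by (rule arg_cong[where f = "\<lambda>u. cinner u r"]) (simp add: r_def)
  ultimately have "cinner r r = cinner x r" by (simp add: cinner_add_left)
  also have "cinner x r = cinner x x - (\<Sum>a<n. v a * cinner x (e a))"
    by (simp add: r_def cinner_diff_right cinner_sum_right cinner_scaleC_right)
  also have "(\<Sum>a<n. v a * cinner x (e a)) = (\<Sum>a<n. cnj (cinner (e a) x) * cinner (e a) x)"
    by (intro sum.cong refl) (simp add: v_def mult.commute flip: cinner_commute)
  finally show ?thesis using cinner_self_nonneg[of r] by simp
qed

lemma mat_form_None: "mat_form n X None v w = (\<Sum>a<n. cnj (v a) * w a)"
  unfolding mat_form_def
proof (intro sum.cong refl)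
  fix a assume a: "a \<in> {..<n}"
  have "(\<Sum>b<n. cnj (v a) * ent X None a b * w b) = (\<Sum>b<n. if b = a then cnj (v a) * w a else 0)"
    by (intro sum.cong refl) auto
  then show "(\<Sum>b<n. cnj (v a) * ent X None a b * w b) = cnj (v a) * w a" using a by simp
qed

text \<open>The tuple \<open>B\<close> extends \<open>X\<close> by zero. The assumed complete
  positivity for \<open>B\<close>, followed by compression back to the corner, is membership of the
  scaled \<open>X\<close> in \<open>cpset A\<close>.\<close>

lemma sigma_optimal:
  fixes A :: "'d::finite \<Rightarrow> 'h::complex_hilbert \<Rightarrow>\<^sub>L 'h"
  assumes A: "\<And>i. A i \<in> selfadjoint_ops" and z: "0 \<in> state_set (op_form A)" and c: "c \<ge> 0"
    and H: "\<And>B :: 'd \<Rightarrow> ell2 \<Rightarrow>\<^sub>L ell2. (\<And>i. B i \<in> selfadjoint_ops) \<Longrightarrow>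
      pos_rel (op_form A) (op_form B) \<Longrightarrow> cp_rel (op_form A) (scale_form c (op_form B))"
  shows "c \<in> sigma_set A"
proof -
  have Ab: "A i \<in> bounded_ops" for i using A[of i] by (simp add: selfadjoint_ops_def)
  have "tuple_scale c X \<in> cpset A n"
    if T: "matrix_convex T" "T 1 \<subseteq> cpset A 1" and n: "n > 0" and X: "X \<in> T n" for T n X
  proof -
    have sa: "X i \<in> selfadjoint_mats n" for i by (rule matrix_convex_selfadjoint[OF T(1) n X])
    have carr: "X i \<in> carrier_mat n n" for i using sa[of i] by (simp add: selfadjoint_mats_def)
    have T1: "level1_real T \<subseteq> state_set (op_form A)"
      using T(2) unfolding level1_real_cpset[of A, OF Ab, symmetric] level1_real_def by blast
    define B where "B i = mat_op n unit_ell2 (X i)" for i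
    have Bsa: "B i \<in> selfadjoint_ops" for i unfolding B_def by (rule mat_op_selfadjoint[OF sa])
    have Bb: "B i \<in> bounded_ops" for i using Bsa[of i] by (simp add: selfadjoint_ops_def)
    have B_Some: "op_form B (Some i) x y = mat_form n X (Some i)
        (\<lambda>a. cinner (unit_ell2 a) x) (\<lambda>a. cinner (unit_ell2 a) y)" for i x y
      by (simp add: op_form_def B_def cinner_mat_op mat_form_def)
    have "pos_rel (op_form A) (op_form B)"
      unfolding pos_rel_def
    proof (intro allI impI)
      fix d x assume d: "\<forall>v. 0 \<le> (\<Sum>k\<in>UNIV. d k * op_form A k v v)"
      let ?v = "\<lambda>a. cinner (unit_ell2 a) x"
      have pt: "0 \<le> (\<Sum>k\<in>UNIV. d k * pt y k)" if "y \<in> state_set (op_form A)" for y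
        by (rule state_setD[OF that]) (use d in blast)
      \<comment> \<open>The component of \<open>x\<close> outside the corner contributes its squared
        norm times the coefficient of the unit, which is nonnegative because the origin is a state
        of \<open>A\<close>. Bessel's inequality supplies the other factor.\<close>
      have "0 \<le> d None" using pt[OF z] by (simp add: sum_option)
      then have "0 \<le> d None * (cinner x x - (\<Sum>a<n. cnj (?v a) * ?v a))"
        by (intro mult_nonneg_nonneg bessel_inequality) (simp_all add: orthonormal_unit_ell2)
      moreover have "0 \<le> (\<Sum>k\<in>UNIV. d k * mat_form n X k ?v ?v)"
        by (rule mat_form_pos_if_level1[OF T(1) n X]) (use pt T1 in blast)
      ultimately have "0 \<le> d None * (cinner x x - (\<Sum>a<n. cnj (?v a) * ?v a))
          + (\<Sum>k\<in>UNIV. d k * mat_form n X k ?v ?v)" by (rule add_nonneg_nonneg)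
      also have "\<dots> = (\<Sum>k\<in>UNIV. d k * op_form B k x x)"
        unfolding sum_option mat_form_None B_Some[symmetric]
        by (simp add: op_form_def algebra_simps)
      finally show "0 \<le> (\<Sum>k\<in>UNIV. d k * op_form B k x x)" .
    qed
    then have cp: "cp_rel (op_form A) (scale_form c (op_form B))" by (rule H[OF Bsa])
    \<comment> \<open>Compression to the first \<open>n\<close> basis vectors recovers
      \<open>X\<close> from \<open>B\<close>.\<close>
    have "cp_rel (op_form B) (mat_form n X)"
      unfolding cp_rel_def
    proof (intro allI impI)
      fix q d assume posB: "form_pos (op_form B) q d"
      have ent: "X i $$ (a, b) = op_form B (Some i) (unit_ell2 a) (unit_ell2 b)" if "a < n" "b < n" for i a b
      proof -
        have "mat_form n X (Some i) (\<lambda>e. cinner (unit_ell2 e) (unit_ell2 a)) (\<lambda>e. cinner (unit_ell2 e) (unit_ell2 b))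
            = ent X (Some i) a b"
          unfolding orthonormal_unit_ell2 by (rule mat_form_basis[OF that])
        then show ?thesis unfolding B_Some by simp
      qed
      have comp: "op_form B k (\<Sum>a<n. v a *\<^sub>C unit_ell2 a) (\<Sum>b<n. w b *\<^sub>C unit_ell2 b) = mat_form n X k v w"
        for k v w
        by (rule op_form_compression[of B, OF Bb orthonormal_unit_ell2 ent])
      show "form_pos (mat_form n X) q d"
        unfolding form_pos_def comp[symmetric]
      proof
        fix y :: "nat \<Rightarrow> nat \<Rightarrow> complex"
        from posB[unfolded form_pos_def, rule_format, of "\<lambda>i. \<Sum>a<n. y i a *\<^sub>C unit_ell2 a"]
        show "0 \<le> (\<Sum>i<q. \<Sum>j<q. \<Sum>k\<in>UNIV. d k i j *
            op_form B k (\<Sum>a<n. y i a *\<^sub>C unit_ell2 a) (\<Sum>b<n. y j b *\<^sub>C unit_ell2 b))" .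
      qed
    qed
    then have "cp_rel (op_form A) (mat_form n (tuple_scale c X))"
      unfolding mat_form_tuple_scale[of X, OF carr] by (rule cp_rel_scale_trans[OF cp])
    moreover have "tuple_scale c X i \<in> carrier_mat n n" for i using carr by (simp add: tuple_scale_def)
    ultimately show ?thesis by (simp add: cpset_def)
  qed
  then show ?thesis using c by (auto simp: sigma_set_def simp del: One_nat_def)
qed

section \<open>Diagonal operators and optimality of \<rho>\<close>

definition diag_op :: "(nat \<Rightarrow> real) \<Rightarrow> ell2 \<Rightarrow>\<^sub>L ell2" where
  "diag_op d = Blinfun (\<lambda>f. Abs_ell2 (\<lambda>m. of_real (d m) * Rep_ell2 f m))"

text \<open>The bound on \<open>d\<close> keeps the product sequence square summable, so that
  \<open>Abs_ell2\<close> is applied inside its domain, and it also bounds the operator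
  norm.\<close>

lemma Rep_diag_op:
  assumes d: "\<And>m. \<bar>d m\<bar> \<le> M"
  shows "Rep_ell2 (blinfun_apply (diag_op d) f) m = of_real (d m) * Rep_ell2 f m"
proof -
  have M: "M \<ge> 0" using d[of 0] by linarith
  have "summable (\<lambda>m. (cmod (of_real (d m) * Rep_ell2 f m))\<^sup>2)" for f
  proof (rule summable_comparison_test')
    show "summable (\<lambda>m. M\<^sup>2 * (cmod (Rep_ell2 f m))\<^sup>2)"
      by (intro summable_mult Rep_ell2_summable)
    fix m
    have "(d m)\<^sup>2 \<le> M\<^sup>2" using power_mono[OF d[of m] abs_ge_zero, of 2] by simp
    then show "norm ((cmod (of_real (d m) * Rep_ell2 f m))\<^sup>2) \<le> M\<^sup>2 * (cmod (Rep_ell2 f m))\<^sup>2"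
      by (simp add: norm_mult power_mult_distrib mult_right_mono)
  qed
  then have rep: "Rep_ell2 (Abs_ell2 (\<lambda>m. of_real (d m) * Rep_ell2 f m)) = (\<lambda>m. of_real (d m) * Rep_ell2 f m)"
    for f by (simp add: Abs_ell2_inverse)
  have "bounded_linear (\<lambda>f. Abs_ell2 (\<lambda>m. of_real (d m) * Rep_ell2 f m))"
  proof (rule bounded_linear_intro[where K = M])
    fix f g :: ell2 and r :: real
    show "Abs_ell2 (\<lambda>m. of_real (d m) * Rep_ell2 (f + g) m)
        = Abs_ell2 (\<lambda>m. of_real (d m) * Rep_ell2 f m) + Abs_ell2 (\<lambda>m. of_real (d m) * Rep_ell2 g m)"
      by (subst Rep_ell2_inject[symmetric], simp only: rep)
        (simp add: plus_ell2.rep_eq rep distrib_left)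
    show "Abs_ell2 (\<lambda>m. of_real (d m) * Rep_ell2 (r *\<^sub>R f) m)
        = r *\<^sub>R Abs_ell2 (\<lambda>m. of_real (d m) * Rep_ell2 f m)"
      by (subst Rep_ell2_inject[symmetric], simp only: rep)
        (simp add: scaleR_ell2.rep_eq rep mult.left_commute)
    show "norm (Abs_ell2 (\<lambda>m. of_real (d m) * Rep_ell2 f m)) \<le> norm f * M"
    proof (rule ell2_norm_le)
      fix k
      have "L2_set (\<lambda>m. cmod (Rep_ell2 (Abs_ell2 (\<lambda>m. of_real (d m) * Rep_ell2 f m)) m)) {..<k}
          \<le> L2_set (\<lambda>m. M * cmod (Rep_ell2 f m)) {..<k}"
        unfolding rep by (intro L2_set_mono) (auto simp: norm_mult intro!: mult_right_mono d)
      also have "\<dots> = M * L2_set (\<lambda>m. cmod (Rep_ell2 f m)) {..<k}"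
        using M by (simp add: L2_set_right_distrib)
      also have "\<dots> \<le> M * norm f" using M by (intro mult_left_mono ell2_L2_set_le)
      finally show "L2_set (\<lambda>m. cmod (Rep_ell2 (Abs_ell2 (\<lambda>m. of_real (d m) * Rep_ell2 f m)) m)) {..<k}
          \<le> norm f * M" by (simp add: mult.commute)
    qed
  qed
  then show ?thesis by (simp add: diag_op_def bounded_linear_Blinfun_apply rep)
qed

lemma diag_op_selfadjoint:
  assumes d: "\<And>m. \<bar>d m\<bar> \<le> M"
  shows "diag_op d \<in> selfadjoint_ops"
proof -
  note rep = Rep_diag_op[of d, OF d]
  have "diag_op d \<in> bounded_ops"
    unfolding bounded_ops_def
    by (auto simp: rep scaleC_ell2.rep_eq fun_eq_iff simp flip: Rep_ell2_inject)
  moreover have "cinner (blinfun_apply (diag_op d) x) y = cinner x (blinfun_apply (diag_op d) y)" for x y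
    by (simp add: cinner_ell2.rep_eq rep mult_ac)
  ultimately show ?thesis by (simp add: selfadjoint_ops_def is_adjoint_def)
qed

lemma op_form_diag_op:
  assumes \<xi>: "\<And>i m. \<bar>vec_nth (\<xi> m) i\<bar> \<le> M i"
  shows "(\<lambda>m. pt (\<xi> m) k * (cnj (Rep_ell2 x m) * Rep_ell2 y m))
    sums op_form (\<lambda>i. diag_op (\<lambda>m. vec_nth (\<xi> m) i)) k x y"
proof -
  have inner: "(\<lambda>m. cnj (Rep_ell2 u m) * Rep_ell2 v m) sums cinner u v" for u v
    unfolding cinner_ell2.rep_eq by (intro summable_sums ell2_inner_summable Rep_ell2_summable)
  show ?thesis
  proof (cases k)
    case None
    then show ?thesis using inner[of x y] by (simp add: op_form_def)
  next
    case (Some i)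
    have rep: "Rep_ell2 (blinfun_apply (diag_op (\<lambda>m. vec_nth (\<xi> m) i)) y) m
        = of_real (vec_nth (\<xi> m) i) * Rep_ell2 y m" for m
      by (rule Rep_diag_op) (rule \<xi>)
    show ?thesis
      using inner[of x "blinfun_apply (diag_op (\<lambda>m. vec_nth (\<xi> m) i)) y"] Some
      by (simp add: op_form_def rep mult_ac)
  qed
qed

lemma rho_optimal:
  fixes A :: "'d::finite \<Rightarrow> 'h::complex_hilbert \<Rightarrow>\<^sub>L 'h"
  assumes A: "\<And>i. A i \<in> selfadjoint_ops" and z: "0 \<in> state_set (op_form A)" and c: "c \<ge> 0" and n: "n > 0"
    and H: "\<And>B :: 'd \<Rightarrow> ell2 \<Rightarrow>\<^sub>L ell2. (\<And>i. B i \<in> selfadjoint_ops) \<Longrightarrow>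
      pos_rel (op_form B) (op_form A) \<Longrightarrow> cp_rel (op_form B) (scale_form c (op_form A))"
  shows "c \<in> rho_set A n"
proof -
  have Ab: "A i \<in> bounded_ops" for i using A[of i] by (simp add: selfadjoint_ops_def)
  define K where "K = state_set (op_form A)"
  obtain D where D: "countable D" "D \<subseteq> K" "K \<subseteq> closure D" using separable[of K] by blast
  have "D \<noteq> {}" using D(3) z by (auto simp: K_def)
  \<comment> \<open>When \<open>D\<close> is finite its points are repeated along the
    sequence.\<close>
  define \<xi> where "\<xi> = from_nat_into D"
  have range: "range \<xi> = D" unfolding \<xi>_def by (rule range_from_nat_into[OF \<open>D \<noteq> {}\<close> D(1)])
  have \<xi>K: "\<xi> m \<in> K" for m using range D(2) by blast
  have \<xi>b: "\<bar>vec_nth (\<xi> m) i\<bar> \<le> norm (A i)" for m i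
    using \<xi>K[of m] unfolding K_def by (rule state_set_bound[of A, OF A])
  define B where "B i = diag_op (\<lambda>m. vec_nth (\<xi> m) i)" for i
  have Bsa: "B i \<in> selfadjoint_ops" for i unfolding B_def by (rule diag_op_selfadjoint) (rule \<xi>b)
  have Bsums: "(\<lambda>m. pt (\<xi> m) k * (cnj (Rep_ell2 x m) * Rep_ell2 y m)) sums op_form B k x y" for k x y
    unfolding B_def by (rule op_form_diag_op) (rule \<xi>b)
  have Bunit: "op_form B k (unit_ell2 m) (unit_ell2 m) = pt (\<xi> m) k" for k m
  proof -
    have "(\<lambda>l. pt (\<xi> l) k * (cnj (Rep_ell2 (unit_ell2 m) l) * Rep_ell2 (unit_ell2 m) l))
        = (\<lambda>l. if l = m then pt (\<xi> l) k else 0)" by (auto simp: Rep_unit_ell2)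
    then show ?thesis
      using Bsums[of k "unit_ell2 m" "unit_ell2 m"] sums_single[of m "\<lambda>l. pt (\<xi> l) k"]
      by (simp add: sums_unique2)
  qed
  \<comment> \<open>The basis vectors of \<open>ell2\<close> evaluate a functional at every point of
    \<open>D\<close>; nonnegativity is a closed condition and therefore extends to the whole state
    set.\<close>
  have "pos_rel (op_form B) (op_form A)"
  proof (rule pos_rel_op_form_if_states[OF A])
    fix d and x :: "real ^ 'd"
    assume d: "\<forall>v. 0 \<le> (\<Sum>k\<in>UNIV. d k * op_form B k v v)" and x: "x \<in> state_set (op_form A)"
    have cont: "continuous_on UNIV (\<lambda>x :: real ^ 'd. pt x k)" for k
      by (cases k) (auto intro!: continuous_intros)
    have "closed {x. 0 \<le> (\<Sum>k\<in>UNIV. d k * pt x k)}"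
      by (intro closed_Collect_nonneg_complex continuous_intros cont)
    moreover have "D \<subseteq> {x. 0 \<le> (\<Sum>k\<in>UNIV. d k * pt x k)}"
    proof -
      have "0 \<le> (\<Sum>k\<in>UNIV. d k * pt (\<xi> m) k)" for m
        using d[rule_format, of "unit_ell2 m"] by (simp add: Bunit)
      then show ?thesis unfolding range[symmetric] by blast
    qed
    ultimately have "closure D \<subseteq> {x. 0 \<le> (\<Sum>k\<in>UNIV. d k * pt x k)}" by (rule closure_minimal[rotated])
    then show "0 \<le> (\<Sum>k\<in>UNIV. d k * pt x k)" using x D(3) by (auto simp: K_def)
  qed
  then have cp: "cp_rel (op_form B) (scale_form c (op_form A))" by (rule H[OF Bsa])
  have "tuple_scale c X \<in> T n"
    if T: "matrix_convex T" "cpset A 1 \<subseteq> T 1" and X: "X \<in> cpset A n" for T X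
  proof (rule mem_matrix_convex_if_functionals[OF T(1) _ _ _ n])
    have sa: "X i \<in> selfadjoint_mats n" for i by (rule cpset_selfadjoint[of A, OF A X])
    have carr: "X i \<in> carrier_mat n n" for i using sa[of i] by (simp add: selfadjoint_mats_def)
    show "tuple_scale c X i \<in> selfadjoint_mats n" for i by (rule tuple_scale_selfadjoint[OF sa])
    show "K \<subseteq> level1_real T"
      using T(2) unfolding K_def level1_real_cpset[of A, OF Ab, symmetric] level1_real_def by blast
    show "compact K" unfolding K_def by (rule compact_state_set[of A, OF A])
    show "K \<noteq> {}" using z by (auto simp: K_def)
    fix d assume d: "\<And>x v. x \<in> K \<Longrightarrow>
        0 \<le> (\<Sum>i<n. \<Sum>j<n. \<Sum>k\<in>UNIV. d k i j * (pt x k * (cnj (v i) * v j)))"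
    \<comment> \<open>The form at \<open>y\<close> is a convergent series whose term of index
      \<open>m\<close> is the functional \<open>d\<close> at the point \<open>\<xi> m\<close> and
      the vector of \<open>m\<close>-th coordinates of the \<open>y i\<close>, so every partial sum
      is nonnegative.\<close>
    have "form_pos (op_form B) n d"
      unfolding form_pos_def
    proof
      fix y :: "nat \<Rightarrow> ell2"
      let ?f = "\<lambda>m. \<Sum>i<n. \<Sum>j<n. \<Sum>k\<in>UNIV. d k i j * (pt (\<xi> m) k * (cnj (Rep_ell2 (y i) m) * Rep_ell2 (y j) m))"
      have "?f sums (\<Sum>i<n. \<Sum>j<n. \<Sum>k\<in>UNIV. d k i j * op_form B k (y i) (y j))"
        by (intro sums_sum sums_mult Bsums)
      moreover have "0 \<le> (\<Sum>m<N. ?f m)" for N by (intro sum_nonneg d \<xi>K)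
      moreover have "closed {w :: complex. 0 \<le> w}" by (rule closed_Collect_nonneg_complex) (rule continuous_on_id)
      ultimately show "0 \<le> (\<Sum>i<n. \<Sum>j<n. \<Sum>k\<in>UNIV. d k i j * op_form B k (y i) (y j))"
        unfolding sums_def using closed_sequentially[of "{w :: complex. 0 \<le> w}" "\<lambda>N. \<Sum>m<N. ?f m"] by simp
    qed
    moreover have "cp_rel (op_form B) (mat_form n (tuple_scale c X))"
      unfolding mat_form_tuple_scale[of X, OF carr]
      using X by (intro cp_rel_scale_trans[OF cp]) (simp add: cpset_def)
    ultimately have "form_pos (mat_form n (tuple_scale c X)) n d" by (simp add: cp_rel_def)
    then have "0 \<le> (\<Sum>i<n. \<Sum>j<n. \<Sum>k\<in>UNIV. d k i j *
        mat_form n (tuple_scale c X) k (\<lambda>a. if a = i then 1 else 0) (\<lambda>a. if a = j then 1 else 0))"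
      unfolding form_pos_def by (rule spec)
    also have "\<dots> = (\<Sum>i<n. \<Sum>j<n. \<Sum>k\<in>UNIV. d k i j * ent (tuple_scale c X) k i j)"
      by (intro sum.cong refl) (simp add: mat_form_basis)
    finally show "0 \<le> (\<Sum>i<n. \<Sum>j<n. \<Sum>k\<in>UNIV. d k i j * ent (tuple_scale c X) k i j)" .
  qed
  then show ?thesis using c by (auto simp: rho_set_def simp del: One_nat_def)
qed

section \<open>Lower bounds from rank one matrices\<close>

lemma rank_one_lower_bound:
  fixes A :: "'d::finite \<Rightarrow> 'h::complex_hilbert \<Rightarrow>\<^sub>L 'h" and u w :: "'m \<Rightarrow> real ^ 'd"
  assumes A: "\<And>i. A i \<in> selfadjoint_ops" and z: "0 \<in> state_set (op_form A)"
    and C: "C > 0" and M: "finite M" and t: "\<And>m. m \<in> M \<Longrightarrow> 0 \<le> t m" "sum t M = 1"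
    and id: "\<And>a b. (\<Sum>m\<in>M. t m * (vec_nth (u m) a * vec_nth (w m) b)) = (if a = b then 1 else 0)"
    and inv: "\<And>m x. m \<in> M \<Longrightarrow> x \<in> state_set (op_form A) \<Longrightarrow>
      (inner (w m) x / C) *\<^sub>R u m \<in> state_set (op_form A)"
  shows "1 / C \<in> sigma_set A" "n > 0 \<Longrightarrow> 1 / C \<in> rho_set A n"
proof -
  have Ab: "A i \<in> bounded_ops" for i using A[of i] by (simp add: selfadjoint_ops_def)
  note lev = level1_real_cpset[of A, OF Ab]
  have ne: "state_set (op_form A) \<noteq> {}" using z by blast
  have scale: "tuple_scale (1 / C) X \<in> T' n"
    if "matrix_convex T" "level1_real T \<subseteq> state_set (op_form A)"
      "matrix_convex T'" "state_set (op_form A) \<subseteq> level1_real T'" "n > 0" "X \<in> T n" for T T' n X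
    by (rule rank_one_scaling[OF that(1-4) compact_state_set[of A, OF A] ne that(5,6) C M t id inv])
  have "tuple_scale (1 / C) X \<in> cpset A n"
    if "matrix_convex T" "T 1 \<subseteq> cpset A 1" "n > 0" "X \<in> T n" for T n X
  proof (rule scale[of T])
    show "level1_real T \<subseteq> state_set (op_form A)"
      using that(2) unfolding lev[symmetric] level1_real_def by blast
  qed (use that lev matrix_convex_cpset[of A, OF A] in auto)
  then show "1 / C \<in> sigma_set A" using C by (auto simp: sigma_set_def simp del: One_nat_def)
  have "tuple_scale (1 / C) X \<in> T n"
    if "matrix_convex T" "cpset A 1 \<subseteq> T 1" "X \<in> cpset A n" "n > 0" for T X
  proof (rule scale[of "cpset A"])
    show "state_set (op_form A) \<subseteq> level1_real T"
      using that(2) unfolding lev[symmetric] level1_real_def by blast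
  qed (use that lev matrix_convex_cpset[of A, OF A] in auto)
  then show "n > 0 \<Longrightarrow> 1 / C \<in> rho_set A n" using C by (auto simp: rho_set_def simp del: One_nat_def)
qed

section \<open>From admissible scales to the constants\<close>

lemma scaleR_bounded_ops: "T \<in> bounded_ops \<Longrightarrow> r *\<^sub>R T \<in> bounded_ops"
  by (simp add: bounded_ops_def blinfun.scaleR_left scaleC_scaleC mult.commute flip: scaleC_of_real)

lemma sigma_const_eq:
  assumes "\<forall>n>0. S n = cpset A n"
  shows "sigma_const S = Sup {ennreal s | s. s \<in> sigma_set A}"
proof -
  have "(0 \<le> s \<and> (\<forall>T. matrix_convex T \<and> T 1 \<subseteq> S 1 \<longrightarrow> (\<forall>n>0. tuple_scale s ` T n \<subseteq> S n)))
      \<longleftrightarrow> s \<in> sigma_set A" for s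
    using assms by (simp add: sigma_set_def)
  then show ?thesis unfolding sigma_const_def by simp
qed

lemma rho_level_eq:
  assumes "\<forall>n>0. S n = cpset A n" and n: "n > 0"
  shows "rho_level S n = Sup {ennreal s | s. s \<in> rho_set A n}"
proof -
  have "(0 \<le> t \<and> (\<forall>T. matrix_convex T \<and> S 1 \<subseteq> T 1 \<longrightarrow> tuple_scale t ` S n \<subseteq> T n))
      \<longleftrightarrow> t \<in> rho_set A n" for t
    using assms by (simp add: rho_set_def)
  then show ?thesis unfolding rho_level_def by simp
qed

lemma sigma_const_ge:
  assumes "\<forall>n>0. S n = cpset A n" "s \<in> sigma_set A"
  shows "ennreal s \<le> sigma_const S"
  unfolding sigma_const_eq[of S A, OF assms(1)] by (rule Sup_upper) (use assms(2) in blast)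

lemma rho_const_ge:
  assumes S: "\<forall>n>0. S n = cpset A n" and t: "\<And>n. n > 0 \<Longrightarrow> t \<in> rho_set A n"
  shows "ennreal t \<le> rho_const S"
  unfolding rho_const_def
proof (rule INF_greatest)
  fix n :: nat assume "n \<in> {0<..}"
  then have n: "n > 0" by simp
  show "ennreal t \<le> rho_level S n"
    unfolding rho_level_eq[of S A, OF S n] by (rule Sup_upper) (use t[OF n] in blast)
qed

lemma rank_one_const_bounds:
  fixes A :: "'d::finite \<Rightarrow> 'h::complex_hilbert \<Rightarrow>\<^sub>L 'h" and u w :: "'m \<Rightarrow> real ^ 'd"
  assumes S: "\<forall>n>0. S n = cpset A n"
    and A: "\<And>i. A i \<in> selfadjoint_ops" and z: "0 \<in> state_set (op_form A)"
    and C: "C > 0" and M: "finite M" and t: "\<And>m. m \<in> M \<Longrightarrow> 0 \<le> t m" "sum t M = 1"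
    and id: "\<And>a b. (\<Sum>m\<in>M. t m * (vec_nth (u m) a * vec_nth (w m) b)) = (if a = b then 1 else 0)"
    and inv: "\<And>m x. m \<in> M \<Longrightarrow> x \<in> state_set (op_form A) \<Longrightarrow>
      (inner (w m) x / C) *\<^sub>R u m \<in> state_set (op_form A)"
  shows "ennreal (1 / C) \<le> rho_const S \<and> ennreal (1 / C) \<le> sigma_const S"
proof
  show "ennreal (1 / C) \<le> rho_const S"
    using rank_one_lower_bound(2)[of A, OF A z C M t id inv] by (intro rho_const_ge[OF S])
  show "ennreal (1 / C) \<le> sigma_const S"
    by (intro sigma_const_ge[OF S] rank_one_lower_bound(1)[of A, OF A z C M t id inv])
qed

text \<open>All columns lie in the one-dimensional range, hence are multiples of one vector
  \<open>p\<close>; the multipliers form \<open>q\<close>.\<close>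

lemma rank_one_factorization:
  fixes L :: "real ^ 'n::finite ^ 'm::finite"
  assumes "rank L = 1"
  shows "\<exists>p q. \<forall>a b. vec_nth (vec_nth L a) b = vec_nth p a * vec_nth q b"
proof -
  let ?V = "range ((*v) L)"
  obtain B where B: "B \<subseteq> ?V" "independent B" "?V \<subseteq> span B" "card B = dim ?V"
    using basis_exists[of ?V] by metis
  have "card B = 1" using B(4) assms by (simp add: rank_dim_range)
  then obtain p where "B = {p}" using card_1_singletonE by blast
  then have "column b L \<in> span {p}" for b
    using B(3) by (metis matrix_vector_mult_basis rangeI subsetD)
  then have "\<forall>b. \<exists>s. column b L = s *\<^sub>R p" by (auto simp: span_singleton)
  then obtain s where s: "\<And>b. column b L = s b *\<^sub>R p" by metis
  have "vec_nth (vec_nth L a) b = vec_nth p a * vec_nth (\<chi> b. s b) b" for a b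
    using arg_cong[OF s[of b], of "\<lambda>v. vec_nth v a"] by (simp add: column_def mult.commute)
  then show ?thesis by blast
qed

theorem theorem10p4:
  fixes A :: "'d::finite \<Rightarrow> 'h::complex_hilbert \<Rightarrow>\<^sub>L 'h"
    and S :: "'d graded_set"
  assumes A: "\<And>i. A i \<in> selfadjoint_ops"
    and S: "S = matrix_range A"
    and zero: "\<exists>n>0. (\<lambda>i. 0\<^sub>m n n) \<in> S n"
  shows
    "(\<forall>B :: 'd \<Rightarrow> 'k::complex_hilbert \<Rightarrow>\<^sub>L 'k.
        (\<forall>i. B i \<in> selfadjoint_ops) \<longrightarrow> positive_assignment A B \<longrightarrow>
        cp_assignment A (\<lambda>i. ext_scale (sigma_const S) (B i)))
     \<and> (\<forall>c::real. c \<ge> 0 \<longrightarrow>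
        (\<forall>B :: 'd \<Rightarrow> ell2 \<Rightarrow>\<^sub>L ell2.
           (\<forall>i. B i \<in> selfadjoint_ops) \<longrightarrow> positive_assignment A B \<longrightarrow>
           cp_assignment A (\<lambda>i. c *\<^sub>R B i)) \<longrightarrow>
        ennreal c \<le> sigma_const S)
     \<and> (\<forall>B :: 'd \<Rightarrow> 'k \<Rightarrow>\<^sub>L 'k.
        (\<forall>i. B i \<in> selfadjoint_ops) \<longrightarrow> positive_assignment B A \<longrightarrow>
        cp_assignment B (\<lambda>i. ext_scale (rho_const S) (A i)))
     \<and> (\<forall>c::real. c \<ge> 0 \<longrightarrow>
        (\<forall>B :: 'd \<Rightarrow> ell2 \<Rightarrow>\<^sub>L ell2.
           (\<forall>i. B i \<in> selfadjoint_ops) \<longrightarrow> positive_assignment B A \<longrightarrow>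
           cp_assignment B (\<lambda>i. c *\<^sub>R A i)) \<longrightarrow>
        ennreal c \<le> rho_const S)
     \<and> (0 \<in> interior (level1_real S) \<longrightarrow> 0 < rho_const S \<and> 0 < sigma_const S)
     \<and> (\<forall>(C::real) k (lam :: nat \<Rightarrow> real ^ 'd ^ 'd).
        C > 0 \<longrightarrow> (\<forall>m\<in>{1..k}. rank (lam m) = 1) \<longrightarrow>
        mat 1 \<in> convex hull (lam ` {1..k}) \<longrightarrow>
        (\<forall>m\<in>{1..k}. (\<lambda>x. lam m *v x) ` level1_real S \<subseteq> (\<lambda>x. C *\<^sub>R x) ` level1_real S) \<longrightarrow>
        ennreal (1 / C) \<le> rho_const S \<and> ennreal (1 / C) \<le> sigma_const S)
     \<and> (\<forall>N (v :: nat \<Rightarrow> real ^ 'd).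
        isometric_tight_frame N v \<longrightarrow> invariant_under_projections (level1_real S) N v \<longrightarrow>
        ennreal (1 / real CARD('d)) \<le> rho_const S \<and> ennreal (1 / real CARD('d)) \<le> sigma_const S)"
proof -
  have Ab: "A i \<in> bounded_ops" for i using A[of i] by (simp add: selfadjoint_ops_def)
  have SC: "S n = cpset A n" if "n > 0" for n
    unfolding S by (rule matrix_range_eq_cpset[of A, OF A that])
  define K where "K = state_set (op_form A)"
  have lev: "level1_real S = K"
  proof -
    have "level1_real S = level1_real (cpset A)" unfolding level1_real_def by (simp add: SC)
    then show ?thesis unfolding K_def by (simp only: level1_real_cpset[of A, OF Ab])
  qed
  have z: "0 \<in> state_set (op_form A)"
  proof -
    obtain n where n: "n > 0" and mem: "(\<lambda>i. 0\<^sub>m n n) \<in> S n" using zero by blast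
    define Z :: "'d \<Rightarrow> complex mat" where "Z = (\<lambda>i. 0\<^sub>m n n)"
    have rel: "pos_rel (op_form A) (mat_form n Z)"
      using mem SC[OF n] by (simp add: cpset_def Z_def cp_rel_imp_pos_rel)
    \<comment> \<open>The vector state at the first basis vector carries the zero tuple of level
      \<open>n\<close> to the origin of level one.\<close>
    have ent: "ent Z k 0 0 = pt 0 k" for k using n by (cases k) (simp_all add: Z_def)
    have "0 \<le> (\<Sum>k\<in>UNIV. c k * pt 0 k)" if "\<forall>v. 0 \<le> (\<Sum>k\<in>UNIV. c k * op_form A k v v)" for c
    proof -
      have "0 \<le> (\<Sum>k\<in>UNIV. c k * mat_form n Z k (\<lambda>a. if a = 0 then 1 else 0) (\<lambda>a. if a = 0 then 1 else 0))"
        by (rule rel[unfolded pos_rel_def, rule_format, of c]) (use that in blast)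
      then show ?thesis unfolding mat_form_basis[OF n n] ent .
    qed
    then show ?thesis by (simp add: state_set_def)
  qed
  have SC': "\<forall>n>0. S n = cpset A n" using SC by blast
  note sigma_eq = sigma_const_eq[OF SC']
  note rho_eq = rho_level_eq[OF SC']
  note bounds = rank_one_const_bounds[OF SC' A z]
  have part1: "cp_assignment A (\<lambda>i. ext_scale (sigma_const S) (B i))"
    if B: "\<forall>i. B i \<in> selfadjoint_ops" and pos: "positive_assignment A B"
    for B :: "'d \<Rightarrow> 'k \<Rightarrow>\<^sub>L 'k"
  proof -
    have Bs: "B i \<in> selfadjoint_ops" and Bb: "B i \<in> bounded_ops" for i
      using B by (auto simp: selfadjoint_ops_def)
    have rel: "pos_rel (op_form A) (op_form B)"
      using pos positive_assignment_iff[of B A, OF Bb] by blast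
    \<comment> \<open>\<open>ext_scale\<close> is unspecified for an infinite constant and a nonzero
      vector. If some \<open>B i\<close> is nonzero, one of its states is a state of
      \<open>A\<close> with a nonzero coordinate, which makes the constant finite; otherwise
      \<open>r = 0\<close> will do.\<close>
    have "\<exists>r\<ge>0. ennreal r \<le> sigma_const S \<and> (\<lambda>i. ext_scale (sigma_const S) (B i)) = (\<lambda>i. r *\<^sub>R B i)"
    proof (cases "\<forall>i. B i = 0")
      case True
      then show ?thesis by (intro exI[of _ 0]) (simp add: ext_scale_def)
    next
      case False
      then obtain i where "B i \<noteq> 0" by blast
      then obtain x where "x \<in> state_set (op_form B)" "vec_nth x i \<noteq> 0"
        using nonzero_state[of B i, OF Bs] by blast
      then have "sigma_const S \<noteq> \<infinity>"
        unfolding sigma_eq using state_set_mono[OF rel]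
        by (intro scales_bounded[of A x i, OF A] sigma_set_self[of A, OF A]) auto
      then show ?thesis
        by (intro exI[of _ "enn2real (sigma_const S)"])
          (auto simp: ext_scale_def fun_eq_iff less_top[symmetric])
    qed
    then obtain r where r: "r \<ge> 0" "ennreal r \<le> sigma_const S"
      and eq: "(\<lambda>i. ext_scale (sigma_const S) (B i)) = (\<lambda>i. r *\<^sub>R B i)" by blast
    have mem: "cp_rel (op_form A) (scale_form s (op_form B))" if "s \<in> sigma_set A" for s
      by (rule sigma_setD[of A B, OF A Bs rel that])
    have "r \<in> {s. cp_rel (op_form A) (scale_form s (op_form B))}"
    proof (rule mem_if_ennreal_le_Sup[OF closed_convex_cp_scales])
      show "0 \<in> {s. cp_rel (op_form A) (scale_form s (op_form B))}"
        using mem zero_in_sigma_set[of A, OF A z] by blast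
      show "sigma_set A \<subseteq> {s. cp_rel (op_form A) (scale_form s (op_form B))}" using mem by blast
      show "0 \<le> s" if "s \<in> sigma_set A" for s using that by (simp add: sigma_set_def)
      show "ennreal r \<le> Sup {ennreal s | s. s \<in> sigma_set A}" using r(2) unfolding sigma_eq .
    qed (rule r(1))
    then show ?thesis
      unfolding eq using cp_assignment_iff[of "\<lambda>i. r *\<^sub>R B i" A] scaleR_bounded_ops[OF Bb]
      by (simp add: op_form_scale)
  qed
  have part2: "ennreal c \<le> sigma_const S"
    if c: "c \<ge> 0" and H: "\<forall>B :: 'd \<Rightarrow> ell2 \<Rightarrow>\<^sub>L ell2. (\<forall>i. B i \<in> selfadjoint_ops) \<longrightarrow>
      positive_assignment A B \<longrightarrow> cp_assignment A (\<lambda>i. c *\<^sub>R B i)" for c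
  proof (rule sigma_const_ge[OF SC'], rule sigma_optimal[of A, OF A z c])
    fix B :: "'d \<Rightarrow> ell2 \<Rightarrow>\<^sub>L ell2"
    assume Bs: "\<And>i. B i \<in> selfadjoint_ops" and rel: "pos_rel (op_form A) (op_form B)"
    have Bb: "B i \<in> bounded_ops" for i using Bs[of i] by (simp add: selfadjoint_ops_def)
    have "positive_assignment A B" using rel positive_assignment_iff[of B A, OF Bb] by blast
    then have "cp_assignment A (\<lambda>i. c *\<^sub>R B i)" using H Bs by blast
    then show "cp_rel (op_form A) (scale_form c (op_form B))"
      using cp_assignment_iff[of "\<lambda>i. c *\<^sub>R B i" A] scaleR_bounded_ops[OF Bb]
      by (simp add: op_form_scale)
  qed
  have part3: "cp_assignment B (\<lambda>i. ext_scale (rho_const S) (A i))"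
    if B: "\<forall>i. B i \<in> selfadjoint_ops" and pos: "positive_assignment B A"
    for B :: "'d \<Rightarrow> 'k \<Rightarrow>\<^sub>L 'k"
  proof -
    have Bs: "B i \<in> selfadjoint_ops" for i using B by blast
    have rel: "pos_rel (op_form B) (op_form A)"
      using pos positive_assignment_iff[of A B, OF Ab] by blast
    have "\<exists>r\<ge>0. ennreal r \<le> rho_const S \<and> (\<lambda>i. ext_scale (rho_const S) (A i)) = (\<lambda>i. r *\<^sub>R A i)"
    proof (cases "\<forall>i. A i = 0")
      case True
      then show ?thesis by (intro exI[of _ 0]) (simp add: ext_scale_def)
    next
      case False
      then obtain i where "A i \<noteq> 0" by blast
      then obtain x where x: "x \<in> state_set (op_form A)" "vec_nth x i \<noteq> 0"
        using nonzero_state[of A i, OF A] by blast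
      have "rho_level S 1 = Sup {ennreal s | s. s \<in> rho_set A 1}" by (rule rho_eq) simp
      then have "rho_level S 1 \<noteq> \<infinity>"
        using scales_bounded[of A x i, OF A x, of "rho_set A 1"] rho_set_self[of A, OF A] by simp
      moreover have "rho_const S \<le> rho_level S 1" unfolding rho_const_def by (rule INF_lower) simp
      \<comment> \<open>An infimum is finite as soon as one level is, and level one
        suffices.\<close>
      ultimately have "rho_const S \<noteq> \<infinity>" by (auto simp: top_unique)
      then show ?thesis
        by (intro exI[of _ "enn2real (rho_const S)"])
          (auto simp: ext_scale_def fun_eq_iff less_top[symmetric])
    qed
    then obtain r where r: "r \<ge> 0" "ennreal r \<le> rho_const S"
      and eq: "(\<lambda>i. ext_scale (rho_const S) (A i)) = (\<lambda>i. r *\<^sub>R A i)" by blast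
    have "cp_rel (op_form B) (scale_form r (op_form A))"
    \<comment> \<open>The compressed tuple is the target \<open>A\<close>; for a compression of size
      \<open>n\<close> only the bound of \<open>r\<close> by \<open>rho_level S n\<close> is
      used.\<close>
    proof (rule cp_rel_scale_op_form[of A, OF Ab])
      fix n :: nat and Y assume n: "n > 0" and Y: "Y \<in> cpset A n"
      have mem: "cp_rel (op_form B) (scale_form s (mat_form n Y))" if "s \<in> rho_set A n" for s
        by (rule rho_setD[of A B, OF A Bs rel that Y])
      have "r \<in> {s. cp_rel (op_form B) (scale_form s (mat_form n Y))}"
      proof (rule mem_if_ennreal_le_Sup[OF closed_convex_cp_scales])
        show "0 \<in> {s. cp_rel (op_form B) (scale_form s (mat_form n Y))}"
          using mem zero_in_rho_set[of A, OF A z n] by blast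
        show "rho_set A n \<subseteq> {s. cp_rel (op_form B) (scale_form s (mat_form n Y))}" using mem by blast
        show "0 \<le> s" if "s \<in> rho_set A n" for s using that by (simp add: rho_set_def)
        have "rho_const S \<le> rho_level S n" unfolding rho_const_def by (rule INF_lower) (simp add: n)
        then show "ennreal r \<le> Sup {ennreal s | s. s \<in> rho_set A n}"
          using r(2) unfolding rho_eq[OF n] by (rule order_trans[rotated])
      qed (rule r(1))
      then show "cp_rel (op_form B) (scale_form r (mat_form n Y))" by simp
    qed
    then show ?thesis
      unfolding eq using cp_assignment_iff[of "\<lambda>i. r *\<^sub>R A i" B] scaleR_bounded_ops[OF Ab]
      by (simp add: op_form_scale)
  qed
  have part4: "ennreal c \<le> rho_const S"
    if c: "c \<ge> 0" and H: "\<forall>B :: 'd \<Rightarrow> ell2 \<Rightarrow>\<^sub>L ell2. (\<forall>i. B i \<in> selfadjoint_ops) \<longrightarrow>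
      positive_assignment B A \<longrightarrow> cp_assignment B (\<lambda>i. c *\<^sub>R A i)" for c
  proof (rule rho_const_ge[OF SC'], rule rho_optimal[of A, OF A z c], assumption)
    fix B :: "'d \<Rightarrow> ell2 \<Rightarrow>\<^sub>L ell2"
    assume Bs: "\<And>i. B i \<in> selfadjoint_ops" and rel: "pos_rel (op_form B) (op_form A)"
    have "positive_assignment B A" using rel positive_assignment_iff[of A B, OF Ab] by blast
    then have "cp_assignment B (\<lambda>i. c *\<^sub>R A i)" using H Bs by blast
    then show "cp_rel (op_form B) (scale_form c (op_form A))"
      using cp_assignment_iff[of "\<lambda>i. c *\<^sub>R A i" B] scaleR_bounded_ops[OF Ab]
      by (simp add: op_form_scale)
  qed
  have d0: "real CARD('d) > 0" by simp
  have part5: "0 < rho_const S \<and> 0 < sigma_const S" if int: "0 \<in> interior (level1_real S)"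
  proof -
    obtain e where e: "e > 0" "ball 0 e \<subseteq> K"
      using int unfolding lev mem_interior by blast
    obtain M where M: "M > 0" "\<And>x. x \<in> K \<Longrightarrow> norm x \<le> M"
      using compact_imp_bounded[OF compact_state_set[of A, OF A]] unfolding K_def bounded_pos by blast
    \<comment> \<open>The matrices \<open>d\<close> times the coordinate projections average to the
      identity and map \<open>K\<close> into the ball of radius \<open>d * M\<close>, where
      \<open>d\<close> is the dimension. Division by \<open>C\<close> shrinks this radius to
      \<open>e / 2\<close>, strictly inside the open ball.\<close>
    define C where "C = 2 * real CARD('d) * M / e"
    have C: "C > 0" using M(1) e(1) d0 by (simp add: C_def)
    have "ennreal (1 / C) \<le> rho_const S \<and> ennreal (1 / C) \<le> sigma_const S"
    proof (rule bounds[where M = "UNIV :: 'd set" and t = "\<lambda>_. 1 / real CARD('d)"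
          and u = "\<lambda>m. axis m 1" and w = "\<lambda>m. real CARD('d) *\<^sub>R axis m 1"])
      show "(\<Sum>m\<in>UNIV. 1 / real CARD('d) *
          (vec_nth (axis m 1) a * vec_nth (real CARD('d) *\<^sub>R axis m 1) b)) = (if a = b then 1 else 0)"
        for a b :: 'd
      proof -
        have "1 / real CARD('d) * (vec_nth (axis m 1) a * vec_nth (real CARD('d) *\<^sub>R axis m 1) b)
            = (if m = a then if a = b then 1 else 0 else 0)" for m :: 'd
          by (auto simp: axis_def)
        then show ?thesis by simp
      qed
      fix m :: 'd and x assume "x \<in> state_set (op_form A)"
      then have "norm x \<le> M" using M(2) by (simp add: K_def)
      then have "\<bar>vec_nth x m\<bar> \<le> M" using component_le_norm_cart[of x m] by linarith
      have "norm ((inner (real CARD('d) *\<^sub>R axis m 1) x / C) *\<^sub>R (axis m 1 :: real ^ 'd))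
          = real CARD('d) * \<bar>vec_nth x m\<bar> / C"
        using C by (simp add: inner_axis' abs_mult)
      also have "\<dots> \<le> real CARD('d) * M / C"
        using \<open>\<bar>vec_nth x m\<bar> \<le> M\<close> C by (intro divide_right_mono mult_left_mono) auto
      also have "\<dots> < e" using M(1) e(1) d0 by (simp add: C_def)
      finally show "(inner (real CARD('d) *\<^sub>R axis m 1) x / C) *\<^sub>R axis m 1 \<in> state_set (op_form A)"
        using e(2) unfolding K_def by (auto simp: subset_iff)
    qed (use C in auto)
    moreover have "0 < ennreal (1 / C)" using C by simp
    ultimately show ?thesis using less_le_trans by blast
  qed
  have part6: "ennreal (1 / C) \<le> rho_const S \<and> ennreal (1 / C) \<le> sigma_const S"
    if C: "C > 0" and rk: "\<forall>m\<in>{1..k}. rank (lam m) = 1"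
      and hull: "mat 1 \<in> convex hull (lam ` {1..k})"
      and inv: "\<forall>m\<in>{1..k}. (\<lambda>x. lam m *v x) ` level1_real S \<subseteq> (\<lambda>x. C *\<^sub>R x) ` level1_real S"
    for C :: real and k and lam :: "nat \<Rightarrow> real ^ 'd ^ 'd"
  proof -
    let ?M = "lam ` {1..k}"
    \<comment> \<open>The sum runs over the set of matrices rather than over indices, so coinciding
      \<open>lam m\<close> share one weight.\<close>
    obtain t where t: "\<forall>L\<in>?M. 0 \<le> t L" "sum t ?M = 1" "(\<Sum>L\<in>?M. t L *\<^sub>R L) = mat 1"
      using hull by (subst (asm) convex_hull_finite) auto
    have "\<forall>L\<in>?M. \<exists>p q. \<forall>a b. vec_nth (vec_nth L a) b = vec_nth p a * vec_nth q b"
      using rk rank_one_factorization by blast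
    then obtain u w where uw: "\<And>L a b. L \<in> ?M \<Longrightarrow> vec_nth (vec_nth L a) b = vec_nth (u L) a * vec_nth (w L) b"
      by metis
    show ?thesis
    proof (rule bounds[where M = ?M and t = t and u = u and w = w, OF C])
      show "(\<Sum>L\<in>?M. t L * (vec_nth (u L) a * vec_nth (w L) b)) = (if a = b then 1 else 0)" for a b
      proof -
        have "(\<Sum>L\<in>?M. t L * (vec_nth (u L) a * vec_nth (w L) b)) = vec_nth (vec_nth (\<Sum>L\<in>?M. t L *\<^sub>R L) a) b"
          using uw by (simp add: sum_component)
        also have "\<dots> = (if a = b then 1 else 0)" unfolding t(3) by (simp add: mat_def)
        finally show ?thesis .
      qed
      fix L x assume L: "L \<in> ?M" and x: "x \<in> state_set (op_form A)"
      have "L *v x = inner (w L) x *\<^sub>R u L"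
        by (simp add: vec_eq_iff matrix_vector_mult_def uw[OF L] inner_vec_def sum_distrib_left
            sum_distrib_right mult_ac)
      moreover have "L *v x \<in> (\<lambda>x. C *\<^sub>R x) ` K"
        using inv L x unfolding lev K_def by blast
      ultimately obtain y where "y \<in> K" "inner (w L) x *\<^sub>R u L = C *\<^sub>R y" by auto
      then have "(inner (w L) x / C) *\<^sub>R u L = y"
        using C by (metis divide_inverse_commute less_irrefl scaleR_scaleR scaleR_one left_inverse)
      then show "(inner (w L) x / C) *\<^sub>R u L \<in> state_set (op_form A)"
        using \<open>y \<in> K\<close> by (simp add: K_def)
    qed (use t in auto)
  qed
  have part7: "ennreal (1 / real CARD('d)) \<le> rho_const S \<and> ennreal (1 / real CARD('d)) \<le> sigma_const S"
    if frame: "isometric_tight_frame N v" and inv: "invariant_under_projections (level1_real S) N v"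
    for N and v :: "nat \<Rightarrow> real ^ 'd"
  proof -
    obtain l s where l: "l > 0" "\<And>i. i \<in> {1..N} \<Longrightarrow> norm (v i) = l"
      and s: "s > 0" "(\<Sum>i=1..N. outer (v i) (v i)) = s *\<^sub>R mat 1"
      using frame unfolding isometric_tight_frame_def by blast
    have ab: "(\<Sum>i=1..N. vec_nth (v i) a * vec_nth (v i) b) = (if a = b then s else 0)" for a b
      using arg_cong[OF s(2), of "\<lambda>M. vec_nth (vec_nth M a) b"]
      by (simp add: outer_def mat_def)
    have nv: "(\<Sum>a\<in>UNIV. vec_nth (v i) a * vec_nth (v i) a) = l\<^sup>2" if "i \<in> {1..N}" for i
      using l(2)[OF that] power2_norm_eq_inner[of "v i"] by (simp add: inner_vec_def)
    \<comment> \<open>Taking traces in the frame identity determines the ratio of the frame constant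
      to the squared length.\<close>
    have "real N * l\<^sup>2 = (\<Sum>i=1..N. \<Sum>a\<in>UNIV. vec_nth (v i) a * vec_nth (v i) a)"
      by (simp add: nv)
    also have "\<dots> = (\<Sum>a\<in>UNIV. \<Sum>i=1..N. vec_nth (v i) a * vec_nth (v i) a)" by (rule sum.swap)
    also have "\<dots> = real CARD('d) * s" unfolding ab by simp
    finally have trace: "real N * l\<^sup>2 = real CARD('d) * s" .
    then have N: "N > 0" using s(1) d0 by (cases N) auto
    have factor: "real CARD('d) * s / (real N * l\<^sup>2) = 1" using N l(1) unfolding trace[symmetric] by simp
    show ?thesis
    \<comment> \<open>Each product of \<open>u i\<close> and \<open>w i\<close> is the dimension
      times the projection onto the line of \<open>v i\<close>. By the trace identity their plain
      average is the identity, and invariance under the projections gives \<open>C\<close> equal to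
      the dimension.\<close>
    proof (rule bounds[where M = "{1..N}" and t = "\<lambda>_. 1 / real N"
          and u = "\<lambda>i. (1 / l) *\<^sub>R v i" and w = "\<lambda>i. (real CARD('d) / l) *\<^sub>R v i", OF d0])
      show "(\<Sum>i=1..N. 1 / real N * (vec_nth ((1 / l) *\<^sub>R v i) a * vec_nth ((real CARD('d) / l) *\<^sub>R v i) b))
          = (if a = b then 1 else 0)" for a b
      proof -
        have "(\<Sum>i=1..N. 1 / real N * (vec_nth ((1 / l) *\<^sub>R v i) a * vec_nth ((real CARD('d) / l) *\<^sub>R v i) b))
            = real CARD('d) / (real N * l\<^sup>2) * (\<Sum>i=1..N. vec_nth (v i) a * vec_nth (v i) b)"
          unfolding sum_distrib_left by (intro sum.cong refl) (simp add: power2_eq_square)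
        also have "\<dots> = real CARD('d) / (real N * l\<^sup>2) * (if a = b then s else 0)" unfolding ab ..
        also have "\<dots> = (if a = b then 1 else 0)"
        proof (cases "a = b")
          case True
          show ?thesis
            unfolding if_P[OF True] using factor by (simp only: times_divide_eq_left)
        next
          case False
          show ?thesis unfolding if_not_P[OF False] by (rule mult_zero_right)
        qed
        finally show ?thesis .
      qed
      fix i x assume i: "i \<in> {1..N}" and x: "x \<in> state_set (op_form A)"
      have "((1 / (norm (v i))\<^sup>2) *\<^sub>R outer (v i) (v i)) *v x \<in> K"
        using inv i x unfolding invariant_under_projections_def lev K_def by blast
      also have "((1 / (norm (v i))\<^sup>2) *\<^sub>R outer (v i) (v i)) *v x
          = (inner ((real CARD('d) / l) *\<^sub>R v i) x / real CARD('d)) *\<^sub>R (1 / l) *\<^sub>R v i"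
        by (simp add: vec_eq_iff matrix_vector_mult_def outer_def inner_vec_def l(2)[OF i]
            sum_distrib_left sum_distrib_right sum_divide_distrib power2_eq_square mult_ac)
      finally show "(inner ((real CARD('d) / l) *\<^sub>R v i) x / real CARD('d)) *\<^sub>R (1 / l) *\<^sub>R v i
          \<in> state_set (op_form A)" by (simp add: K_def)
    qed (use N in auto)
  qed
  show ?thesis
    using part1 part2 part3 part4 part5 part6 part7 by (intro conjI allI impI) blast+
qed

end
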